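(* Let $X=G/K$ be a compact irreducible Riemannian symmetric space and let $(\mu_t,t\ge 0)$ be a $K$-bi-invariant convolution semigroup of probability measures on $G$. (1) For all $t\ge 0$ and $\pi\in\widehat G_s$, $P_t\phi_\pi=e^{-t\chi_\pi}\phi_\pi$. (2) If $\mu_t$ has a continuous density for all $t>0$, then for all $t>0$ and $g,h\in G$: (a) $$k_t(gK,hK)=\sum_{\pi\in\widehat G_s}d_\pi e^{-t\overline{\chi_\pi}}\,\phi_\pi(g^{-1}h);$$ (b) $$k_t(gK,hK)=\sum_{\pi\in\widehat G_s}\sum_{j=1}^{d_\pi}d_\pi e^{-t\chi_\pi}\,\overline{\pi_{1j}(g)}\,\pi_{1j}(h).$$
   Context: $X=G/K$ is a compact (globally Riemannian) symmetric space, with $G$ a compact connected Lie group (the identity component of the isometry group of $X$) and $K$ a closed subgroup, the stabiliser of the point $o=eK$; $(G,K)$ is then a compact Gelfand pair. Irreducible means that $\mathrm{Ad}(K)$ acts irreducibly on $\mathfrak p=\mathfrak g\ominus\mathfrak k$, where $\mathfrak g,\mathfrak k$ are the Lie algebras of $G,K$. Haar measures on $G$ and $K$ are normalised; $\sigma$ is the $G$-invariant probability measure on $X$ (image of Haar measure under $\xi:G\to X$, $\xi(g)=gK$). A convolution semigroup is a family of probability measures with $\mu_{s+t}=\mu_s*\mu_t$ for all $s,t\ge0$ and $\mu_t\to\mu_0$ weakly as $t\to0$; it is $K$-bi-invariant if each $\mu_t$ is invariant under left and right translations by $K$, and then $\mu_0=m_K$, the normalised Haar measure of $K$ viewed as a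 measure on $G$. $P_tf(g)=\int_Gf(gh)\,\mu_t(dh)$. $\widehat G$ is the unitary dual of $G$ (one representative $\pi$ on a space $V_\pi$ fixed per class), $d_\pi=\dim V_\pi$, and $\widehat G_s$ is the set of spherical $\pi$, i.e. those having a non-zero $K$-fixed vector, which is then unique up to scalars. For $\pi\in\widehat G_s$ fix an orthonormal basis $e_1^\pi,\dots,e_{d_\pi}^\pi$ of $V_\pi$ with $e_1^\pi$ a unit $K$-fixed vector. The inner product is linear in its first slot; $\pi_{ij}(g)=\langle\pi(g)e_i^\pi,e_j^\pi\rangle$ and $\phi_\pi(g)=\langle e_1^\pi,\pi(g)e_1^\pi\rangle$. $\chi_\pi\in\mathbb C$ ($\pi\in\widehat G_s$) is the characteristic exponent of the semigroup: $\int_G\phi_\pi\,d\mu_t=e^{-t\chi_\pi}$ for all $t\ge0$. (Gangolli's known Lévy–Khintchine formula expresses it as $\chi_\pi=a\kappa_\pi+\int_G(1-\phi_\pi(g))\,\nu(dg)$ with $a\ge0$, $\nu$ a $K$-bi-invariant Lévy measure on $G$, and $\Delta\phi_\pi=-\kappa_\pi\phi_\pi$, where $\Delta$ is the Laplace–Beltrami operator of an $\mathrm{Ad}$-invariant Riemannian metric on $G$ compatible with that of $X$.) When $\mu_t$ has a continuous density (with respect to normalised Haar measure) for $t>0$, $k_t:X\times X\to[0,\infty)$ denotes the continuous transition density with respect to $\sigma$ of the $G$-invariant Feller process on $X$ obtained by projecting under $\xi$ the Lévy process on $G$ with laws $(\mu_t)$; that is, the continuous function such that $\int_X f(y)\,k_t(gK,y)\,\sigma(dy)=\int_G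 f(ghK)\,\mu_t(dh)$ for all $f\in C(X)$, $g\in G$. *)

theory Defs
  imports "HOL-Probability.Probability" "HOL-Algebra.Group" "Jordan_Normal_Form.Matrix"
begin

section \<open>Smooth manifolds\<close>

primrec times_differentiable_on ::
    "nat \<Rightarrow> 'a::euclidean_space set \<Rightarrow> ('a \<Rightarrow> 'b::euclidean_space) \<Rightarrow> bool" where
  "times_differentiable_on 0 S f \<longleftrightarrow> continuous_on S f"
| "times_differentiable_on (Suc n) S f \<longleftrightarrow>
     (\<forall>x\<in>S. f differentiable (at x)) \<and>
     (\<forall>v. times_differentiable_on n S (\<lambda>x. frechet_derivative f (at x) v))"

text \<open>Only used for open sets \<open>S\<close>.\<close>

definition smooth_on :: "'a::euclidean_space set \<Rightarrow> ('a \<Rightarrow> 'b::euclidean_space) \<Rightarrow> bool" where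
  "smooth_on S f \<longleftrightarrow> (\<forall>n. times_differentiable_on n S f)"

type_synonym ('x, 'e) chart = "'x set \<times> ('x \<Rightarrow> 'e)"

definition is_chart :: "'x topology \<Rightarrow> ('x, 'e::euclidean_space) chart \<Rightarrow> bool" where
  "is_chart T = (\<lambda>(U, c). openin T U \<and> open (c ` U) \<and>
     homeomorphic_map (subtopology T U) (top_of_set (c ` U)) c)"

text \<open>Atlases need not be maximal; no notion below depends on the choice of an atlas within
  a smooth structure.\<close>

definition smooth_manifold :: "'x topology \<Rightarrow> ('x, 'e::euclidean_space) chart set \<Rightarrow> bool" where
  "smooth_manifold T A \<longleftrightarrow>
     Hausdorff_space T \<and> second_countable T \<and>
     (\<forall>\<kappa>\<in>A. is_chart T \<kappa>) \<and> (\<Union>(U, c)\<in>A. U) = topspace T \<and>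
     (\<forall>(U, c)\<in>A. \<forall>(V, d)\<in>A. smooth_on (c ` (U \<inter> V)) (d \<circ> inv_into U c))"

definition smooth_map ::
    "'x topology \<Rightarrow> ('x, 'e::euclidean_space) chart set \<Rightarrow>
     'y topology \<Rightarrow> ('y, 'f::euclidean_space) chart set \<Rightarrow> ('x \<Rightarrow> 'y) \<Rightarrow> bool" where
  "smooth_map S A T B f \<longleftrightarrow> continuous_map S T f \<and>
     (\<forall>(U, c)\<in>A. \<forall>(V, d)\<in>B. smooth_on (c ` {x \<in> U. f x \<in> V}) (d \<circ> f \<circ> inv_into U c))"

definition prod_atlas ::
    "('x, 'e) chart set \<Rightarrow> ('y, 'f) chart set \<Rightarrow> ('x \<times> 'y, 'e \<times> 'f) chart set" where
  "prod_atlas A B = (\<lambda>((U, c), (V, d)). (U \<times> V, map_prod c d)) ` (A \<times> B)"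


section \<open>Riemannian symmetric spaces\<close>

definition inner_product_form :: "('e::euclidean_space \<Rightarrow> 'e \<Rightarrow> real) \<Rightarrow> bool" where
  "inner_product_form B \<longleftrightarrow> bilinear B \<and> (\<forall>u v. B u v = B v u) \<and> (\<forall>u. u \<noteq> 0 \<longrightarrow> 0 < B u u)"

text \<open>A Riemannian metric \<open>m\<close> is given by its local representatives: \<open>m \<kappa> q\<close> is the inner product,
  in the coordinates of the chart \<open>\<kappa> = (U, c)\<close>, on the tangent space at the point with
  coordinates \<open>q\<close>.  Preservation by a map \<open>f\<close> is the identity \<open>f\<^sup>* m = m\<close> in coordinates; for
  \<open>f = id\<close> it is the transformation law of a tensor under a change of charts.\<close>

type_synonym ('x, 'e) metric_tensor = "('x, 'e) chart \<Rightarrow> 'e \<Rightarrow> 'e \<Rightarrow> 'e \<Rightarrow> real"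

definition preserves_metric ::
    "('x, 'e::euclidean_space) chart set \<Rightarrow> ('x, 'e) metric_tensor \<Rightarrow> ('x \<Rightarrow> 'x) \<Rightarrow> bool" where
  "preserves_metric A m f \<longleftrightarrow>
     (\<forall>(U, c)\<in>A. \<forall>(V, d)\<in>A. \<forall>x\<in>U. f x \<in> V \<longrightarrow>
        (let D = frechet_derivative (d \<circ> f \<circ> inv_into U c) (at (c x))
         in \<forall>u v. m (V, d) (d (f x)) (D u) (D v) = m (U, c) (c x) u v))"

definition riemannian_metric ::
    "('x, 'e::euclidean_space) chart set \<Rightarrow> ('x, 'e) metric_tensor \<Rightarrow> bool" where
  "riemannian_metric A m \<longleftrightarrow>
     (\<forall>(U, c)\<in>A. (\<forall>q\<in>c ` U. inner_product_form (m (U, c) q)) \<and>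
        (\<forall>u v. smooth_on (c ` U) (\<lambda>q. m (U, c) q u v))) \<and>
     preserves_metric A m id"

text \<open>The manifold is the whole type \<open>'x\<close> with its type-class topology.\<close>

definition isometries ::
    "('x::topological_space, 'e::euclidean_space) chart set \<Rightarrow> ('x, 'e) metric_tensor \<Rightarrow> ('x \<Rightarrow> 'x) set"
  where "isometries A m =
     {f. bij f \<and> smooth_map euclidean A euclidean A f \<and>
         smooth_map euclidean A euclidean A (inv_into UNIV f) \<and> preserves_metric A m f}"

definition riemannian_symmetric_space ::
    "('x::topological_space, 'e::euclidean_space) chart set \<Rightarrow> ('x, 'e) metric_tensor \<Rightarrow> bool" where
  "riemannian_symmetric_space A m \<longleftrightarrow>
     smooth_manifold euclidean A \<and> connected (UNIV :: 'x set) \<and> riemannian_metric A m \<and>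
     (\<forall>p. \<exists>s\<in>isometries A m. s \<circ> s = id \<and> s p = p \<and>
        (\<exists>U. open U \<and> p \<in> U \<and> (\<forall>x\<in>U. s x = x \<longrightarrow> x = p)))"

definition compact_open_topology :: "('x::topological_space \<Rightarrow> 'y::topological_space) topology" where
  "compact_open_topology = topology_generated_by {{f. f ` C \<subseteq> V} | C V. compact C \<and> open V}"

text \<open>The identity component of the isometry group, as an abstract group.\<close>

definition isometry_group_0 ::
    "('x::topological_space, 'e::euclidean_space) chart set \<Rightarrow> ('x, 'e) metric_tensor \<Rightarrow> ('x \<Rightarrow> 'x) monoid"
  where "isometry_group_0 A m =
    \<lparr>carrier = connected_component_of_set (subtopology compact_open_topology (isometries A m)) id,
     mult = (\<circ>), one = id\<rparr>"


section \<open>Lie groups and the adjoint representation\<close>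

definition lie_group ::
    "'g monoid \<Rightarrow> 'g topology \<Rightarrow> ('g, 'f::euclidean_space) chart set \<Rightarrow> bool" where
  "lie_group G T A \<longleftrightarrow>
     group G \<and> topspace T = carrier G \<and> smooth_manifold T A \<and>
     smooth_map (prod_topology T T) (prod_atlas A A) T A (\<lambda>(x, y). x \<otimes>\<^bsub>G\<^esub> y) \<and>
     smooth_map T A T A (\<lambda>x. inv\<^bsub>G\<^esub> x)"

text \<open>The Lie algebra of \<open>G\<close> as a vector space, i.e. the tangent space at the identity, is
  identified with the model space \<open>'f\<close> by a chart around the identity.\<close>

definition Ad :: "'g monoid \<Rightarrow> ('g, 'f::euclidean_space) chart \<Rightarrow> 'g \<Rightarrow> 'f \<Rightarrow> 'f" where
  "Ad G = (\<lambda>(U, c) g.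
     frechet_derivative (c \<circ> (\<lambda>x. g \<otimes>\<^bsub>G\<^esub> x \<otimes>\<^bsub>G\<^esub> inv\<^bsub>G\<^esub> g) \<circ> inv_into U c) (at (c \<one>\<^bsub>G\<^esub>)))"

text \<open>The Lie algebra of a closed subgroup: initial velocities of the one-parameter subgroups
  of \<open>G\<close> that stay in \<open>K\<close>.\<close>

definition subgroup_lie_algebra ::
    "'g monoid \<Rightarrow> 'g topology \<Rightarrow> ('g, 'f::euclidean_space) chart \<Rightarrow> 'g set \<Rightarrow> 'f set" where
  "subgroup_lie_algebra G T = (\<lambda>(U, c) K.
     {v. \<exists>\<gamma> :: real \<Rightarrow> 'g. continuous_map euclideanreal T \<gamma> \<and>
           (\<forall>s t. \<gamma> (s + t) = \<gamma> s \<otimes>\<^bsub>G\<^esub> \<gamma> t) \<and> range \<gamma> \<subseteq> K \<and>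
           ((c \<circ> \<gamma>) has_vector_derivative v) (at 0)})"

text \<open>\<open>\<pp>\<close> is the orthogonal complement of the Lie algebra of \<open>K\<close> with respect to an
  \<open>Ad(G)\<close>-invariant inner product; the choices of the latter and of the chart are immaterial.\<close>

definition Ad_irreducible ::
    "'g monoid \<Rightarrow> 'g topology \<Rightarrow> ('g, 'f::euclidean_space) chart set \<Rightarrow> 'g set \<Rightarrow> bool" where
  "Ad_irreducible G T A K \<longleftrightarrow>
     (\<exists>\<kappa>\<in>A. \<exists>B. \<one>\<^bsub>G\<^esub> \<in> fst \<kappa> \<and> inner_product_form B \<and>
        (\<forall>g\<in>carrier G. \<forall>u v. B (Ad G \<kappa> g u) (Ad G \<kappa> g v) = B u v) \<and>
        (let \<pp> = {v. \<forall>w\<in>subgroup_lie_algebra G T \<kappa> K. B v w = 0}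
         in \<pp> \<noteq> {0} \<and>
            (\<forall>W. subspace W \<and> W \<subseteq> \<pp> \<and> (\<forall>k\<in>K. Ad G \<kappa> k ` W \<subseteq> W) \<longrightarrow> W = {0} \<or> W = \<pp>)))"


section \<open>Compact irreducible symmetric spaces \<open>X = G/K\<close>\<close>

text \<open>\<open>X\<close> is the type \<open>'x\<close> with atlas \<open>AX\<close> and metric \<open>m\<close>; the coset \<open>gK\<close> is the point \<open>g p\<close>, where
  \<open>p\<close> is the base point.  \<open>AG\<close> is the smooth structure making \<open>G\<close> a Lie transformation group
  of \<open>X\<close>.\<close>

definition compact_irreducible_symmetric_space ::
    "('x::topological_space, 'e::euclidean_space) chart set \<Rightarrow> ('x, 'e) metric_tensor \<Rightarrow> 'x \<Rightarrow>
     ('x \<Rightarrow> 'x) monoid \<Rightarrow> ('x \<Rightarrow> 'x) topology \<Rightarrow> ('x \<Rightarrow> 'x, 'f::euclidean_space) chart set \<Rightarrow>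
     ('x \<Rightarrow> 'x) set \<Rightarrow> bool" where
  "compact_irreducible_symmetric_space AX m p G T AG K \<longleftrightarrow>
     riemannian_symmetric_space AX m \<and> compact (UNIV :: 'x set) \<and>
     G = isometry_group_0 AX m \<and> T = subtopology compact_open_topology (carrier G) \<and>
     lie_group G T AG \<and> compact_space T \<and>
     smooth_map (prod_topology T euclidean) (prod_atlas AG AX) euclidean AX (\<lambda>(g, x). g x) \<and>
     K = {g \<in> carrier G. g p = p} \<and> (\<lambda>g. g p) ` carrier G = UNIV \<and>
     Ad_irreducible G T AG K"


section \<open>Measures on topological groups\<close>

definition borel_of_topology :: "'g topology \<Rightarrow> 'g measure" where
  "borel_of_topology T = sigma (topspace T) {U. openin T U}"

definition normalised_haar_measure :: "'g monoid \<Rightarrow> 'g topology \<Rightarrow> 'g measure \<Rightarrow> bool" where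
  "normalised_haar_measure G T M \<longleftrightarrow>
     prob_space M \<and> sets M = sets (borel_of_topology T) \<and>
     (\<forall>g\<in>carrier G. distr M M (\<lambda>x. g \<otimes>\<^bsub>G\<^esub> x) = M)"

definition convolve :: "'g monoid \<Rightarrow> 'g topology \<Rightarrow> 'g measure \<Rightarrow> 'g measure \<Rightarrow> 'g measure" where
  "convolve G T M N = distr (M \<Otimes>\<^sub>M N) (borel_of_topology T) (\<lambda>(x, y). x \<otimes>\<^bsub>G\<^esub> y)"

text \<open>Only the members \<open>\<mu> t\<close> with \<open>t \<ge> 0\<close> are relevant.\<close>

definition convolution_semigroup ::
    "'g monoid \<Rightarrow> 'g topology \<Rightarrow> (real \<Rightarrow> 'g measure) \<Rightarrow> bool" where
  "convolution_semigroup G T \<mu> \<longleftrightarrow>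
     (\<forall>t\<ge>0. prob_space (\<mu> t) \<and> sets (\<mu> t) = sets (borel_of_topology T)) \<and>
     (\<forall>s\<ge>0. \<forall>t\<ge>0. \<mu> (s + t) = convolve G T (\<mu> s) (\<mu> t)) \<and>
     (\<forall>f. continuous_map T euclideanreal f \<and> bounded (f ` topspace T) \<longrightarrow>
        ((\<lambda>t. \<integral>x. f x \<partial>\<mu> t) \<longlongrightarrow> (\<integral>x. f x \<partial>\<mu> 0)) (at_right 0))"

text \<open>The requirement that \<open>\<mu> 0\<close> is the normalised Haar measure \<open>mK\<close> of \<open>K\<close> is part of the notion.
  It does not follow from invariance alone: the constant family at the Haar measure of \<open>G\<close> is
  \<open>K\<close>-bi-invariant too, but has no characteristic exponents.\<close>

definition K_biinvariant_semigroup ::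
    "'g monoid \<Rightarrow> 'g topology \<Rightarrow> 'g set \<Rightarrow> 'g measure \<Rightarrow> (real \<Rightarrow> 'g measure) \<Rightarrow> bool" where
  "K_biinvariant_semigroup G T K mK \<mu> \<longleftrightarrow>
     convolution_semigroup G T \<mu> \<and>
     (\<forall>t\<ge>0. \<forall>k\<in>K. distr (\<mu> t) (\<mu> t) (\<lambda>x. k \<otimes>\<^bsub>G\<^esub> x) = \<mu> t \<and>
                   distr (\<mu> t) (\<mu> t) (\<lambda>x. x \<otimes>\<^bsub>G\<^esub> k) = \<mu> t) \<and>
     \<mu> 0 = distr mK (borel_of_topology T) (\<lambda>x. x)"

definition transition_operator ::
    "'g monoid \<Rightarrow> (real \<Rightarrow> 'g measure) \<Rightarrow> real \<Rightarrow> ('g \<Rightarrow> complex) \<Rightarrow> 'g \<Rightarrow> complex" where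
  "transition_operator G \<mu> t f g = (\<integral>h. f (g \<otimes>\<^bsub>G\<^esub> h) \<partial>\<mu> t)"

definition has_continuous_density :: "'g topology \<Rightarrow> 'g measure \<Rightarrow> 'g measure \<Rightarrow> bool" where
  "has_continuous_density T M N \<longleftrightarrow>
     (\<exists>f. continuous_map T euclideanreal f \<and> (\<forall>x\<in>topspace T. 0 \<le> f x) \<and>
          N = density M (\<lambda>x. ennreal (f x)))"

text \<open>\<open>distr mG borel (\<lambda>g. g p)\<close> is the invariant probability measure \<open>\<sigma>\<close> on \<open>X\<close>.\<close>

definition is_continuous_transition_density ::
    "('x \<Rightarrow> 'x) monoid \<Rightarrow> 'x \<Rightarrow> ('x \<Rightarrow> 'x) measure \<Rightarrow> ('x \<Rightarrow> 'x) measure \<Rightarrow>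
     ('x::topological_space \<Rightarrow> 'x \<Rightarrow> real) \<Rightarrow> bool" where
  "is_continuous_transition_density G p mG M k \<longleftrightarrow>
     continuous_on UNIV (\<lambda>(x, y). k x y) \<and> (\<forall>x y. 0 \<le> k x y) \<and>
     (\<forall>f :: 'x \<Rightarrow> real. continuous_on UNIV f \<longrightarrow>
        (\<forall>g\<in>carrier G.
           (\<integral>y. f y * k (g p) y \<partial>distr mG borel (\<lambda>g. g p)) = (\<integral>h. f ((g \<otimes>\<^bsub>G\<^esub> h) p) \<partial>M)))"

definition transition_density ::
    "('x \<Rightarrow> 'x) monoid \<Rightarrow> 'x \<Rightarrow> ('x \<Rightarrow> 'x) measure \<Rightarrow> (real \<Rightarrow> ('x \<Rightarrow> 'x) measure) \<Rightarrow>
     real \<Rightarrow> 'x::topological_space \<Rightarrow> 'x \<Rightarrow> real" where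
  "transition_density G p mG \<mu> t = (THE k. is_continuous_transition_density G p mG (\<mu> t) k)"


section \<open>The unitary dual and spherical functions\<close>

text \<open>Irreducible unitary representations of a compact group are finite-dimensional, so they are
  realised on the spaces \<open>\<complex>\<^sup>d\<close> with their standard inner product \<open>v \<bullet>c w\<close>, which is linear in \<open>v\<close>.\<close>

type_synonym 'g rep = "'g \<Rightarrow> complex Matrix.mat"

definition rep_dim :: "'g monoid \<Rightarrow> 'g rep \<Rightarrow> nat" where
  "rep_dim G \<pi> = dim_row (\<pi> \<one>\<^bsub>G\<^esub>)"

definition unitary_mat :: "nat \<Rightarrow> complex Matrix.mat \<Rightarrow> bool" where
  "unitary_mat d A \<longleftrightarrow> A \<in> carrier_mat d d \<and>
     (\<forall>v\<in>carrier_vec d. \<forall>w\<in>carrier_vec d. (A *\<^sub>v v) \<bullet>c (A *\<^sub>v w) = v \<bullet>c w)"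

definition unitary_rep :: "'g monoid \<Rightarrow> 'g topology \<Rightarrow> 'g rep \<Rightarrow> bool" where
  "unitary_rep G T \<pi> \<longleftrightarrow>
     (let d = rep_dim G \<pi> in
       (\<forall>g\<in>carrier G. unitary_mat d (\<pi> g)) \<and> \<pi> \<one>\<^bsub>G\<^esub> = 1\<^sub>m d \<and>
       (\<forall>g\<in>carrier G. \<forall>h\<in>carrier G. \<pi> (g \<otimes>\<^bsub>G\<^esub> h) = \<pi> g * \<pi> h) \<and>
       (\<forall>i<d. \<forall>j<d. continuous_map T euclidean (\<lambda>g. \<pi> g $$ (i, j))))"

definition irreducible_unitary_rep :: "'g monoid \<Rightarrow> 'g topology \<Rightarrow> 'g rep \<Rightarrow> bool" where
  "irreducible_unitary_rep G T \<pi> \<longleftrightarrow> unitary_rep G T \<pi> \<and>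
     (let d = rep_dim G \<pi> in d > 0 \<and>
       (\<forall>W \<subseteq> carrier_vec d.
          0\<^sub>v d \<in> W \<and> (\<forall>v\<in>W. \<forall>w\<in>W. v + w \<in> W) \<and> (\<forall>a. \<forall>v\<in>W. a \<cdot>\<^sub>v v \<in> W) \<and>
          (\<forall>g\<in>carrier G. \<forall>v\<in>W. \<pi> g *\<^sub>v v \<in> W)
          \<longrightarrow> W = {0\<^sub>v d} \<or> W = carrier_vec d))"

definition unitarily_equivalent :: "'g monoid \<Rightarrow> 'g rep \<Rightarrow> 'g rep \<Rightarrow> bool" where
  "unitarily_equivalent G \<pi> \<rho> \<longleftrightarrow> rep_dim G \<pi> = rep_dim G \<rho> \<and>
     (\<exists>A. unitary_mat (rep_dim G \<pi>) A \<and> (\<forall>g\<in>carrier G. A * \<pi> g = \<rho> g * A))"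

text \<open>\<open>R\<close> contains exactly one representative of each class.\<close>

definition is_unitary_dual :: "'g monoid \<Rightarrow> 'g topology \<Rightarrow> 'g rep set \<Rightarrow> bool" where
  "is_unitary_dual G T R \<longleftrightarrow>
     (\<forall>\<pi>\<in>R. irreducible_unitary_rep G T \<pi>) \<and>
     (\<forall>\<rho>. irreducible_unitary_rep G T \<rho> \<longrightarrow> (\<exists>!\<pi>. \<pi> \<in> R \<and> unitarily_equivalent G \<pi> \<rho>))"

definition K_fixed :: "'g set \<Rightarrow> 'g rep \<Rightarrow> complex Matrix.vec \<Rightarrow> bool" where
  "K_fixed K \<pi> v \<longleftrightarrow> (\<forall>k\<in>K. \<pi> k *\<^sub>v v = v)"

definition spherical_part :: "'g monoid \<Rightarrow> 'g set \<Rightarrow> 'g rep set \<Rightarrow> 'g rep set" where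
  "spherical_part G K R =
     {\<pi> \<in> R. \<exists>v\<in>carrier_vec (rep_dim G \<pi>). v \<noteq> 0\<^sub>v (rep_dim G \<pi>) \<and> K_fixed K \<pi> v}"

text \<open>\<open>e \<pi> i\<close> for \<open>i = 1, \<dots>, d\<^sub>\<pi>\<close> is the chosen orthonormal basis, with \<open>e \<pi> 1\<close> fixed by \<open>K\<close>.\<close>

definition adapted_basis ::
    "'g monoid \<Rightarrow> 'g set \<Rightarrow> 'g rep \<Rightarrow> (nat \<Rightarrow> complex Matrix.vec) \<Rightarrow> bool" where
  "adapted_basis G K \<pi> b \<longleftrightarrow>
     (\<forall>i\<in>{1..rep_dim G \<pi>}. b i \<in> carrier_vec (rep_dim G \<pi>)) \<and>
     (\<forall>i\<in>{1..rep_dim G \<pi>}. \<forall>j\<in>{1..rep_dim G \<pi>}. b i \<bullet>c b j = (if i = j then 1 else 0)) \<and>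
     K_fixed K \<pi> (b 1)"

definition matrix_coeff ::
    "('g rep \<Rightarrow> nat \<Rightarrow> complex Matrix.vec) \<Rightarrow> 'g rep \<Rightarrow> nat \<Rightarrow> nat \<Rightarrow> 'g \<Rightarrow> complex" where
  "matrix_coeff e \<pi> i j g = (\<pi> g *\<^sub>v e \<pi> i) \<bullet>c e \<pi> j"

definition spherical_function ::
    "('g rep \<Rightarrow> nat \<Rightarrow> complex Matrix.vec) \<Rightarrow> 'g rep \<Rightarrow> 'g \<Rightarrow> complex" where
  "spherical_function e \<pi> g = e \<pi> 1 \<bullet>c (\<pi> g *\<^sub>v e \<pi> 1)"

definition characteristic_exponent ::
    "(real \<Rightarrow> 'g measure) \<Rightarrow> ('g rep \<Rightarrow> nat \<Rightarrow> complex Matrix.vec) \<Rightarrow> 'g rep \<Rightarrow> complex" where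
  "characteristic_exponent \<mu> e \<pi> =
     (THE c. \<forall>t\<ge>0. (\<integral>g. spherical_function e \<pi> g \<partial>\<mu> t) = exp (- of_real t * c))"

end

theory Submission
  imports Defs "Jordan_Normal_Form.Spectral_Radius"
begin

text \<open>
  For a spherical \<open>\<pi>\<close> the operator \<open>\<integral> \<pi>(g) \<mu>\<^sub>t(dg)\<close> maps into the \<open>K\<close>-fixed vectors, and so does its adjoint.
  These form a line, hence the operator is a multiple of the projection onto \<open>e\<^sub>1\<close>; this gives (1), and the
  multiples form a continuous one-parameter semigroup of complex numbers, i.e. an exponential. For (2), the
  continuous density \<open>f\<^sub>t\<close> therefore has the same matrix coefficients as the series of spherical functions.
  The series converges absolutely by Bessel's inequality for \<open>f\<^sub>t\<^sub>/\<^sub>2\<close>, since \<open>e\<^sup>-\<^sup>t\<^sup>\<chi>\<close> is a square, and a continuous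
  function is determined by its coefficients (Peter--Weyl).

  That the \<open>K\<close>-fixed vectors form a line needs no geodesics: conjugation by the symmetry at the base point is an
  involution \<open>\<theta>\<close> of \<open>G\<close>, and unique local square roots in the Lie group \<open>G\<close>, together with the isolated fixed
  point of the symmetry, show \<open>\<theta>(g) \<in> K g\<^sup>-\<^sup>1 K\<close> for \<open>g\<close> near the identity. For matrix coefficients this propagates
  from a neighbourhood of the identity to the connected group \<open>G\<close>.
\<close>

section \<open>Continuous functions on compact groups\<close>

text \<open>The spherical function is the complex conjugate of the coefficient
  \<open>coef \<pi> (e \<pi> 1) (e \<pi> 1)\<close>, because the group acts in its second slot.
  Fourier analysis of the density therefore yields the terms d e^(-t chi) times the coefficient at
  g^(-1) h, which is series (b) by Parseval. Series (a) is the termwise conjugate, and both have the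
  same sum because a density is real. The factor d is forced by Schur orthogonality: a coefficient
  of unit vectors has squared L^2 norm 1/d. Bessel at half the time bounds the sum of d |e^(-t
  chi)|, and this dominates the series uniformly since coefficients of unit vectors are at most 1 in
  modulus. Bessel at time t alone would give only L^2 convergence, not an identity at each point.
  \<open>G\<close> is a set of maps with an explicit topology \<open>T\<close>. The analysis uses
  continuous functions on \<open>carrier G\<close>, integrals and uniform limits, and no Hilbert
  space is completed. Full support of Haar measure replaces "almost everywhere" by "everywhere"; it
  also makes the transition density unique, as its definition by a definite description
  requires.\<close>

lemma space_borel_of_topology [simp]: "space (borel_of_topology T) = topspace T"
  by (auto simp: borel_of_topology_def openin_subset space_measure_of_conv)

lemma sets_borel_of_topology: "sets (borel_of_topology T) = sigma_sets (topspace T) {U. openin T U}"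
  unfolding borel_of_topology_def by (rule sets_measure_of) (auto dest: openin_subset)

lemma openin_in_sets: "openin T U \<Longrightarrow> U \<in> sets (borel_of_topology T)"
  by (auto simp: sets_borel_of_topology)

lemma continuous_map_measurable:
  assumes "continuous_map T S f"
  shows "f \<in> borel_of_topology T \<rightarrow>\<^sub>M borel_of_topology S"
  unfolding borel_of_topology_def[of S]
proof (rule measurable_measure_of)
  show "{U. openin S U} \<subseteq> Pow (topspace S)" by (auto dest: openin_subset)
  show "f \<in> space (borel_of_topology T) \<rightarrow> topspace S"
    using assms by (auto simp: continuous_map_def)
  fix U assume "U \<in> {U. openin S U}"
  then have "openin T {x \<in> topspace T. f x \<in> U}" using assms by (auto simp: continuous_map_def)
  moreover have "f -` U \<inter> space (borel_of_topology T) = {x \<in> topspace T. f x \<in> U}" by auto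
  ultimately show "f -` U \<inter> space (borel_of_topology T) \<in> sets (borel_of_topology T)"
    by (simp add: openin_in_sets)
qed

lemma continuous_map_borel_measurable:
  assumes "continuous_map T euclidean f"
  shows "f \<in> borel_measurable (borel_of_topology T)"
proof (rule borel_measurableI)
  fix U :: "'b set" assume "open U"
  then have "openin T {x \<in> topspace T. f x \<in> U}" using assms by (auto simp: continuous_map_def)
  moreover have "f -` U \<inter> space (borel_of_topology T) = {x \<in> topspace T. f x \<in> U}" by auto
  ultimately show "f -` U \<inter> space (borel_of_topology T) \<in> sets (borel_of_topology T)"
    by (simp add: openin_in_sets)
qed

text \<open>The product sigma-algebra is generated by rectangles only; second countability writes an
  open subset of the product as a countable union of basic open rectangles. Joint measurability of
  the group multiplication depends on this.\<close>

lemma openin_prod_sets: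
  assumes "second_countable T" "second_countable S" "openin (prod_topology T S) W"
  shows "W \<in> sets (borel_of_topology T \<Otimes>\<^sub>M borel_of_topology S)"
proof -
  obtain A where A: "countable A" "\<And>V. V \<in> A \<Longrightarrow> openin T V"
    "\<And>U x. openin T U \<Longrightarrow> x \<in> U \<Longrightarrow> \<exists>V\<in>A. x \<in> V \<and> V \<subseteq> U"
    using assms(1) unfolding second_countable_def by metis
  obtain B where B: "countable B" "\<And>V. V \<in> B \<Longrightarrow> openin S V"
    "\<And>U x. openin S U \<Longrightarrow> x \<in> U \<Longrightarrow> \<exists>V\<in>B. x \<in> V \<and> V \<subseteq> U"
    using assms(2) unfolding second_countable_def by metis
  define C where "C = {(U, V). (U, V) \<in> A \<times> B \<and> U \<times> V \<subseteq> W}"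
  have "countable C" using A(1) B(1) by (intro countable_subset[of C "A \<times> B"]) (auto simp: C_def)
  moreover have "W = (\<Union>(U, V)\<in>C. U \<times> V)"
  proof
    show "(\<Union>(U, V)\<in>C. U \<times> V) \<subseteq> W" by (auto simp: C_def)
    show "W \<subseteq> (\<Union>(U, V)\<in>C. U \<times> V)"
    proof
      fix z assume "z \<in> W"
      obtain x y where z: "z = (x, y)" by force
      obtain U V where UV: "openin T U" "openin S V" "x \<in> U" "y \<in> V" "U \<times> V \<subseteq> W"
        using assms(3) \<open>z \<in> W\<close> z unfolding openin_prod_topology_alt by meson
      obtain U' V' where "U' \<in> A" "x \<in> U'" "U' \<subseteq> U" "V' \<in> B" "y \<in> V'" "V' \<subseteq> V"
        using A(3)[OF UV(1,3)] B(3)[OF UV(2,4)] by auto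
      then have "(U', V') \<in> C" "z \<in> U' \<times> V'" using UV(5) z by (auto simp: C_def)
      then show "z \<in> (\<Union>(U, V)\<in>C. U \<times> V)" by auto
    qed
  qed
  moreover have "case c of (U, V) \<Rightarrow> U \<times> V \<in> sets (borel_of_topology T \<Otimes>\<^sub>M borel_of_topology S)"
    if "c \<in> C" for c
    using that A(2) B(2) by (auto simp: C_def intro!: pair_measureI openin_in_sets)
  ultimately show ?thesis
    by (auto intro!: sets.countable_UN' simp: case_prod_beta)
qed

lemma continuous_map_prod_measurable:
  assumes "second_countable T" "second_countable S" "continuous_map (prod_topology T S) R f"
  shows "f \<in> borel_of_topology T \<Otimes>\<^sub>M borel_of_topology S \<rightarrow>\<^sub>M borel_of_topology R"
  unfolding borel_of_topology_def[of R]
proof (rule measurable_measure_of)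
  let ?M = "borel_of_topology T \<Otimes>\<^sub>M borel_of_topology S"
  show "{U. openin R U} \<subseteq> Pow (topspace R)" by (auto dest: openin_subset)
  show "f \<in> space ?M \<rightarrow> topspace R"
    using assms by (auto simp: continuous_map_def space_pair_measure)
  fix U assume "U \<in> {U. openin R U}"
  then have "openin (prod_topology T S) {x \<in> topspace (prod_topology T S). f x \<in> U}"
    using assms by (auto simp: continuous_map_def)
  moreover have "f -` U \<inter> space ?M = {x \<in> topspace (prod_topology T S). f x \<in> U}"
    by (auto simp: space_pair_measure)
  ultimately show "f -` U \<inter> space ?M \<in> sets ?M"
    using openin_prod_sets[OF assms(1,2)] by simp
qed

lemma borel_of_topology_euclidean: "sets (borel_of_topology euclidean) = sets borel"
  by (simp add: borel_of_topology_def borel_def)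

lemma continuous_map_prod_borel_measurable:
  assumes "second_countable T" "second_countable S" "continuous_map (prod_topology T S) euclidean f"
  shows "f \<in> borel_measurable (borel_of_topology T \<Otimes>\<^sub>M borel_of_topology S)"
  using continuous_map_prod_measurable[OF assms] measurable_cong_sets[OF refl borel_of_topology_euclidean]
  by blast

lemma continuous_map_mult:
  fixes f g :: "'a \<Rightarrow> 'b::real_normed_algebra"
  shows "continuous_map X euclidean f \<Longrightarrow> continuous_map X euclidean g \<Longrightarrow>
    continuous_map X euclidean (\<lambda>x. f x * g x)"
  by (simp add: continuous_map_atin tendsto_mult)

lemma continuous_map_cnj:
  "continuous_map X euclidean f \<Longrightarrow> continuous_map X euclidean (\<lambda>x. cnj (f x))"
  by (simp add: continuous_map_atin tendsto_cnj)

lemma continuous_map_of_real: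
  "continuous_map X euclidean f \<Longrightarrow> continuous_map X euclidean (\<lambda>x. complex_of_real (f x))"
  by (simp add: continuous_map_atin tendsto_of_real)

lemma continuous_map_Re:
  "continuous_map X euclidean f \<Longrightarrow> continuous_map X euclidean (\<lambda>x. Re (f x))"
  by (simp add: continuous_map_atin tendsto_Re)

lemma continuous_map_Im:
  "continuous_map X euclidean f \<Longrightarrow> continuous_map X euclidean (\<lambda>x. Im (f x))"
  by (simp add: continuous_map_atin tendsto_Im)

lemma continuous_map_compose':
  "continuous_map S R f \<Longrightarrow> continuous_map X S a \<Longrightarrow> continuous_map X R (\<lambda>z. f (a z))"
  using continuous_map_compose[of X S a R f] by (simp add: o_def)

lemmas cont_intros = continuous_map_mult continuous_map_cnj continuous_map_of_real
  continuous_map_add continuous_map_diff continuous_map_minus continuous_map_sum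
  continuous_map_canonical_const continuous_map_norm continuous_map_fst continuous_map_snd

lemma compact_space_bounded_image:
  assumes "compact_space T" "continuous_map T euclidean (f :: 'a \<Rightarrow> 'b::metric_space)"
  shows "bounded (f ` topspace T)"
  using image_compactin[of T "topspace T" euclidean f] assms
  by (auto simp: compact_space_def compact_imp_bounded)

section \<open>Haar measure and integrals of continuous functions on a compact group\<close>

locale compact_group =
  fixes G :: "'g monoid" (structure) and T :: "'g topology" and m :: "'g measure"
  assumes group: "group G" and topspace: "topspace T = carrier G"
    and compact: "compact_space T" and second_countable: "second_countable T"
    and continuous_mult: "continuous_map (prod_topology T T) T (\<lambda>(x, y). x \<otimes> y)"
    and continuous_inv: "continuous_map T T (\<lambda>x. inv x)"
    and haar: "normalised_haar_measure G T m"
begin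

sublocale group G by (rule group)

definition borel_prob :: "'g measure \<Rightarrow> bool" where
  "borel_prob M \<longleftrightarrow> prob_space M \<and> sets M = sets (borel_of_topology T)"

lemma borel_prob_haar: "borel_prob m"
  using haar by (auto simp: normalised_haar_measure_def borel_prob_def)

lemma space_borel_prob: "borel_prob M \<Longrightarrow> space M = carrier G"
  using topspace sets_eq_imp_space_eq[of M "borel_of_topology T"] by (simp add: borel_prob_def)

lemma continuous_mult':
  assumes "continuous_map X T a" "continuous_map X T b"
  shows "continuous_map X T (\<lambda>z. a z \<otimes> b z)"
  using continuous_map_compose'[OF continuous_mult, of X "\<lambda>z. (a z, b z)"] assms
  by (simp add: continuous_map_pairedI)

lemma continuous_inv': "continuous_map X T a \<Longrightarrow> continuous_map X T (\<lambda>z. inv (a z))"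
  by (rule continuous_map_compose'[OF continuous_inv])

lemma continuous_const': "c \<in> carrier G \<Longrightarrow> continuous_map X T (\<lambda>z. c)"
  by (simp add: topspace)

lemma continuous_id': "continuous_map T T (\<lambda>z. z)"
  using continuous_map_id by (simp add: id_def)

lemmas cont_group = continuous_mult' continuous_inv' continuous_const' continuous_id'
  continuous_map_fst continuous_map_snd

abbreviation cf :: "('g \<Rightarrow> complex) \<Rightarrow> bool" where
  "cf \<equiv> continuous_map T euclidean"

lemma cf_bounded:
  fixes f :: "'g \<Rightarrow> 'b::real_normed_vector"
  assumes "continuous_map T euclidean f"
  obtains C where "C > 0" "\<And>x. x \<in> carrier G \<Longrightarrow> norm (f x) \<le> C"
  using compact_space_bounded_image[OF compact assms] unfolding bounded_pos topspace by auto

lemma measurable_borel_prob: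
  fixes f :: "'g \<Rightarrow> 'b::topological_space"
  assumes "borel_prob M" "continuous_map T euclidean f"
  shows "f \<in> borel_measurable M"
  using continuous_map_borel_measurable[OF assms(2)] assms(1) measurable_cong_sets[of M _ borel borel]
  by (auto simp: borel_prob_def)

lemma integrable_cf:
  fixes f :: "'g \<Rightarrow> 'b::euclidean_space"
  assumes "borel_prob M" "continuous_map T euclidean f"
  shows "integrable M f"
proof -
  interpret prob_space M using assms(1) by (simp add: borel_prob_def)
  obtain C where "C > 0" "\<And>x. x \<in> carrier G \<Longrightarrow> norm (f x) \<le> C" using cf_bounded[OF assms(2)] by auto
  then show ?thesis
    by (intro integrable_const_bound[of _ C] measurable_borel_prob assms)
       (auto simp: space_borel_prob[OF assms(1)])
qed

lemma norm_integral_le: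
  fixes f :: "'g \<Rightarrow> 'b::euclidean_space"
  assumes "borel_prob M" "continuous_map T euclidean f" "\<And>x. x \<in> carrier G \<Longrightarrow> norm (f x) \<le> C"
  shows "norm (integral\<^sup>L M f) \<le> C"
proof -
  interpret prob_space M using assms(1) by (simp add: borel_prob_def)
  have "norm (integral\<^sup>L M f) \<le> (\<integral>x. norm (f x) \<partial>M)" by (rule integral_norm_bound)
  also have "\<dots> \<le> (\<integral>x. C \<partial>M)"
    using assms by (intro integral_mono integrable_cf cont_intros) (auto simp: space_borel_prob)
  finally show ?thesis by (simp add: prob_space)
qed

lemma integral_const:
  fixes c :: "'b::euclidean_space"
  assumes "borel_prob M" shows "(\<integral>x. c \<partial>M) = c"
proof -
  interpret prob_space M using assms(1) by (simp add: borel_prob_def)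
  show ?thesis by (simp add: prob_space)
qed

lemma integral_cong':
  assumes "borel_prob M" "\<And>x. x \<in> carrier G \<Longrightarrow> f x = g x"
  shows "integral\<^sup>L M f = integral\<^sup>L M g"
  using assms by (intro Bochner_Integration.integral_cong) (auto simp: space_borel_prob)

text \<open>Second countability makes \<open>F\<close> measurable for the product sigma-algebra;
  compactness makes it bounded, hence integrable for a product of probability measures.\<close>

lemma
  fixes F :: "'g \<times> 'g \<Rightarrow> complex"
  assumes M: "borel_prob M" and N: "borel_prob N"
    and F: "continuous_map (prod_topology T T) euclidean F"
  shows fubini: "(\<integral>x. (\<integral>y. F (x, y) \<partial>N) \<partial>M) = (\<integral>y. (\<integral>x. F (x, y) \<partial>M) \<partial>N)"
    and integral_pair: "(\<integral>z. F z \<partial>(M \<Otimes>\<^sub>M N)) = (\<integral>x. (\<integral>y. F (x, y) \<partial>N) \<partial>M)"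
proof -
  interpret M: prob_space M using M by (simp add: borel_prob_def)
  interpret N: prob_space N using N by (simp add: borel_prob_def)
  interpret P: pair_prob_space M N ..
  have sets: "sets (M \<Otimes>\<^sub>M N) = sets (borel_of_topology T \<Otimes>\<^sub>M borel_of_topology T)"
    using M N by (intro sets_pair_measure_cong) (auto simp: borel_prob_def)
  have meas: "F \<in> borel_measurable (M \<Otimes>\<^sub>M N)"
    using continuous_map_prod_borel_measurable[OF second_countable second_countable F]
      measurable_cong_sets[OF sets refl] by blast
  have "compact_space (prod_topology T T)" using compact by (simp add: compact_space_prod_topology)
  then have "bounded (F ` (carrier G \<times> carrier G))"
    using compact_space_bounded_image[OF _ F] topspace by simp
  then obtain C where C: "\<And>x. x \<in> carrier G \<times> carrier G \<Longrightarrow> norm (F x) \<le> C"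
    unfolding bounded_iff by blast
  have int: "integrable (M \<Otimes>\<^sub>M N) F"
    by (intro P.integrable_const_bound[of _ C] meas)
       (auto simp: space_pair_measure space_borel_prob[OF M] space_borel_prob[OF N] intro!: C)
  have int': "integrable (M \<Otimes>\<^sub>M N) (case_prod (\<lambda>x y. F (x, y)))" using int by (simp add: case_prod_beta')
  show "(\<integral>x. (\<integral>y. F (x, y) \<partial>N) \<partial>M) = (\<integral>y. (\<integral>x. F (x, y) \<partial>M) \<partial>N)"
    using P.Fubini_integral[OF int'] by simp
  show "(\<integral>z. F z \<partial>(M \<Otimes>\<^sub>M N)) = (\<integral>x. (\<integral>y. F (x, y) \<partial>N) \<partial>M)"
    using P.integral_fst'[OF int] by simp
qed

text \<open>Compactness of the integration variable makes continuity in the parameter uniform (tube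
  lemma), and the integrals differ by at most the uniform gap.\<close>

lemma continuous_parameter_integral:
  fixes F :: "'g \<times> 'g \<Rightarrow> complex"
  assumes N: "borel_prob N" and F: "continuous_map (prod_topology T T) euclidean F"
  shows "cf (\<lambda>x. \<integral>y. F (x, y) \<partial>N)"
  unfolding continuous_map_atin limitin_canonical_iff tendsto_iff
proof (intro ballI allI impI)
  fix x0 and e :: real assume x0: "x0 \<in> topspace T" and e: "e > 0"
  have slice: "cf (\<lambda>y. F (x, y))" if "x \<in> carrier G" for x
    by (rule continuous_map_compose'[OF F]) (auto simp: topspace that intro!: continuous_map_pairedI cont_group)
  have slice2: "continuous_map (prod_topology T T) euclidean (\<lambda>z. F (x0, snd z))"
    using continuous_map_compose'[OF slice continuous_map_snd] x0 topspace by simp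
  \<comment> \<open>A tube \<open>U \<times> topspace T\<close> fits into this open set around the
    slice at \<open>x0\<close>; the radius e/2 leaves room for a strict inequality after
    integration.\<close>
  define W where "W = {z \<in> topspace (prod_topology T T). F z - F (x0, snd z) \<in> ball 0 (e/2)}"
  have "openin (prod_topology T T) W"
    unfolding W_def
    by (rule openin_continuous_map_preimage[of _ euclidean]) (auto intro!: cont_intros F slice2)
  moreover have "{x0} \<times> topspace T \<subseteq> W" using x0 e by (auto simp: W_def)
  ultimately obtain U V where UV: "openin T U" "x0 \<in> U" "topspace T \<subseteq> V" "U \<times> V \<subseteq> W"
    using tube_lemma_right[of T T W "topspace T" x0] compact x0 unfolding compact_space_def by auto
  have "dist (\<integral>y. F (x, y) \<partial>N) (\<integral>y. F (x0, y) \<partial>N) < e" if "x \<in> U" for x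
  proof -
    have x: "x \<in> carrier G" "x0 \<in> carrier G" using that UV(1) x0 topspace openin_subset by auto
    have "norm (F (x, y) - F (x0, y)) \<le> e/2" if y: "y \<in> carrier G" for y
    proof -
      have "(x, y) \<in> W" using \<open>x \<in> U\<close> UV(3,4) y topspace by auto
      then show ?thesis by (simp add: W_def)
    qed
    then have "norm (\<integral>y. F (x, y) - F (x0, y) \<partial>N) \<le> e/2"
      by (intro norm_integral_le[OF N] cont_intros slice x)
    then show ?thesis
      using e by (simp add: dist_norm Bochner_Integration.integral_diff integrable_cf[OF N] slice x)
  qed
  then show "\<forall>\<^sub>F x in atin T x0. dist (\<integral>y. F (x, y) \<partial>N) (\<integral>y. F (x0, y) \<partial>N) < e"
    using UV(1,2) x0 by (auto simp: eventually_atin)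
qed

lemma integral_distr_left:
  fixes f :: "'g \<Rightarrow> complex"
  assumes M: "borel_prob M" and a: "continuous_map T T a" and f: "cf f" and eq: "distr M M a = M"
  shows "(\<integral>x. f (a x) \<partial>M) = (\<integral>x. f x \<partial>M)"
proof -
  have "a \<in> M \<rightarrow>\<^sub>M M"
    using continuous_map_measurable[OF a] M measurable_cong_sets by (auto simp: borel_prob_def)
  then have "(\<integral>x. f x \<partial>distr M M a) = (\<integral>x. f (a x) \<partial>M)"
    by (rule integral_distr) (rule measurable_borel_prob[OF M f])
  with eq show ?thesis by simp
qed

lemma left_invariant:
  assumes "cf f" "g \<in> carrier G"
  shows "(\<integral>x. f (g \<otimes> x) \<partial>m) = (\<integral>x. f x \<partial>m)"
  using haar assms
  by (intro integral_distr_left[OF borel_prob_haar]) (auto simp: normalised_haar_measure_def intro!: cont_group)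

text \<open>Unimodularity from left invariance alone: in the double integral of f(x^(-1) y),
  integrating over y first gives the integral of f, integrating over x first gives that of f
  composed with inversion.\<close>

lemma inverse_invariant:
  assumes f: "cf f"
  shows "(\<integral>x. f (inv x) \<partial>m) = (\<integral>x. f x \<partial>m)"
proof -
  have "(\<integral>x. f x \<partial>m) = (\<integral>x. (\<integral>y. f (inv x \<otimes> y) \<partial>m) \<partial>m)"
    using left_invariant[OF f] integral_const[OF borel_prob_haar, of "\<integral>x. f x \<partial>m"]
    by (simp cong: integral_cong'[OF borel_prob_haar])
  also have "\<dots> = (\<integral>y. (\<integral>x. f (inv x \<otimes> y) \<partial>m) \<partial>m)"
    using fubini[OF borel_prob_haar borel_prob_haar, of "\<lambda>z. f (inv (fst z) \<otimes> snd z)"]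
    by (simp add: continuous_map_compose'[OF f] cont_group)
  also have "\<dots> = (\<integral>y. (\<integral>x. f (inv x) \<partial>m) \<partial>m)"
  proof (rule integral_cong'[OF borel_prob_haar])
    fix y assume y: "y \<in> carrier G"
    have "(\<integral>x. f (inv x \<otimes> y) \<partial>m) = (\<integral>x. f (inv (inv y \<otimes> x)) \<partial>m)"
      using y by (intro integral_cong'[OF borel_prob_haar]) (simp add: inv_mult_group)
    also have "\<dots> = (\<integral>x. f (inv x) \<partial>m)"
      using left_invariant[of "\<lambda>x. f (inv x)" "inv y"] y
      by (simp add: continuous_map_compose'[OF f] cont_group)
    finally show "(\<integral>x. f (inv x \<otimes> y) \<partial>m) = (\<integral>x. f (inv x) \<partial>m)" .
  qed
  also have "\<dots> = (\<integral>x. f (inv x) \<partial>m)" by (rule integral_const[OF borel_prob_haar])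
  finally show ?thesis by simp
qed

lemma right_invariant:
  assumes f: "cf f" and g: "g \<in> carrier G"
  shows "(\<integral>x. f (x \<otimes> g) \<partial>m) = (\<integral>x. f x \<partial>m)"
proof -
  have "(\<integral>x. f (x \<otimes> g) \<partial>m) = (\<integral>x. f (inv x \<otimes> g) \<partial>m)"
    by (intro inverse_invariant[symmetric] continuous_map_compose'[OF f] cont_group g)
  also have "\<dots> = (\<integral>x. f (inv (inv g \<otimes> x)) \<partial>m)"
    using g by (intro integral_cong'[OF borel_prob_haar]) (simp add: inv_mult_group)
  also have "\<dots> = (\<integral>x. f (inv x) \<partial>m)"
    using left_invariant[of "\<lambda>x. f (inv x)" "inv g"] g
    by (simp add: continuous_map_compose'[OF f] cont_group)
  also have "\<dots> = (\<integral>x. f x \<partial>m)" by (rule inverse_invariant[OF f])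
  finally show ?thesis .
qed

text \<open>By compactness finitely many translates of the open set where \<open>f\<close> exceeds
  half of \<open>f x0\<close> cover the group. The sum of the corresponding translates of
  \<open>f\<close> is bounded below by f x0 / 2, yet its integral is zero by left
  invariance.\<close>

lemma haar_full_support:
  fixes f :: "'g \<Rightarrow> real"
  assumes f: "continuous_map T euclidean f" and nonneg: "\<And>x. x \<in> carrier G \<Longrightarrow> 0 \<le> f x"
    and zero: "(\<integral>x. f x \<partial>m) = 0" and x0: "x0 \<in> carrier G"
  shows "f x0 = 0"
proof (rule ccontr)
  assume "f x0 \<noteq> 0"
  then have pos: "f x0 > 0" using nonneg[OF x0] by simp
  define U where "U g = {x \<in> topspace T. f (g \<otimes> x) \<in> {f x0 / 2<..}}" for g
  have cfg: "continuous_map T euclidean (\<lambda>x. f (g \<otimes> x))" if "g \<in> carrier G" for g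
    by (intro continuous_map_compose'[OF f] cont_group that)
  have "openin T (U g)" if "g \<in> carrier G" for g
    unfolding U_def by (rule openin_continuous_map_preimage[of _ euclidean]) (auto intro!: cfg that)
  moreover have "topspace T \<subseteq> \<Union> (U ` carrier G)"
  proof
    fix x assume "x \<in> topspace T"
    then have "x \<in> carrier G" by (simp add: topspace)
    moreover from this have "x0 \<otimes> inv x \<otimes> x = x0" using x0 by (simp add: m_assoc)
    ultimately have "x \<in> U (x0 \<otimes> inv x)" "x0 \<otimes> inv x \<in> carrier G" using pos x0 topspace by (auto simp: U_def)
    then show "x \<in> \<Union> (U ` carrier G)" by blast
  qed
  ultimately obtain D where D: "finite D" "D \<subseteq> carrier G" "topspace T \<subseteq> \<Union> (U ` D)"
    using compactinD[of T "topspace T" "U ` carrier G"] compact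
    unfolding compact_space_def by (smt (verit) finite_subset_image image_iff)
  define s where "s x = (\<Sum>g\<in>D. f (g \<otimes> x))" for x
  have cs: "continuous_map T euclidean s"
    unfolding s_def using D by (intro cont_intros cfg) auto
  have inv: "(\<integral>x. f (g \<otimes> x) \<partial>m) = 0" if g: "g \<in> carrier G" for g
  proof -
    have "complex_of_real (\<integral>x. f (g \<otimes> x) \<partial>m) = complex_of_real (\<integral>x. f x \<partial>m)"
      using left_invariant[OF continuous_map_of_real[OF f] g] by simp
    then show ?thesis using zero by simp
  qed
  have "(\<integral>x. s x \<partial>m) = (\<Sum>g\<in>D. \<integral>x. f (g \<otimes> x) \<partial>m)"
    unfolding s_def using D by (intro Bochner_Integration.integral_sum integrable_cf borel_prob_haar cfg) auto
  also have "\<dots> = 0" using inv D by (auto intro!: sum.neutral)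
  finally have s0: "(\<integral>x. s x \<partial>m) = 0" .
  have "f x0 / 2 \<le> s x" if x: "x \<in> carrier G" for x
  proof -
    obtain g where g: "g \<in> D" "x \<in> U g" using D(3) x topspace by auto
    have "f (g \<otimes> x) \<le> s x"
      unfolding s_def using D g x by (intro member_le_sum nonneg) auto
    then show ?thesis using g by (auto simp: U_def)
  qed
  then have "(\<integral>x. f x0 / 2 \<partial>m) \<le> (\<integral>x. s x \<partial>m)"
    by (intro integral_mono integrable_cf borel_prob_haar cs) (auto simp: space_borel_prob[OF borel_prob_haar])
  then show False using s0 pos integral_const[OF borel_prob_haar, of "f x0 / 2"] by simp
qed

section \<open>The L^2 inner product on continuous functions\<close>

definition ip :: "('g \<Rightarrow> complex) \<Rightarrow> ('g \<Rightarrow> complex) \<Rightarrow> complex" where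
  "ip f h = (\<integral>x. f x * cnj (h x) \<partial>m)"

definition nsq :: "('g \<Rightarrow> complex) \<Rightarrow> real" where
  "nsq f = (\<integral>x. (cmod (f x))\<^sup>2 \<partial>m)"

lemma cont_cmod_sq: "cf f \<Longrightarrow> continuous_map T euclidean (\<lambda>x. (cmod (f x))\<^sup>2)"
  unfolding power2_eq_square by (intro cont_intros)

lemma ip_self: "ip f f = of_real (nsq f)"
  unfolding ip_def nsq_def by (simp add: complex_norm_square flip: of_real_power integral_complex_of_real)

lemma nsq_nonneg: "nsq f \<ge> 0"
  unfolding nsq_def by simp

lemma nsq_eq_0:
  assumes "cf f" "nsq f = 0" "x \<in> carrier G"
  shows "f x = 0"
  using haar_full_support[OF cont_cmod_sq[OF assms(1)] _ _ assms(3)] assms(2)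
  by (simp add: nsq_def)

lemma ip_cnj: "cnj (ip f h) = ip h f"
  unfolding ip_def Bochner_Integration.integral_cnj[symmetric] by (simp add: mult.commute)

lemma ip_cong:
  assumes "\<And>x. x \<in> carrier G \<Longrightarrow> f x = f' x" "\<And>x. x \<in> carrier G \<Longrightarrow> h x = h' x"
  shows "ip f h = ip f' h'"
  unfolding ip_def using assms by (intro integral_cong'[OF borel_prob_haar]) auto

lemma nsq_cong:
  assumes "\<And>x. x \<in> carrier G \<Longrightarrow> f x = f' x"
  shows "nsq f = nsq f'"
  unfolding nsq_def using assms by (intro integral_cong'[OF borel_prob_haar]) auto

lemma int_m: "cf f \<Longrightarrow> integrable m f"
  by (rule integrable_cf[OF borel_prob_haar])

lemma ip_diff_left: "cf f \<Longrightarrow> cf g \<Longrightarrow> cf h \<Longrightarrow> ip (\<lambda>x. f x - g x) h = ip f h - ip g h"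
  unfolding ip_def left_diff_distrib
  by (intro Bochner_Integration.integral_diff int_m cont_intros)

lemma ip_diff_right: "cf f \<Longrightarrow> cf g \<Longrightarrow> cf h \<Longrightarrow> ip h (\<lambda>x. f x - g x) = ip h f - ip h g"
proof -
  assume a: "cf f" "cf g" "cf h"
  have "cnj (ip (\<lambda>x. f x - g x) h) = cnj (ip f h) - cnj (ip g h)" by (simp add: ip_diff_left a)
  then show ?thesis by (simp only: ip_cnj)
qed

lemma ip_sum_left:
  "(\<And>i. i \<in> I \<Longrightarrow> cf (f i)) \<Longrightarrow> cf h \<Longrightarrow> ip (\<lambda>x. \<Sum>i\<in>I. c i * f i x) h = (\<Sum>i\<in>I. c i * ip (f i) h)"
proof -
  assume a: "\<And>i. i \<in> I \<Longrightarrow> cf (f i)" "cf h"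
  have "ip (\<lambda>x. \<Sum>i\<in>I. c i * f i x) h = (\<integral>x. (\<Sum>i\<in>I. c i * (f i x * cnj (h x))) \<partial>m)"
    unfolding ip_def by (simp add: sum_distrib_right mult.assoc)
  also have "\<dots> = (\<Sum>i\<in>I. \<integral>x. c i * (f i x * cnj (h x)) \<partial>m)"
    using a by (intro Bochner_Integration.integral_sum int_m cont_intros) auto
  finally show ?thesis by (simp add: ip_def)
qed

lemma ip_sum_right:
  "(\<And>i. i \<in> I \<Longrightarrow> cf (f i)) \<Longrightarrow> cf h \<Longrightarrow>
    ip h (\<lambda>x. \<Sum>i\<in>I. c i * f i x) = (\<Sum>i\<in>I. cnj (c i) * ip h (f i))"
proof -
  assume a: "\<And>i. i \<in> I \<Longrightarrow> cf (f i)" "cf h"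
  have "cnj (ip (\<lambda>x. \<Sum>i\<in>I. c i * f i x) h) = (\<Sum>i\<in>I. cnj (c i) * cnj (ip (f i) h))"
    by (simp add: ip_sum_left a)
  then show ?thesis by (simp only: ip_cnj)
qed

lemma nsq_diff:
  assumes "cf f" "cf h"
  shows "nsq (\<lambda>x. f x - h x) = nsq f + nsq h - 2 * Re (ip f h)"
proof -
  have "complex_of_real (nsq (\<lambda>x. f x - h x)) = ip f f + ip h h - (ip f h + cnj (ip f h))"
    using assms by (simp add: ip_self[symmetric] ip_cnj ip_diff_left ip_diff_right continuous_map_diff)
  then have "Re (complex_of_real (nsq (\<lambda>x. f x - h x))) = Re (ip f f + ip h h - (ip f h + cnj (ip f h)))"
    by simp
  then show ?thesis by (simp add: ip_self)
qed

definition orthonormal :: "'i set \<Rightarrow> ('i \<Rightarrow> 'g \<Rightarrow> complex) \<Rightarrow> bool" where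
  "orthonormal I w \<longleftrightarrow> (\<forall>i\<in>I. cf (w i)) \<and> (\<forall>i\<in>I. \<forall>j\<in>I. ip (w i) (w j) = (if i = j then 1 else 0))"

text \<open>Pythagoras for the orthogonal projection \<open>h\<close> of \<open>f\<close> onto the
  span of the system: \<open>ip f h\<close> and \<open>nsq h\<close> are the same sum of
  squares.\<close>

lemma nsq_orthogonal_remainder:
  assumes fin: "finite I" and on: "orthonormal I w" and f: "cf f"
  shows "nsq (\<lambda>x. f x - (\<Sum>i\<in>I. ip f (w i) * w i x)) = nsq f - (\<Sum>i\<in>I. (cmod (ip f (w i)))\<^sup>2)"
proof -
  define h where "h x = (\<Sum>i\<in>I. ip f (w i) * w i x)" for x
  have w: "\<And>i. i \<in> I \<Longrightarrow> cf (w i)" using on by (simp add: orthonormal_def)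
  have h: "cf h" unfolding h_def using fin w by (intro cont_intros) auto
  have fh: "ip f h = (\<Sum>i\<in>I. of_real ((cmod (ip f (w i)))\<^sup>2))"
    unfolding h_def using w f by (simp only: ip_sum_right complex_norm_square mult.commute[of "cnj _"])
  have whi: "ip (w i) h = cnj (ip f (w i))" if "i \<in> I" for i
  proof -
    have "ip (w i) h = (\<Sum>j\<in>I. cnj (ip f (w j)) * ip (w i) (w j))"
      unfolding h_def using w that by (simp add: ip_sum_right)
    also have "\<dots> = (\<Sum>j\<in>I. if i = j then cnj (ip f (w j)) else 0)"
      using on that by (intro sum.cong refl) (auto simp: orthonormal_def)
    finally show ?thesis using that fin by simp
  qed
  have "ip h h = (\<Sum>i\<in>I. ip f (w i) * ip (w i) h)"
    using ip_sum_left[of I w h "\<lambda>i. ip f (w i)"] w h unfolding h_def by simp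
  also have "\<dots> = (\<Sum>i\<in>I. of_real ((cmod (ip f (w i)))\<^sup>2))"
    by (simp only: whi complex_norm_square cong: sum.cong)
  finally have hh: "nsq h = (\<Sum>i\<in>I. (cmod (ip f (w i)))\<^sup>2)"
    unfolding ip_self by (simp flip: of_real_sum of_real_power)
  show ?thesis using nsq_diff[OF f h] hh fh unfolding h_def[symmetric]
    by (simp flip: of_real_sum of_real_power)
qed

lemma bessel:
  assumes "finite I" "orthonormal I w" "cf f"
  shows "(\<Sum>i\<in>I. (cmod (ip f (w i)))\<^sup>2) \<le> nsq f"
  using nsq_orthogonal_remainder[OF assms] nsq_nonneg[of "\<lambda>x. f x - (\<Sum>i\<in>I. ip f (w i) * w i x)"] by simp

lemma nsq_scale: "nsq (\<lambda>x. c * f x) = (cmod c)\<^sup>2 * nsq f"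
  unfolding nsq_def by (simp add: norm_mult power_mult_distrib)

lemma ip_scale_right: "ip f (\<lambda>x. c * h x) = cnj c * ip f h"
  unfolding ip_def by (simp add: mult.left_commute mult.commute)

lemma ip_scale_left: "ip (\<lambda>x. c * f x) h = c * ip f h"
  unfolding ip_def by (simp add: mult.assoc)

text \<open>Bessel's inequality for the one-element system obtained by normalising \<open>h\<close>.
  If \<open>nsq h\<close> is zero, full support of Haar measure makes \<open>h\<close> vanish on the
  group.\<close>

lemma cauchy_schwarz:
  assumes f: "cf f" and h: "cf h"
  shows "(cmod (ip f h))\<^sup>2 \<le> nsq f * nsq h"
proof (cases "nsq h = 0")
  case True
  then have "ip f h = ip f (\<lambda>x. 0)" using nsq_eq_0[OF h True] by (intro ip_cong) auto
  then show ?thesis using True by (simp add: ip_def)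
next
  case False
  then have pos: "nsq h > 0" using nsq_nonneg[of h] by simp
  define c where "c = complex_of_real (1 / sqrt (nsq h))"
  have c: "(cmod c)\<^sup>2 = 1 / nsq h" using pos by (simp add: c_def norm_divide power_divide)
  have ch: "cf (\<lambda>x. c * h x)" by (intro cont_intros h)
  have "orthonormal {()} (\<lambda>_ x. c * h x)"
    using pos ch by (simp add: orthonormal_def ip_self nsq_scale c)
  from bessel[OF _ this f] have "(cmod (cnj c * ip f h))\<^sup>2 \<le> nsq f" by (simp add: ip_scale_right)
  then have "(1 / nsq h) * (cmod (ip f h))\<^sup>2 \<le> nsq f" by (simp add: norm_mult power_mult_distrib c)
  then show ?thesis using pos by (simp add: field_simps)
qed

lemma cf_uniform_limit:
  fixes f :: "'i \<Rightarrow> 'g \<Rightarrow> complex"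
  assumes lim: "uniform_limit (carrier G) f l F" and f: "\<forall>\<^sub>F n in F. cf (f n)" and F: "F \<noteq> bot"
  shows "cf l"
  using Met_TC.continuous_map_uniform_limit[of T f F l] f lim F
  by (simp add: uniform_limit_iff topspace dist_commute)

lemma tendsto_integral_uniform_limit:
  fixes f :: "'i \<Rightarrow> 'g \<Rightarrow> complex"
  assumes M: "borel_prob M" and lim: "uniform_limit (carrier G) f l F"
    and f: "\<forall>\<^sub>F n in F. cf (f n)" and l: "cf l"
  shows "((\<lambda>n. integral\<^sup>L M (f n)) \<longlongrightarrow> integral\<^sup>L M l) F"
  unfolding tendsto_iff
proof (intro allI impI)
  fix e :: real assume e: "e > 0"
  have "\<forall>\<^sub>F n in F. \<forall>x\<in>carrier G. dist (f n x) (l x) < e / 2"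
    using lim e unfolding uniform_limit_iff by (meson half_gt_zero)
  with f show "\<forall>\<^sub>F n in F. dist (integral\<^sup>L M (f n)) (integral\<^sup>L M l) < e"
  proof eventually_elim
    case (elim n)
    have "norm (\<integral>x. f n x - l x \<partial>M) \<le> e / 2"
      using elim by (intro norm_integral_le M cont_intros l) (auto simp: dist_norm intro: less_imp_le)
    then show ?case
      using e by (simp add: dist_norm Bochner_Integration.integral_diff integrable_cf M elim l)
  qed
qed

end

section \<open>Schur's lemma and orthogonality relations\<close>

unbundle no vec_syntax

section \<open>Complex matrices and the standard inner product\<close>

lemma cscalar_sum:
  assumes "w \<in> carrier_vec d"
  shows "v \<bullet>c w = (\<Sum>i<d. v $ i * cnj (w $ i))"
  using assms by (simp add: scalar_prod_def lessThan_atLeast0)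

definition adj :: "complex Matrix.mat \<Rightarrow> complex Matrix.mat" where
  "adj A = Matrix.mat (dim_col A) (dim_row A) (\<lambda>(i, j). cnj (A $$ (j, i)))"

lemma adj_carrier [simp]: "A \<in> carrier_mat n k \<Longrightarrow> adj A \<in> carrier_mat k n"
  by (auto simp: adj_def)

lemma adj_index [simp]: "i < dim_col A \<Longrightarrow> j < dim_row A \<Longrightarrow> adj A $$ (i, j) = cnj (A $$ (j, i))"
  by (simp add: adj_def)

lemma dim_adj [simp]: "dim_row (adj A) = dim_col A" "dim_col (adj A) = dim_row A"
  by (simp_all add: adj_def)

lemma adj_adj [simp]: "adj (adj A) = A"
  by (rule eq_matI) auto

lemma mult_mat_index:
  assumes "A \<in> carrier_mat n k" "B \<in> carrier_mat k l" "i < n" "j < l"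
  shows "(A * B) $$ (i, j) = (\<Sum>a<k. A $$ (i, a) * B $$ (a, j))"
  using assms by (auto simp: scalar_prod_def lessThan_atLeast0)

lemma mult_mat_vec_index':
  assumes "A \<in> carrier_mat n k" "v \<in> carrier_vec k" "i < n"
  shows "(A *\<^sub>v v) $ i = (\<Sum>a<k. A $$ (i, a) * v $ a)"
  using assms by (auto simp: scalar_prod_def lessThan_atLeast0)

lemma adj_mult:
  assumes A: "A \<in> carrier_mat n k" and B: "B \<in> carrier_mat k l"
  shows "adj (A * B) = adj B * adj A"
proof (rule eq_matI)
  fix i j assume ij: "i < dim_row (adj B * adj A)" "j < dim_col (adj B * adj A)"
  then have i: "i < l" and j: "j < n" using A B by auto
  have "adj (A * B) $$ (i, j) = cnj ((A * B) $$ (j, i))" using A B i j by simp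
  also have "\<dots> = (\<Sum>a<k. cnj (A $$ (j, a)) * cnj (B $$ (a, i)))"
    by (simp add: mult_mat_index[OF A B j i])
  also have "\<dots> = (\<Sum>a<k. adj B $$ (i, a) * adj A $$ (a, j))"
    using A B i j by (intro sum.cong refl) auto
  also have "\<dots> = (adj B * adj A) $$ (i, j)"
    by (rule mult_mat_index[symmetric, OF adj_carrier[OF B] adj_carrier[OF A] i j])
  finally show "adj (A * B) $$ (i, j) = (adj B * adj A) $$ (i, j)" .
qed (use A B in auto)

lemma adj_cscalar:
  assumes A: "A \<in> carrier_mat n k" and v: "v \<in> carrier_vec k" and w: "w \<in> carrier_vec n"
  shows "(A *\<^sub>v v) \<bullet>c w = v \<bullet>c (adj A *\<^sub>v w)"
proof -
  have "(A *\<^sub>v v) \<bullet>c w = (\<Sum>i<n. \<Sum>j<k. A $$ (i, j) * v $ j * cnj (w $ i))"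
    by (simp add: cscalar_sum[OF w] mult_mat_vec_index'[OF A v] sum_distrib_right)
  also have "\<dots> = (\<Sum>j<k. \<Sum>i<n. A $$ (i, j) * v $ j * cnj (w $ i))" by (rule sum.swap)
  also have "\<dots> = (\<Sum>j<k. v $ j * cnj (\<Sum>i<n. adj A $$ (j, i) * w $ i))"
    using A by (intro sum.cong refl) (auto simp: sum_distrib_left algebra_simps)
  also have "\<dots> = v \<bullet>c (adj A *\<^sub>v w)"
    using A w mult_mat_vec_index'[OF adj_carrier[OF A] w]
    by (subst cscalar_sum[of _ k]) (auto intro!: mult_mat_vec_carrier[of _ k n])
  finally show ?thesis .
qed

lemma cscalar_unit_vec:
  fixes v :: "complex Matrix.vec"
  assumes "v \<in> carrier_vec d" "i < d" shows "v \<bullet>c unit_vec d i = v $ i"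
proof -
  have "v \<bullet>c unit_vec d i = (\<Sum>j<d. if j = i then v $ j else 0)"
    unfolding cscalar_sum[of _ d, OF unit_vec_carrier]
    by (rule sum.cong) (use assms in auto)
  then show ?thesis using assms by simp
qed

lemma mult_unit_vec_index:
  fixes A :: "complex Matrix.mat"
  assumes "A \<in> carrier_mat n k" "j < k" "i < n"
  shows "(A *\<^sub>v unit_vec k j) $ i = A $$ (i, j)"
proof -
  have "(A *\<^sub>v unit_vec k j) $ i = (\<Sum>a<k. if a = j then A $$ (i, a) else 0)"
    unfolding mult_mat_vec_index'[OF assms(1) unit_vec_carrier assms(3)]
    by (rule sum.cong) (use assms in auto)
  then show ?thesis using assms by simp
qed

text \<open>Evaluating preservation of the inner product on unit vectors yields the entries of
  \<open>adj A * A\<close>; the algebraic form is the one used in computations with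
  intertwiners.\<close>

lemma unitary_mat_iff_adj:
  "unitary_mat d A \<longleftrightarrow> A \<in> carrier_mat d d \<and> adj A * A = 1\<^sub>m d"
proof
  assume U: "unitary_mat d A"
  then have A: "A \<in> carrier_mat d d" by (simp add: unitary_mat_def)
  have "adj A * A = 1\<^sub>m d"
  proof (rule eq_matI)
    fix i j assume ij: "i < dim_row (1\<^sub>m d)" "j < dim_col (1\<^sub>m d)"
    have "(adj A * A) $$ (i, j) = (\<Sum>a<d. cnj (A $$ (a, i)) * A $$ (a, j))"
      using ij A by (subst mult_mat_index[of _ d d _ d]) (auto intro!: sum.cong)
    also have "\<dots> = (A *\<^sub>v unit_vec d j) \<bullet>c (A *\<^sub>v unit_vec d i)"
      using ij A by (subst cscalar_sum[of _ d])
        (auto simp: mult_unit_vec_index[OF A] mult.commute intro!: mult_mat_vec_carrier[of _ d d] sum.cong)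
    also have "\<dots> = unit_vec d j \<bullet>c unit_vec d i" using U by (simp add: unitary_mat_def)
    also have "\<dots> = 1\<^sub>m d $$ (i, j)" using ij by (simp add: cscalar_unit_vec[of _ d])
    finally show "(adj A * A) $$ (i, j) = 1\<^sub>m d $$ (i, j)" .
  qed (use A in auto)
  with A show "A \<in> carrier_mat d d \<and> adj A * A = 1\<^sub>m d" by simp
next
  assume "A \<in> carrier_mat d d \<and> adj A * A = 1\<^sub>m d"
  then have A: "A \<in> carrier_mat d d" and AA: "adj A * A = 1\<^sub>m d" by auto
  show "unitary_mat d A" unfolding unitary_mat_def
  proof (intro conjI ballI A)
    fix v w :: "complex Matrix.vec" assume vw: "v \<in> carrier_vec d" "w \<in> carrier_vec d"
    have "(A *\<^sub>v v) \<bullet>c (A *\<^sub>v w) = v \<bullet>c (adj A *\<^sub>v (A *\<^sub>v w))"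
      by (rule adj_cscalar[OF A vw(1)]) (rule mult_mat_vec_carrier[OF A vw(2)])
    also have "adj A *\<^sub>v (A *\<^sub>v w) = w"
      using assoc_mult_mat_vec[OF adj_carrier[OF A] A vw(2)] AA vw by simp
    finally show "(A *\<^sub>v v) \<bullet>c (A *\<^sub>v w) = v \<bullet>c w" .
  qed
qed

lemma unitary_mat_adj_right: "unitary_mat d A \<Longrightarrow> A * adj A = 1\<^sub>m d"
  using mat_mult_left_right_inverse[of "adj A" d A] by (auto simp: unitary_mat_iff_adj)

lemma unitary_mat_columns:
  assumes "unitary_mat d A" "j < d" "k < d"
  shows "(\<Sum>i<d. A $$ (i, j) * cnj (A $$ (i, k))) = (if j = k then 1 else 0)"
proof -
  have A: "A \<in> carrier_mat d d" and e: "(adj A * A) $$ (k, j) = 1\<^sub>m d $$ (k, j)"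
    using assms by (auto simp: unitary_mat_iff_adj)
  then have "(\<Sum>i<d. adj A $$ (k, i) * A $$ (i, j)) = 1\<^sub>m d $$ (k, j)"
    using assms by (subst (asm) mult_mat_index[of _ d d _ d]) auto
  then show ?thesis using A assms by (simp add: mult.commute)
qed

lemma unitary_matI:
  assumes A: "A \<in> carrier_mat d d"
    and c: "\<And>j k. j < d \<Longrightarrow> k < d \<Longrightarrow> (\<Sum>i<d. A $$ (i, j) * cnj (A $$ (i, k))) = (if j = k then 1 else 0)"
  shows "unitary_mat d A"
  unfolding unitary_mat_iff_adj
proof (intro conjI A eq_matI)
  fix i j assume ij: "i < dim_row (1\<^sub>m d)" "j < dim_col (1\<^sub>m d)"
  have "(adj A * A) $$ (i, j) = (\<Sum>a<d. adj A $$ (i, a) * A $$ (a, j))"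
    using ij A by (intro mult_mat_index[of _ d d _ d]) auto
  also have "\<dots> = (\<Sum>a<d. A $$ (a, j) * cnj (A $$ (a, i)))"
    using A ij by (intro sum.cong) (auto simp: mult.commute)
  finally show "(adj A * A) $$ (i, j) = 1\<^sub>m d $$ (i, j)" using c[of j i] ij by simp
qed (use A in auto)

lemma conjugate_mult_mat_vec:
  fixes A :: "complex Matrix.mat"
  assumes A: "A \<in> carrier_mat n k" and v: "v \<in> carrier_vec k"
  shows "map_mat cnj A *\<^sub>v conjugate v = conjugate (A *\<^sub>v v)"
proof (rule eq_vecI)
  have A': "map_mat cnj A \<in> carrier_mat n k" and v': "conjugate v \<in> carrier_vec k" using A v by auto
  fix i assume "i < dim_vec (conjugate (A *\<^sub>v v))"
  then have i: "i < n" using A by simp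
  have "(map_mat cnj A *\<^sub>v conjugate v) $ i = (\<Sum>a<k. cnj (A $$ (i, a)) * cnj (v $ a))"
    unfolding mult_mat_vec_index'[OF A' v' i] using A v i by (intro sum.cong) auto
  also have "\<dots> = cnj ((A *\<^sub>v v) $ i)" unfolding mult_mat_vec_index'[OF A v i] by simp
  finally show "(map_mat cnj A *\<^sub>v conjugate v) $ i = conjugate (A *\<^sub>v v) $ i" using A i by simp
qed (use A in auto)

lemma conjugate_cscalar:
  fixes v w :: "complex Matrix.vec"
  assumes v: "v \<in> carrier_vec d" and w: "w \<in> carrier_vec d"
  shows "conjugate v \<bullet>c conjugate w = w \<bullet>c v"
proof -
  have "conjugate w \<in> carrier_vec d" using w by simp
  then have "conjugate v \<bullet>c conjugate w = (\<Sum>i<d. cnj (v $ i) * cnj (cnj (w $ i)))"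
    unfolding cscalar_sum[OF \<open>conjugate w \<in> carrier_vec d\<close>] using v w by (intro sum.cong) auto
  then show ?thesis by (simp add: cscalar_sum[OF v] mult.commute)
qed

lemma cscalar_commute:
  fixes v w :: "complex Matrix.vec"
  assumes v: "v \<in> carrier_vec d" and w: "w \<in> carrier_vec d"
  shows "cnj (v \<bullet>c w) = w \<bullet>c v"
  by (simp add: cscalar_sum[OF v] cscalar_sum[OF w] mult.commute)

text \<open>Kept for arbitrary \<open>k\<close>: with k = -<x,b>/<b,b> this is the squared norm of
  the component of \<open>x\<close> orthogonal to \<open>b\<close>. It serves the bound on
  coefficients and the equality case of Cauchy-Schwarz.\<close>

lemma cscalar_expand:
  fixes x b :: "complex Matrix.vec"
  assumes "x \<in> carrier_vec d" "b \<in> carrier_vec d"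
  shows "(x + k \<cdot>\<^sub>v b) \<bullet>c (x + k \<cdot>\<^sub>v b) = x \<bullet>c x + cnj k * (x \<bullet>c b) + k * (b \<bullet>c x) + k * cnj k * (b \<bullet>c b)"
proof -
  have c: "x + k \<cdot>\<^sub>v b \<in> carrier_vec d" using assms by simp
  have "(x + k \<cdot>\<^sub>v b) \<bullet>c (x + k \<cdot>\<^sub>v b) = (\<Sum>i<d. x $ i * cnj (x $ i) + cnj k * (x $ i * cnj (b $ i)) +
     k * (b $ i * cnj (x $ i)) + k * cnj k * (b $ i * cnj (b $ i)))"
    unfolding cscalar_sum[OF c] using assms by (intro sum.cong) (auto simp: algebra_simps)
  then show ?thesis using assms
    by (simp add: cscalar_sum[of _ d] sum.distrib sum_distrib_left)
qed

section \<open>Unitary representations, Schur's lemma and orthogonality\<close>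

context compact_group
begin

context
  fixes \<pi> :: "'g rep"
  assumes rep: "unitary_rep G T \<pi>"
begin

lemma rep_unitary: "g \<in> carrier G \<Longrightarrow> unitary_mat (rep_dim G \<pi>) (\<pi> g)"
  using rep by (auto simp: unitary_rep_def Let_def)

lemma rep_carrier: "g \<in> carrier G \<Longrightarrow> \<pi> g \<in> carrier_mat (rep_dim G \<pi>) (rep_dim G \<pi>)"
  using rep_unitary by (auto simp: unitary_mat_def)

lemma rep_one: "\<pi> \<one> = 1\<^sub>m (rep_dim G \<pi>)"
  using rep by (auto simp: unitary_rep_def Let_def)

lemma rep_mult: "g \<in> carrier G \<Longrightarrow> h \<in> carrier G \<Longrightarrow> \<pi> (g \<otimes> h) = \<pi> g * \<pi> h"
  using rep by (auto simp: unitary_rep_def Let_def)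

lemma rep_cf: "i < rep_dim G \<pi> \<Longrightarrow> j < rep_dim G \<pi> \<Longrightarrow> cf (\<lambda>g. \<pi> g $$ (i, j))"
  using rep by (auto simp: unitary_rep_def Let_def)

lemma rep_inv:
  assumes g: "g \<in> carrier G"
  shows "\<pi> (inv g) = adj (\<pi> g)"
proof -
  let ?d = "rep_dim G \<pi>"
  have c: "\<pi> (inv g) \<in> carrier_mat ?d ?d" "\<pi> g \<in> carrier_mat ?d ?d" "adj (\<pi> g) \<in> carrier_mat ?d ?d"
    using rep_carrier g by auto
  have "\<pi> (inv g) * \<pi> g = 1\<^sub>m ?d" using rep_mult[of "inv g" g] g by (simp add: rep_one)
  then have "\<pi> (inv g) * \<pi> g * adj (\<pi> g) = adj (\<pi> g)" using c by simp
  moreover have "\<pi> (inv g) * \<pi> g * adj (\<pi> g) = \<pi> (inv g)"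
    using c by (simp add: assoc_mult_mat[of _ ?d ?d _ ?d _ ?d] unitary_mat_adj_right[OF rep_unitary[OF g]])
  ultimately show ?thesis by simp
qed

lemma rep_mult_vec:
  "g \<in> carrier G \<Longrightarrow> h \<in> carrier G \<Longrightarrow> v \<in> carrier_vec (rep_dim G \<pi>) \<Longrightarrow>
    \<pi> (g \<otimes> h) *\<^sub>v v = \<pi> g *\<^sub>v (\<pi> h *\<^sub>v v)"
  using rep_mult rep_carrier assoc_mult_mat_vec by metis

lemma rep_vec_carrier:
  "g \<in> carrier G \<Longrightarrow> v \<in> carrier_vec (rep_dim G \<pi>) \<Longrightarrow> \<pi> g *\<^sub>v v \<in> carrier_vec (rep_dim G \<pi>)"
  using rep_carrier mult_mat_vec_carrier by metis

lemma rep_cscalar: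
  "g \<in> carrier G \<Longrightarrow> v \<in> carrier_vec (rep_dim G \<pi>) \<Longrightarrow> w \<in> carrier_vec (rep_dim G \<pi>) \<Longrightarrow>
    (\<pi> g *\<^sub>v v) \<bullet>c w = v \<bullet>c (\<pi> (inv g) *\<^sub>v w)"
  using adj_cscalar[OF rep_carrier] rep_inv by simp

end

lemma irrepD:
  assumes "irreducible_unitary_rep G T \<pi>"
  shows "unitary_rep G T \<pi>" "rep_dim G \<pi> > 0"
  using assms by (auto simp: irreducible_unitary_rep_def Let_def)

text \<open>Over the complex numbers \<open>C\<close> has an eigenvalue; its eigenspace is a
  non-zero subspace stable under all \<open>\<pi> g\<close>, hence the whole space.\<close>

lemma schur_scalar:
  assumes irr: "irreducible_unitary_rep G T \<pi>" and d: "d = rep_dim G \<pi>"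
    and C: "C \<in> carrier_mat d d" and comm: "\<And>g. g \<in> carrier G \<Longrightarrow> C * \<pi> g = \<pi> g * C"
  shows "\<exists>c. C = c \<cdot>\<^sub>m 1\<^sub>m d"
proof -
  note rep = irrepD(1)[OF irr]
  obtain l where "l \<in> spectrum C" using spectrum_non_empty[OF C] irrepD(2)[OF irr] d by auto
  then obtain v where v: "eigenvector C v l" by (auto simp: spectrum_def eigenvalue_def)
  then have v': "v \<in> carrier_vec d" "v \<noteq> 0\<^sub>v d" "C *\<^sub>v v = l \<cdot>\<^sub>v v" using C by (auto simp: eigenvector_def)
  define W where "W = {v \<in> carrier_vec d. C *\<^sub>v v = l \<cdot>\<^sub>v v}"
  have "W \<subseteq> carrier_vec d" by (auto simp: W_def)
  moreover have "0\<^sub>v d \<in> W" using C by (auto simp: W_def)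
  moreover have "\<forall>v\<in>W. \<forall>w\<in>W. v + w \<in> W"
    using C by (auto simp: W_def mult_add_distrib_mat_vec[of _ d d] smult_add_distrib_vec[of _ d])
  moreover have "\<forall>a. \<forall>v\<in>W. a \<cdot>\<^sub>v v \<in> W"
    using C by (auto simp: W_def mult_mat_vec[of _ d d] smult_smult_assoc mult.commute)
  moreover have "\<forall>g\<in>carrier G. \<forall>v\<in>W. \<pi> g *\<^sub>v v \<in> W"
  proof (intro ballI)
    fix g v assume g: "g \<in> carrier G" and v: "v \<in> W"
    have p: "\<pi> g \<in> carrier_mat d d" using rep_carrier[OF rep g] d by simp
    have vc: "v \<in> carrier_vec d" "C *\<^sub>v v = l \<cdot>\<^sub>v v" using v by (auto simp: W_def)
    have "C *\<^sub>v (\<pi> g *\<^sub>v v) = (C * \<pi> g) *\<^sub>v v" using assoc_mult_mat_vec[OF C p vc(1)] by simp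
    also have "\<dots> = \<pi> g *\<^sub>v (C *\<^sub>v v)" using assoc_mult_mat_vec[OF p C vc(1)] comm[OF g] by simp
    also have "\<dots> = l \<cdot>\<^sub>v (\<pi> g *\<^sub>v v)" using vc p by (simp add: mult_mat_vec)
    finally show "\<pi> g *\<^sub>v v \<in> W" using mult_mat_vec_carrier[OF p vc(1)] by (simp add: W_def)
  qed
  ultimately have "W = {0\<^sub>v d} \<or> W = carrier_vec d"
    using irr d by (auto simp: irreducible_unitary_rep_def Let_def)
  moreover have "v \<in> W" using v' by (simp add: W_def)
  ultimately have W: "W = carrier_vec d" using v' by auto
  have "C = l \<cdot>\<^sub>m 1\<^sub>m d"
  proof (rule eq_matI)
    fix i j assume ij: "i < dim_row (l \<cdot>\<^sub>m 1\<^sub>m d)" "j < dim_col (l \<cdot>\<^sub>m 1\<^sub>m d)"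
    have "unit_vec d j \<in> W" using W by simp
    then have "C *\<^sub>v unit_vec d j = l \<cdot>\<^sub>v unit_vec d j" by (simp add: W_def)
    then have "(C *\<^sub>v unit_vec d j) $ i = (l \<cdot>\<^sub>v unit_vec d j) $ i" by simp
    then show "C $$ (i, j) = (l \<cdot>\<^sub>m 1\<^sub>m d) $$ (i, j)"
      using ij mult_unit_vec_index[OF C, of j i] by simp
  qed (use C in auto)
  then show ?thesis by blast
qed

text \<open>Both products of \<open>B\<close> with its adjoint commute with the respective
  representation and are scalars. The two scalars and the two dimensions agree, and \<open>B\<close>
  divided by the square root of the scalar is the unitary equivalence.\<close>

lemma schur_intertwiner:
  assumes irr1: "irreducible_unitary_rep G T \<pi>" and irr2: "irreducible_unitary_rep G T \<rho>"
    and d: "d = rep_dim G \<pi>" and d': "d' = rep_dim G \<rho>"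
    and B: "B \<in> carrier_mat d' d" and comm: "\<And>g. g \<in> carrier G \<Longrightarrow> B * \<pi> g = \<rho> g * B"
    and B0: "B \<noteq> 0\<^sub>m d' d"
  shows "unitarily_equivalent G \<pi> \<rho>"
proof -
  note r1 = irrepD(1)[OF irr1] and r2 = irrepD(1)[OF irr2]
  have p1: "\<pi> g \<in> carrier_mat d d" if "g \<in> carrier G" for g using rep_carrier[OF r1 that] d by simp
  have p2: "\<rho> g \<in> carrier_mat d' d'" if "g \<in> carrier G" for g using rep_carrier[OF r2 that] d' by simp
  have aB: "adj B \<in> carrier_mat d d'" using B by simp
  \<comment> \<open>The adjoint intertwines in the opposite direction: take adjoints of the relation
    at \<open>inv g\<close>, the representations being unitary.\<close>
  have comm': "adj B * \<rho> g = \<pi> g * adj B" if g: "g \<in> carrier G" for g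
  proof -
    have "adj (B * \<pi> (inv g)) = adj (\<rho> (inv g) * B)" using comm[of "inv g"] g by simp
    then show ?thesis
      using g adj_mult[OF B p1[of "inv g"]] adj_mult[OF p2[of "inv g"] B]
      by (simp add: rep_inv[OF r1] rep_inv[OF r2])
  qed
  have "\<exists>c. adj B * B = c \<cdot>\<^sub>m 1\<^sub>m d"
  proof (rule schur_scalar[OF irr1 d])
    show "adj B * B \<in> carrier_mat d d" by (rule mult_carrier_mat[OF aB B])
    fix g assume g: "g \<in> carrier G"
    have "adj B * B * \<pi> g = adj B * (\<rho> g * B)"
      using assoc_mult_mat[OF aB B p1[OF g]] comm[OF g] by simp
    also have "\<dots> = \<pi> g * adj B * B"
      using assoc_mult_mat[OF aB p2[OF g] B] comm'[OF g] by simp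
    finally show "adj B * B * \<pi> g = \<pi> g * (adj B * B)" using assoc_mult_mat[OF p1[OF g] aB B] by simp
  qed
  then obtain c where c: "adj B * B = c \<cdot>\<^sub>m 1\<^sub>m d" by blast
  have "\<exists>c. B * adj B = c \<cdot>\<^sub>m 1\<^sub>m d'"
  proof (rule schur_scalar[OF irr2 d'])
    show "B * adj B \<in> carrier_mat d' d'" by (rule mult_carrier_mat[OF B aB])
    fix g assume g: "g \<in> carrier G"
    have "B * adj B * \<rho> g = B * (\<pi> g * adj B)"
      using assoc_mult_mat[OF B aB p2[OF g]] comm'[OF g] by simp
    also have "\<dots> = \<rho> g * B * adj B"
      using assoc_mult_mat[OF B p1[OF g] aB] comm[OF g] by simp
    finally show "B * adj B * \<rho> g = \<rho> g * (B * adj B)" using assoc_mult_mat[OF p2[OF g] B aB] by simp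
  qed
  then obtain c' where c': "B * adj B = c' \<cdot>\<^sub>m 1\<^sub>m d'" by blast
  have cols: "(\<Sum>i<d'. B $$ (i, j) * cnj (B $$ (i, k))) = (if j = k then c else 0)" if "j < d" "k < d" for j k
  proof -
    have "(adj B * B) $$ (k, j) = (\<Sum>i<d'. adj B $$ (k, i) * B $$ (i, j))"
      using mult_mat_index[OF aB B that(2,1)] .
    also have "\<dots> = (\<Sum>i<d'. B $$ (i, j) * cnj (B $$ (i, k)))"
      using B that by (intro sum.cong) (auto simp: mult.commute)
    finally show ?thesis using c that by auto
  qed
  have rows: "(\<Sum>i<d. B $$ (j, i) * cnj (B $$ (j, i))) = c'" if "j < d'" for j
  proof -
    have "(B * adj B) $$ (j, j) = (\<Sum>i<d. B $$ (j, i) * adj B $$ (i, j))"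
      using mult_mat_index[OF B aB that that] .
    also have "\<dots> = (\<Sum>i<d. B $$ (j, i) * cnj (B $$ (j, i)))"
      using B that by (intro sum.cong) auto
    finally show ?thesis using c' that by auto
  qed
  have "\<exists>i<d'. \<exists>j<d. B $$ (i, j) \<noteq> 0"
  proof (rule ccontr)
    assume "\<not> ?thesis"
    then have "B = 0\<^sub>m d' d" using B by (intro eq_matI) auto
    with B0 show False by simp
  qed
  then obtain i0 j0 where ij0: "i0 < d'" "j0 < d" "B $$ (i0, j0) \<noteq> 0" by blast
  have "c = (\<Sum>i<d'. of_real ((cmod (B $$ (i, j0)))\<^sup>2))"
    using cols[OF ij0(2) ij0(2)] by (simp add: complex_norm_square del: of_real_power)
  then have cr: "c = of_real (\<Sum>i<d'. (cmod (B $$ (i, j0)))\<^sup>2)" by simp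
  define r where "r = (\<Sum>i<d'. (cmod (B $$ (i, j0)))\<^sup>2)"
  have "(cmod (B $$ (i0, j0)))\<^sup>2 \<le> r" unfolding r_def using ij0 by (intro member_le_sum) auto
  then have r: "r > 0" using ij0 by (smt (verit) zero_less_norm_iff zero_less_power)
  have cr: "c = of_real r" using cr r_def by simp
  \<comment> \<open>Associativity compares the two scalars on a non-zero entry of
    \<open>B\<close>.\<close>
  have "B * (adj B * B) = B * adj B * B" using assoc_mult_mat[OF B aB B] by simp
  then have "B * (c \<cdot>\<^sub>m 1\<^sub>m d) = (c' \<cdot>\<^sub>m 1\<^sub>m d') * B" using c c' by simp
  then have "c \<cdot>\<^sub>m B = c' \<cdot>\<^sub>m B"
    using B mult_smult_distrib[OF B one_carrier_mat, of c] mult_smult_assoc_mat[OF one_carrier_mat B, of c'] by simp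
  then have "(c \<cdot>\<^sub>m B) $$ (i0, j0) = (c' \<cdot>\<^sub>m B) $$ (i0, j0)" by simp
  then have cc: "c = c'" using ij0 B by simp
  \<comment> \<open>The sum of the squared moduli of all entries is \<open>d * c\<close> by columns
    and \<open>d' * c\<close> by rows; as \<open>c\<close> is positive, the dimensions
    agree.\<close>
  have "of_nat d * c = (\<Sum>j<d. \<Sum>i<d'. B $$ (i, j) * cnj (B $$ (i, j)))" using cols by simp
  also have "\<dots> = (\<Sum>i<d'. \<Sum>j<d. B $$ (i, j) * cnj (B $$ (i, j)))" by (rule sum.swap)
  also have "\<dots> = of_nat d' * c" using rows cc by simp
  finally have dd: "d = d'" using r cr by simp
  define U where "U = complex_of_real (1 / sqrt r) \<cdot>\<^sub>m B"
  have U: "U \<in> carrier_mat d d" using B dd by (simp add: U_def)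
  have "unitary_mat d U"
  proof (rule unitary_matI[OF U])
    fix j k assume jk: "j < d" "k < d"
    have "(\<Sum>i<d. U $$ (i, j) * cnj (U $$ (i, k))) =
        (\<Sum>i<d. of_real (1 / r) * (B $$ (i, j) * cnj (B $$ (i, k))))"
    proof (intro sum.cong refl)
      fix i assume "i \<in> {..<d}"
      have "complex_of_real (1 / sqrt r) * complex_of_real (1 / sqrt r) = of_real (1 / r)"
        using r by (simp flip: of_real_mult)
      then show "U $$ (i, j) * cnj (U $$ (i, k)) = of_real (1 / r) * (B $$ (i, j) * cnj (B $$ (i, k)))"
        using \<open>i \<in> {..<d}\<close> B dd jk by (simp add: U_def)
    qed
    also have "\<dots> = of_real (1 / r) * (if j = k then c else 0)"
      unfolding sum_distrib_left[symmetric] using cols[OF jk] dd by simp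
    finally show "(\<Sum>i<d. U $$ (i, j) * cnj (U $$ (i, k))) = (if j = k then 1 else 0)"
      using cr r by simp
  qed
  moreover have "U * \<pi> g = \<rho> g * U" if g: "g \<in> carrier G" for g
    unfolding U_def
    using mult_smult_assoc_mat[OF B p1[OF g]] mult_smult_distrib[OF p2[OF g] B] comm[OF g] by simp
  ultimately show ?thesis unfolding unitarily_equivalent_def using d d' dd by auto
qed

text \<open>\<open>B\<close> is the group average of \<pi>(g) E adj(\<rho>(g)), where E is the
  matrix unit with its 1 at position (j, l); left invariance of Haar measure shows that it is
  unchanged when \<pi>(h) and adj(\<rho>(h)) are put around it.\<close>

lemma integral_intertwines:
  assumes r1: "unitary_rep G T \<pi>" and r2: "unitary_rep G T \<rho>"
    and d: "d = rep_dim G \<pi>" and d': "d' = rep_dim G \<rho>" and j: "j < d" and l: "l < d'"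
    and B: "B = Matrix.mat d d' (\<lambda>(i, k). ip (\<lambda>g. \<pi> g $$ (i, j)) (\<lambda>g. \<rho> g $$ (k, l)))"
    and h: "h \<in> carrier G"
  shows "B * \<rho> h = \<pi> h * B"
proof -
  have p1: "\<pi> g \<in> carrier_mat d d" if "g \<in> carrier G" for g using rep_carrier[OF r1 that] d by simp
  have p2: "\<rho> g \<in> carrier_mat d' d'" if "g \<in> carrier G" for g using rep_carrier[OF r2 that] d' by simp
  have Bc: "B \<in> carrier_mat d d'" using B by simp
  have aR: "adj (\<rho> h) \<in> carrier_mat d' d'" using p2[OF h] by simp
  have pB: "\<pi> h * B \<in> carrier_mat d d'" using p1[OF h] Bc by simp
  have "\<pi> h * B * adj (\<rho> h) = B"
  proof (rule eq_matI)
    fix i k assume "i < dim_row B" "k < dim_col B"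
    then have i: "i < d" and k: "k < d'" using B by auto
    have "B $$ (i, k) = ip (\<lambda>g. \<pi> g $$ (i, j)) (\<lambda>g. \<rho> g $$ (k, l))" using i k B by simp
    also have "\<dots> = (\<integral>g. \<pi> (h \<otimes> g) $$ (i, j) * cnj (\<rho> (h \<otimes> g) $$ (k, l)) \<partial>m)"
      unfolding ip_def using i j k l d d' h
      by (intro left_invariant[symmetric] cont_intros) (auto intro!: rep_cf r1 r2)
    also have "\<dots> = ip (\<lambda>g. \<Sum>a<d. \<pi> h $$ (i, a) * \<pi> g $$ (a, j)) (\<lambda>g. \<Sum>b<d'. \<rho> h $$ (k, b) * \<rho> g $$ (b, l))"
      unfolding ip_def
    proof (rule integral_cong'[OF borel_prob_haar])
      fix g assume g: "g \<in> carrier G"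
      show "\<pi> (h \<otimes> g) $$ (i, j) * cnj (\<rho> (h \<otimes> g) $$ (k, l)) =
        (\<Sum>a<d. \<pi> h $$ (i, a) * \<pi> g $$ (a, j)) * cnj (\<Sum>b<d'. \<rho> h $$ (k, b) * \<rho> g $$ (b, l))"
        unfolding rep_mult[OF r1 h g] rep_mult[OF r2 h g]
          mult_mat_index[OF p1[OF h] p1[OF g] i j] mult_mat_index[OF p2[OF h] p2[OF g] k l] ..
    qed
    also have "\<dots> = (\<Sum>b<d'. cnj (\<rho> h $$ (k, b)) * ip (\<lambda>g. \<Sum>a<d. \<pi> h $$ (i, a) * \<pi> g $$ (a, j)) (\<lambda>g. \<rho> g $$ (b, l)))"
      using j l d d' by (intro ip_sum_right cont_intros) (auto intro!: rep_cf r1 r2)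
    also have "\<dots> = (\<Sum>b<d'. cnj (\<rho> h $$ (k, b)) * (\<Sum>a<d. \<pi> h $$ (i, a) * ip (\<lambda>g. \<pi> g $$ (a, j)) (\<lambda>g. \<rho> g $$ (b, l))))"
      using j l d d' by (intro sum.cong refl arg_cong2[where f="(*)"] ip_sum_left) (auto intro!: rep_cf r1 r2)
    also have "\<dots> = (\<Sum>b<d'. (\<pi> h * B) $$ (i, b) * adj (\<rho> h) $$ (b, k))"
    proof (intro sum.cong refl)
      fix b assume "b \<in> {..<d'}"
      then have b: "b < d'" by simp
      show "cnj (\<rho> h $$ (k, b)) * (\<Sum>a<d. \<pi> h $$ (i, a) * ip (\<lambda>g. \<pi> g $$ (a, j)) (\<lambda>g. \<rho> g $$ (b, l))) =
          (\<pi> h * B) $$ (i, b) * adj (\<rho> h) $$ (b, k)"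
        unfolding mult_mat_index[OF p1[OF h] Bc i b] using p2[OF h] k b by (simp add: B mult.commute)
    qed
    also have "\<dots> = (\<pi> h * B * adj (\<rho> h)) $$ (i, k)"
      using mult_mat_index[OF pB aR i k] by simp
    finally show "(\<pi> h * B * adj (\<rho> h)) $$ (i, k) = B $$ (i, k)" by simp
  qed (use p1[OF h] p2[OF h] B in auto)
  then have "B * \<rho> h = \<pi> h * B * adj (\<rho> h) * \<rho> h" by simp
  also have "\<dots> = \<pi> h * B * (adj (\<rho> h) * \<rho> h)" by (rule assoc_mult_mat[OF pB aR p2[OF h]])
  also have "adj (\<rho> h) * \<rho> h = 1\<^sub>m d'" using rep_unitary[OF r2 h] d' by (simp add: unitary_mat_iff_adj)
  finally show ?thesis using right_mult_one_mat[OF pB] by simp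
qed

text \<open>The averaged matrix maps the space of \<open>\<rho>\<close> to that of
  \<open>\<pi>\<close>, hence the order in the hypothesis of inequivalence.\<close>

lemma orthogonality_inequivalent:
  assumes irr1: "irreducible_unitary_rep G T \<pi>" and irr2: "irreducible_unitary_rep G T \<rho>"
    and ne: "\<not> unitarily_equivalent G \<rho> \<pi>"
    and "i < rep_dim G \<pi>" "j < rep_dim G \<pi>" "k < rep_dim G \<rho>" "l < rep_dim G \<rho>"
  shows "ip (\<lambda>g. \<pi> g $$ (i, j)) (\<lambda>g. \<rho> g $$ (k, l)) = 0"
proof -
  define B where "B = Matrix.mat (rep_dim G \<pi>) (rep_dim G \<rho>) (\<lambda>(i, k). ip (\<lambda>g. \<pi> g $$ (i, j)) (\<lambda>g. \<rho> g $$ (k, l)))"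
  have "B = 0\<^sub>m (rep_dim G \<pi>) (rep_dim G \<rho>)"
  proof (rule ccontr)
    assume "B \<noteq> 0\<^sub>m (rep_dim G \<pi>) (rep_dim G \<rho>)"
    then have "unitarily_equivalent G \<rho> \<pi>"
      using assms integral_intertwines[OF irrepD(1)[OF irr1] irrepD(1)[OF irr2] refl refl _ _ B_def]
      by (intro schur_intertwiner[OF irr2 irr1 refl refl, of B]) (auto simp: B_def)
    with ne show False by simp
  qed
  then have "B $$ (i, k) = 0" using assms by simp
  then show ?thesis using assms by (simp add: B_def)
qed

text \<open>By Schur the integral vanishes unless i = k, and then depends on j and l only. Replacing
  g by its inverse exchanges the roles of rows and columns, which settles j and l; the norm of a
  unitary column fixes the constant.\<close>

lemma orthogonality_same:
  assumes irr: "irreducible_unitary_rep G T \<pi>" and d: "d = rep_dim G \<pi>"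
    and ijkl: "i < d" "j < d" "k < d" "l < d"
  shows "ip (\<lambda>g. \<pi> g $$ (i, j)) (\<lambda>g. \<pi> g $$ (k, l)) = (if i = k \<and> j = l then 1 / of_nat d else 0)"
proof -
  note rep = irrepD(1)[OF irr]
  let ?I = "\<lambda>i j k l. ip (\<lambda>g. \<pi> g $$ (i, j)) (\<lambda>g. \<pi> g $$ (k, l))"
  have "\<exists>c. \<forall>i<d. \<forall>k<d. ?I i j k l = (if i = k then c else 0)" if jl: "j < d" "l < d" for j l
  proof -
    define B where "B = Matrix.mat d d (\<lambda>(i, k). ?I i j k l)"
    have "\<exists>c. B = c \<cdot>\<^sub>m 1\<^sub>m d"
    proof (rule schur_scalar[OF irr d])
      show "B \<in> carrier_mat d d" by (simp add: B_def)
      show "B * \<pi> g = \<pi> g * B" if "g \<in> carrier G" for g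
        by (rule integral_intertwines[OF rep rep d d jl B_def that])
    qed
    then obtain c where c: "B = c \<cdot>\<^sub>m 1\<^sub>m d" by blast
    have "?I i j k l = (if i = k then c else 0)" if "i < d" "k < d" for i k
    proof -
      have "?I i j k l = B $$ (i, k)" using that by (simp add: B_def)
      also have "\<dots> = (if i = k then c else 0)" unfolding c using that by simp
      finally show ?thesis .
    qed
    then show ?thesis by blast
  qed
  then obtain c where c: "\<And>j l i k. j < d \<Longrightarrow> l < d \<Longrightarrow> i < d \<Longrightarrow> k < d \<Longrightarrow> ?I i j k l = (if i = k then c j l else 0)"
    by metis
  have swap: "?I i j k l = ?I l k j i" if "i < d" "j < d" "k < d" "l < d" for i j k l
  proof -
    have "?I i j k l = (\<integral>g. \<pi> (inv g) $$ (i, j) * cnj (\<pi> (inv g) $$ (k, l)) \<partial>m)"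
      unfolding ip_def using that d
      by (intro inverse_invariant[symmetric] cont_intros) (auto intro!: rep_cf rep)
    also have "\<dots> = (\<integral>g. \<pi> g $$ (l, k) * cnj (\<pi> g $$ (j, i)) \<partial>m)"
    proof (rule integral_cong'[OF borel_prob_haar])
      fix g assume g: "g \<in> carrier G"
      show "\<pi> (inv g) $$ (i, j) * cnj (\<pi> (inv g) $$ (k, l)) = \<pi> g $$ (l, k) * cnj (\<pi> g $$ (j, i))"
        using that d rep_carrier[OF rep g] by (simp add: rep_inv[OF rep g] mult.commute)
    qed
    finally show ?thesis by (simp add: ip_def)
  qed
  have cjl: "c j l = 0" if "j < d" "l < d" "j \<noteq> l" for j l
    using c[of j l j j] c[of j j l j] swap[of j j j l] that by auto
  have cjj: "c j j = c i i" if "i < d" "j < d" for i j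
    using c[of j j i i] c[of i i j j] swap[of i j i j] that by auto
  have "of_nat d * c j j = (\<Sum>i<d. ?I i j i j)" using c ijkl by simp
  also have "\<dots> = (\<integral>g. (\<Sum>i<d. \<pi> g $$ (i, j) * cnj (\<pi> g $$ (i, j))) \<partial>m)"
    unfolding ip_def using ijkl d
    by (intro Bochner_Integration.integral_sum[symmetric] int_m cont_intros) (auto intro!: rep_cf rep)
  also have "\<dots> = (\<integral>g. 1 \<partial>m)"
    using unitary_mat_columns[OF rep_unitary[OF rep]] ijkl d by (intro integral_cong'[OF borel_prob_haar]) auto
  also have "\<dots> = 1" by (rule integral_const[OF borel_prob_haar])
  finally have "c j j = 1 / of_nat d" using ijkl by (simp add: field_simps)
  then show ?thesis using c cjl ijkl by auto
qed

section \<open>Matrix coefficients for arbitrary vectors\<close>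

definition coef :: "'g rep \<Rightarrow> complex Matrix.vec \<Rightarrow> complex Matrix.vec \<Rightarrow> 'g \<Rightarrow> complex" where
  "coef \<pi> v w g = (\<pi> g *\<^sub>v v) \<bullet>c w"

lemma coef_sum:
  assumes rep: "unitary_rep G T \<pi>" and d: "d = rep_dim G \<pi>" and v: "v \<in> carrier_vec d" and w: "w \<in> carrier_vec d"
    and g: "g \<in> carrier G"
  shows "coef \<pi> v w g = (\<Sum>p\<in>{..<d} \<times> {..<d}. v $ snd p * cnj (w $ fst p) * \<pi> g $$ p)"
proof -
  have p: "\<pi> g \<in> carrier_mat d d" using rep_carrier[OF rep g] d by simp
  have "coef \<pi> v w g = (\<Sum>i<d. \<Sum>j<d. v $ j * cnj (w $ i) * \<pi> g $$ (i, j))"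
    unfolding coef_def
    by (simp add: cscalar_sum[OF w] mult_mat_vec_index'[OF p v] sum_distrib_right sum_distrib_left mult_ac)
  then show ?thesis by (simp add: sum.cartesian_product case_prod_beta')
qed

lemma cf_coef:
  assumes rep: "unitary_rep G T \<pi>" and v: "v \<in> carrier_vec (rep_dim G \<pi>)" and w: "w \<in> carrier_vec (rep_dim G \<pi>)"
  shows "cf (coef \<pi> v w)"
proof (rule continuous_map_eq)
  show "cf (\<lambda>g. \<Sum>p\<in>{..<rep_dim G \<pi>} \<times> {..<rep_dim G \<pi>}. v $ snd p * cnj (w $ fst p) * \<pi> g $$ p)"
    by (intro cont_intros) (auto intro!: rep_cf rep)
qed (use coef_sum[OF rep refl v w] topspace in auto)

lemma ip_coef:
  assumes r1: "unitary_rep G T \<pi>" and r2: "unitary_rep G T \<rho>"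
    and d: "d = rep_dim G \<pi>" and d': "d' = rep_dim G \<rho>"
    and v: "v \<in> carrier_vec d" "w \<in> carrier_vec d" and v': "v' \<in> carrier_vec d'" "w' \<in> carrier_vec d'"
  shows "ip (coef \<pi> v w) (coef \<rho> v' w') = (\<Sum>q\<in>{..<d'} \<times> {..<d'}. \<Sum>p\<in>{..<d} \<times> {..<d}.
    cnj (v' $ snd q * cnj (w' $ fst q)) * (v $ snd p * cnj (w $ fst p)) * ip (\<lambda>g. \<pi> g $$ p) (\<lambda>g. \<rho> g $$ q))"
proof -
  have "ip (coef \<pi> v w) (coef \<rho> v' w') =
      ip (\<lambda>g. \<Sum>p\<in>{..<d} \<times> {..<d}. v $ snd p * cnj (w $ fst p) * \<pi> g $$ p)
         (\<lambda>g. \<Sum>q\<in>{..<d'} \<times> {..<d'}. v' $ snd q * cnj (w' $ fst q) * \<rho> g $$ q)"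
    by (intro ip_cong coef_sum r1 r2 d d' v v')
  also have "\<dots> = (\<Sum>q\<in>{..<d'} \<times> {..<d'}. cnj (v' $ snd q * cnj (w' $ fst q)) *
      ip (\<lambda>g. \<Sum>p\<in>{..<d} \<times> {..<d}. v $ snd p * cnj (w $ fst p) * \<pi> g $$ p) (\<lambda>g. \<rho> g $$ q))"
    using d d' by (intro ip_sum_right cont_intros) (auto intro!: rep_cf r1 r2)
  also have "\<dots> = (\<Sum>q\<in>{..<d'} \<times> {..<d'}. cnj (v' $ snd q * cnj (w' $ fst q)) *
      (\<Sum>p\<in>{..<d} \<times> {..<d}. (v $ snd p * cnj (w $ fst p)) * ip (\<lambda>g. \<pi> g $$ p) (\<lambda>g. \<rho> g $$ q)))"
    using d d' by (intro sum.cong refl arg_cong2[where f="(*)"] ip_sum_left) (auto intro!: rep_cf r1 r2)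
  finally show ?thesis by (simp add: sum_distrib_left mult.assoc)
qed

lemma coef_orthogonal:
  assumes irr1: "irreducible_unitary_rep G T \<pi>" and irr2: "irreducible_unitary_rep G T \<rho>"
    and ne: "\<not> unitarily_equivalent G \<rho> \<pi>"
    and "v \<in> carrier_vec (rep_dim G \<pi>)" "w \<in> carrier_vec (rep_dim G \<pi>)"
      "v' \<in> carrier_vec (rep_dim G \<rho>)" "w' \<in> carrier_vec (rep_dim G \<rho>)"
  shows "ip (coef \<pi> v w) (coef \<rho> v' w') = 0"
  using assms
  by (auto simp: ip_coef irrepD(1) orthogonality_inequivalent intro!: sum.neutral)

lemma coef_schur:
  assumes irr: "irreducible_unitary_rep G T \<pi>" and d: "d = rep_dim G \<pi>"
    and vw: "v \<in> carrier_vec d" "w \<in> carrier_vec d" "v' \<in> carrier_vec d" "w' \<in> carrier_vec d"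
  shows "ip (coef \<pi> v w) (coef \<pi> v' w') = (v \<bullet>c v') * cnj (w \<bullet>c w') / of_nat d"
proof -
  have "ip (coef \<pi> v w) (coef \<pi> v' w') = (\<Sum>q\<in>{..<d} \<times> {..<d}. \<Sum>p\<in>{..<d} \<times> {..<d}.
     if p = q then cnj (v' $ snd q * cnj (w' $ fst q)) * (v $ snd q * cnj (w $ fst q)) / of_nat d else 0)"
    unfolding ip_coef[OF irrepD(1)[OF irr] irrepD(1)[OF irr] d d vw]
    by (intro sum.cong refl) (auto simp: orthogonality_same[OF irr d] split: if_splits)
  also have "\<dots> = (\<Sum>q\<in>{..<d} \<times> {..<d}. cnj (v' $ snd q * cnj (w' $ fst q)) * (v $ snd q * cnj (w $ fst q)) / of_nat d)"
    by (intro sum.cong refl) (simp add: sum.delta)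
  also have "\<dots> = (\<Sum>i<d. \<Sum>j<d. (v $ j * cnj (v' $ j)) * cnj (w $ i * cnj (w' $ i)) / of_nat d)"
    by (simp add: sum.cartesian_product case_prod_beta' mult_ac)
  also have "\<dots> = (v \<bullet>c v') * cnj (w \<bullet>c w') / of_nat d"
    by (simp add: cscalar_sum[OF vw(3)] cscalar_sum[OF vw(4)] sum_distrib_left sum_distrib_right
        flip: sum_divide_distrib)
  finally show ?thesis .
qed

end

section \<open>Convolution and the uniqueness part of the Peter--Weyl theorem\<close>

text \<open>Log-convexity makes the ratios A (n+1) / A n increase, submultiplicativity bounds them
  by \<open>A 0\<close>, and \<open>L\<close> is their limit. Index \<open>n\<close> stands for the
  power n + 1, hence the shifts by one.\<close>

lemma log_convex_submultiplicative:
  fixes A :: "nat \<Rightarrow> real"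
  assumes pos: "\<And>n. A n > 0" and lc: "\<And>n. (A (Suc n))\<^sup>2 \<le> A n * A (Suc (Suc n))"
    and sm: "\<And>i j. A (i + j + 1) \<le> A i * A j"
  obtains L where "L > 0" "\<And>n. A (Suc n) \<le> L * A n" "\<And>n. L ^ Suc n \<le> A n"
proof -
  define r where "r n = A (Suc n) / A n" for n
  have rpos: "r n > 0" for n using pos by (simp add: r_def)
  have step: "r n \<le> r (Suc n)" for n
    using lc[of n] pos[of n] pos[of "Suc n"] by (simp add: r_def field_simps power2_eq_square)
  then have "incseq r" by (simp add: incseq_Suc_iff)
  moreover have bnd: "r n \<le> A 0" for n using sm[of n 0] pos[of n] by (simp add: r_def field_simps)
  ultimately obtain L where L: "r \<longlonglongrightarrow> L" "\<And>n. r n \<le> L" using incseq_convergent by blast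
  have Lpos: "L > 0" using rpos[of 0] L(2)[of 0] by linarith
  have up: "A (Suc n) \<le> L * A n" for n using L(2)[of n] pos[of n] by (simp add: r_def field_simps)
  \<comment> \<open>If r^(k+1) exceeded \<open>A k\<close>, then along the indices (k+1)(i+1) - 1
    submultiplicativity would force \<open>A\<close> below the geometric growth that increasing
    ratios guarantee.\<close>
  have low: "r n ^ Suc k \<le> A k" for n k
  proof -
    have g: "A n * r n ^ j \<le> A (n + j)" for j
    proof (induction j)
      case (Suc j)
      have "r n \<le> r (n + j)" using \<open>incseq r\<close> by (simp add: incseq_def)
      have "A n * r n ^ Suc j = r n * (A n * r n ^ j)" by simp
      also have "\<dots> \<le> r (n + j) * A (n + j)"
        using Suc.IH \<open>r n \<le> r (n + j)\<close> rpos[of n] rpos[of "n+j"] pos[of n] by (intro mult_mono) auto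
      also have "\<dots> = A (n + Suc j)" using pos[of "n + j"] by (simp add: r_def)
      finally show ?case .
    qed simp
    have sub: "A (k * Suc i + i) \<le> A k ^ Suc i" for i
    proof (induction i)
      case (Suc i)
      have "A (k * Suc (Suc i) + Suc i) = A (k + (k * Suc i + i) + 1)" by (simp add: algebra_simps)
      also have "\<dots> \<le> A k * A (k * Suc i + i)" by (rule sm)
      also have "\<dots> \<le> A k * A k ^ Suc i" using Suc.IH pos[of k] by (intro mult_left_mono) auto
      finally show ?case by simp
    qed simp
    \<comment> \<open>A positive constant that stays below all large powers of A k / r^(k+1); if
      that quotient were less than 1, its powers would tend to 0.\<close>
    define c where "c = A n / r n ^ Suc n"
    have cpos: "c > 0" using pos rpos by (simp add: c_def)
    have ev: "c \<le> (A k / r n ^ Suc k) ^ Suc i" if "i \<ge> n" for i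
    proof -
      have i: "k * Suc i + i = n + (k * Suc i + (i - n))" using that by simp
      have e: "Suc n + (k * Suc i + (i - n)) = Suc k * Suc i" using that by (simp add: algebra_simps)
      have "c * r n ^ (Suc k * Suc i) = A n * r n ^ (k * Suc i + (i - n))"
        using rpos[of n] unfolding e[symmetric] power_add c_def by simp
      also have "\<dots> \<le> A k ^ Suc i" using g[of "k * Suc i + (i - n)"] sub[of i] i by simp
      finally have "c * (r n ^ Suc k) ^ Suc i \<le> A k ^ Suc i" by (simp only: power_mult)
      then show ?thesis using rpos[of n] by (simp add: power_divide pos_le_divide_eq)
    qed
    show ?thesis
    proof (rule ccontr)
      assume "\<not> r n ^ Suc k \<le> A k"
      then have lt: "A k / r n ^ Suc k < 1" using rpos[of n] by (simp add: divide_simps)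
      have ge: "0 \<le> A k / r n ^ Suc k" using pos[of k] rpos[of n] by (simp add: less_imp_le)
      have "(\<lambda>i. (A k / r n ^ Suc k) ^ Suc i) \<longlonglongrightarrow> 0"
        using LIMSEQ_realpow_zero[OF ge lt] LIMSEQ_Suc by blast
      then have "c \<le> 0" using ev by (intro LIMSEQ_le_const) auto
      with cpos show False by simp
    qed
  qed
  have "L ^ Suc k \<le> A k" for k
    using low[of _ k] by (intro LIMSEQ_le_const2[OF tendsto_power[OF L(1)]]) auto
  with that Lpos up show thesis by blast
qed

section \<open>The convolution algebra and its eigenfunctions\<close>

context compact_group
begin

definition conv :: "('g \<Rightarrow> complex) \<Rightarrow> ('g \<Rightarrow> complex) \<Rightarrow> 'g \<Rightarrow> complex" where
  "conv f h x = (\<integral>y. f y * h (inv y \<otimes> x) \<partial>m)"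

text \<open>The involution of the convolution algebra: \<open>star f\<close> is the kernel of the
  adjoint of left convolution by \<open>f\<close>, so agreement of \<open>star k\<close> with
  \<open>k\<close> on the group makes that operator self-adjoint.\<close>

definition star :: "('g \<Rightarrow> complex) \<Rightarrow> 'g \<Rightarrow> complex" where
  "star f x = cnj (f (inv x))"

lemma cf_star:
  assumes f: "cf f" shows "cf (star f)"
  unfolding star_def by (intro continuous_map_cnj continuous_map_compose'[OF f] continuous_inv)

lemma cf_conv:
  assumes f: "cf f" and h: "cf h" shows "cf (conv f h)"
proof -
  let ?F = "\<lambda>z. f (snd z) * h (inv (snd z) \<otimes> fst z)"
  have "continuous_map (prod_topology T T) euclidean ?F"
    by (intro continuous_map_mult continuous_map_compose'[OF f] continuous_map_compose'[OF h] cont_group)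
  from continuous_parameter_integral[OF borel_prob_haar this] show ?thesis unfolding conv_def by simp
qed

lemma conv_cong:
  assumes "\<And>y. y \<in> carrier G \<Longrightarrow> f y = f' y" "\<And>y. y \<in> carrier G \<Longrightarrow> h y = h' y" "x \<in> carrier G"
  shows "conv f h x = conv f' h' x"
  unfolding conv_def using assms by (intro integral_cong'[OF borel_prob_haar]) auto

lemma conv_assoc:
  assumes f: "cf f" and g: "cf g" and h: "cf h" and x: "x \<in> carrier G"
  shows "conv (conv f g) h x = conv f (conv g h) x"
proof -
  let ?F = "\<lambda>p. f (snd p) * g (inv (snd p) \<otimes> fst p) * h (inv (fst p) \<otimes> x)"
  have F: "continuous_map (prod_topology T T) euclidean ?F"
    by (intro continuous_map_mult continuous_map_compose'[OF f] continuous_map_compose'[OF g]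
      continuous_map_compose'[OF h] cont_group x)
  have "conv (conv f g) h x = (\<integral>y. (\<integral>z. f z * g (inv z \<otimes> y) * h (inv y \<otimes> x) \<partial>m) \<partial>m)"
    unfolding conv_def by simp
  also have "\<dots> = (\<integral>z. (\<integral>y. f z * g (inv z \<otimes> y) * h (inv y \<otimes> x) \<partial>m) \<partial>m)"
    using fubini[OF borel_prob_haar borel_prob_haar F] by (simp only: fst_conv snd_conv)
  also have "\<dots> = (\<integral>z. f z * (\<integral>y. g y * h (inv y \<otimes> (inv z \<otimes> x)) \<partial>m) \<partial>m)"
  proof (rule integral_cong'[OF borel_prob_haar])
    fix z assume z: "z \<in> carrier G"
    have "(\<integral>y. f z * g (inv z \<otimes> y) * h (inv y \<otimes> x) \<partial>m) =
          (\<integral>y. f z * g (inv z \<otimes> (z \<otimes> y)) * h (inv (z \<otimes> y) \<otimes> x) \<partial>m)"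
      by (intro left_invariant[symmetric] cont_intros continuous_map_compose'[OF g]
        continuous_map_compose'[OF h] cont_group z x) (use z x in auto)
    also have "\<dots> = (\<integral>y. f z * (g y * h (inv y \<otimes> (inv z \<otimes> x))) \<partial>m)"
      using z x by (intro integral_cong'[OF borel_prob_haar]) (simp add: inv_mult_group m_assoc flip: m_assoc[of "inv z" z])
    finally show "(\<integral>y. f z * g (inv z \<otimes> y) * h (inv y \<otimes> x) \<partial>m) =
        f z * (\<integral>y. g y * h (inv y \<otimes> (inv z \<otimes> x)) \<partial>m)" by simp
  qed
  finally show ?thesis by (simp add: conv_def)
qed

lemma star_conv:
  assumes f: "cf f" and h: "cf h" and x: "x \<in> carrier G"
  shows "star (conv f h) x = conv (star h) (star f) x"
proof -
  let ?F = "\<lambda>y. cnj (h (inv y)) * cnj (f (inv (inv y \<otimes> x)))"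
  have F: "cf ?F"
    by (intro cont_intros continuous_map_compose'[OF f] continuous_map_compose'[OF h] cont_group x)
  have "conv (star h) (star f) x = (\<integral>y. ?F y \<partial>m)" by (simp add: conv_def star_def)
  also have "\<dots> = (\<integral>y. ?F (x \<otimes> y) \<partial>m)" by (rule left_invariant[OF F x, symmetric])
  also have "\<dots> = (\<integral>y. cnj (f y * h (inv y \<otimes> inv x)) \<partial>m)"
    using x by (intro integral_cong'[OF borel_prob_haar])
      (simp add: inv_mult_group m_assoc flip: m_assoc[of "inv x" x])
  also have "\<dots> = star (conv f h) x" by (simp add: star_def conv_def flip: Bochner_Integration.integral_cnj)
  finally show ?thesis by simp
qed

text \<open>Inner products become values at the identity, so for self-adjoint \<open>k\<close> the
  norms of convolution powers are values of higher powers.\<close>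

lemma ip_eq_conv: "cf f \<Longrightarrow> cf h \<Longrightarrow> ip f h = conv f (star h) \<one>"
  unfolding ip_def conv_def star_def by (intro integral_cong'[OF borel_prob_haar]) simp

lemma nsq_invariant:
  assumes h: "cf h" and x: "x \<in> carrier G"
  shows "nsq (\<lambda>y. cnj (h (inv y \<otimes> x))) = nsq h"
proof -
  let ?q = "\<lambda>y. complex_of_real ((cmod (h y))\<^sup>2)"
  have q: "cf ?q" by (intro continuous_map_of_real cont_cmod_sq h)
  have "complex_of_real (nsq (\<lambda>y. cnj (h (inv y \<otimes> x)))) = (\<integral>y. ?q (inv y \<otimes> x) \<partial>m)"
    by (simp add: nsq_def flip: integral_complex_of_real)
  also have "\<dots> = (\<integral>y. ?q (y \<otimes> x) \<partial>m)"
    by (intro inverse_invariant[of "\<lambda>y. ?q (y \<otimes> x)"] continuous_map_compose'[OF q] cont_group x)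
  also have "\<dots> = (\<integral>y. ?q y \<partial>m)" by (rule right_invariant[OF q x])
  also have "\<dots> = complex_of_real (nsq h)" by (simp add: nsq_def flip: integral_complex_of_real)
  finally show ?thesis by (simp only: of_real_eq_iff)
qed

text \<open>Cauchy-Schwarz together with invariance of Haar measure under y \<mapsto> y^(-1) x. This
  smoothing turns L^2 convergence into uniform convergence.\<close>

lemma conv_bound:
  assumes f: "cf f" and h: "cf h" and x: "x \<in> carrier G"
  shows "(cmod (conv f h x))\<^sup>2 \<le> nsq f * nsq h"
proof -
  have "conv f h x = ip f (\<lambda>y. cnj (h (inv y \<otimes> x)))" by (simp add: conv_def ip_def)
  moreover have "cf (\<lambda>y. cnj (h (inv y \<otimes> x)))"
    by (intro cont_intros continuous_map_compose'[OF h] cont_group x)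
  ultimately show ?thesis using cauchy_schwarz[OF f, of "\<lambda>y. cnj (h (inv y \<otimes> x))"] nsq_invariant[OF h x] by simp
qed

lemma nsq_le:
  assumes f: "cf f" and b: "\<And>x. x \<in> carrier G \<Longrightarrow> (cmod (f x))\<^sup>2 \<le> C"
  shows "nsq f \<le> C"
  using norm_integral_le[OF borel_prob_haar cont_cmod_sq[OF f], of C] b by (simp add: nsq_def)

lemma nsq_conv: "cf f \<Longrightarrow> cf h \<Longrightarrow> nsq (conv f h) \<le> nsq f * nsq h"
  by (intro nsq_le cf_conv conv_bound)

lemma nsq_pos:
  assumes "cf f" "x \<in> carrier G" "f x \<noteq> 0" shows "nsq f > 0"
  using nsq_eq_0[OF assms(1) _ assms(2)] assms(3) nsq_nonneg[of f] by force

text \<open>\<open>cpow k n\<close> has n + 1 factors: no unit for convolution is at hand, so the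
  sequence begins with \<open>k\<close> itself and products of powers shift the index by
  one.\<close>

primrec cpow :: "('g \<Rightarrow> complex) \<Rightarrow> nat \<Rightarrow> 'g \<Rightarrow> complex" where
  "cpow k 0 = k"
| "cpow k (Suc n) = conv k (cpow k n)"

lemma cf_cpow: "cf k \<Longrightarrow> cf (cpow k n)"
  by (induction n) (auto intro: cf_conv)

lemma conv_cpow:
  assumes k: "cf k" and x: "x \<in> carrier G"
  shows "conv (cpow k i) (cpow k j) x = cpow k (i + j + 1) x"
  using x
proof (induction i arbitrary: x)
  case (Suc i)
  have "conv (cpow k (Suc i)) (cpow k j) x = conv k (conv (cpow k i) (cpow k j)) x"
    using conv_assoc[OF k cf_cpow[OF k] cf_cpow[OF k] Suc.prems] by simp
  also have "\<dots> = conv k (cpow k (i + j + 1)) x" using Suc.IH Suc.prems by (intro conv_cong) auto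
  finally show ?case by simp
qed simp

lemma star_cpow:
  assumes k: "cf k" and sa: "\<And>x. x \<in> carrier G \<Longrightarrow> star k x = k x" and x: "x \<in> carrier G"
  shows "star (cpow k i) x = cpow k i x"
  using x
proof (induction i arbitrary: x)
  case (Suc i)
  have "star (cpow k (Suc i)) x = conv (star (cpow k i)) (star k) x"
    using star_conv[OF k cf_cpow[OF k] Suc.prems] by simp
  also have "\<dots> = conv (cpow k i) (cpow k 0) x" using Suc.IH sa Suc.prems by (intro conv_cong) auto
  also have "\<dots> = cpow k (Suc i) x" using conv_cpow[OF k Suc.prems, of i 0] by simp
  finally show ?case .
qed (use sa in simp)

text \<open>Power iteration: with \<open>A n\<close> the squared \<open>L\<^sup>2\<close>-norm of the convolution power \<open>k\<^sup>n\<^sup>+\<^sup>1\<close>, self-adjointness makes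
  \<open>A\<close> log-convex and Cauchy--Schwarz makes it submultiplicative.  Hence \<open>A (n + 1) / A n\<close> increases to some \<open>L\<close>
  with \<open>A n \<ge> L\<^sup>n\<^sup>+\<^sup>1\<close>, and \<open>k\<^sup>2\<^sup>n / L\<^sup>n\<close> converges uniformly to a non-zero eigenfunction.  This replaces
  the spectral theorem for compact operators.\<close>

lemma convolution_eigenfunction:
  assumes k: "cf k" and sa: "\<And>x. x \<in> carrier G \<Longrightarrow> star k x = k x"
    and x0: "x0 \<in> carrier G" "k x0 \<noteq> 0"
  obtains L q x1 where "L > (0::real)" "cf q" "x1 \<in> carrier G" "q x1 \<noteq> 0"
    "\<And>x. x \<in> carrier G \<Longrightarrow> conv (conv k k) q x = of_real L * q x"
proof -
  let ?P = "cpow k"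
  define A where "A n = nsq (?P n)" for n
  have P: "cf (?P n)" for n by (rule cf_cpow[OF k])
  \<comment> \<open>Self-adjointness makes the inner product of two powers depend only on the sum of
    the indices.\<close>
  have ipP: "ip (?P i) (?P j) = ?P (i + j + 1) \<one>" for i j
    using conv_cong[of "?P i" "?P i" "star (?P j)" "?P j" \<one>] star_cpow[OF k sa] conv_cpow[OF k, of \<one> i j]
    by (simp add: ip_eq_conv P)
  have AP: "of_real (A n) = ?P (2 * n + 1) \<one>" for n
    unfolding A_def ip_self[symmetric] ipP by (simp add: mult_2)
  have nn: "A n \<ge> 0" for n by (simp add: A_def nsq_nonneg)
  have sm: "A (i + j + 1) \<le> A i * A j" for i j
  proof -
    have "A (i + j + 1) = nsq (conv (?P i) (?P j))"
      unfolding A_def by (rule nsq_cong) (simp add: conv_cpow[OF k])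
    then show ?thesis unfolding A_def by (simp add: nsq_conv P)
  qed
  have lc: "(A (Suc n))\<^sup>2 \<le> A n * A (Suc (Suc n))" for n
  proof -
    have "complex_of_real (A (Suc n)) = ip (?P n) (?P (Suc (Suc n)))"
      unfolding ipP AP by (simp add: mult_2)
    then have "(A (Suc n))\<^sup>2 = (cmod (ip (?P n) (?P (Suc (Suc n)))))\<^sup>2"
      by (metis norm_of_real power2_abs)
    then show ?thesis using cauchy_schwarz[OF P P, of n "Suc (Suc n)"] by (simp only: A_def)
  qed
  have A0: "A 0 > 0" unfolding A_def using nsq_pos[OF k x0] by simp
  \<comment> \<open>\<open>A j\<close> is the value at the identity of the power with index 2j + 1,
    so positivity passes from \<open>j\<close> to 2j + 1 and holds at arbitrarily large indices; a
    zero would propagate upwards by submultiplicativity.\<close>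
  have pos: "A n > 0" for n
  proof -
    have "\<exists>j\<ge>n. A j > 0"
    proof (induction n)
      case (Suc n)
      then obtain j where j: "j \<ge> n" "A j > 0" by blast
      have "?P (2 * j + 1) \<one> \<noteq> 0" using j unfolding AP[symmetric] by simp
      then have "A (2 * j + 1) > 0" unfolding A_def by (intro nsq_pos[OF P one_closed])
      then show ?case using j by (intro exI[of _ "2 * j + 1"]) auto
    qed (use A0 in auto)
    then obtain j where j: "j \<ge> n" "A j > 0" by blast
    show ?thesis
    proof (rule ccontr)
      assume "\<not> A n > 0"
      then have "A n = 0" using nn[of n] by simp
      moreover from this have "A (n + i) = 0" for i
      proof (cases i)
        case (Suc i')
        then show ?thesis using sm[of n i'] \<open>A n = 0\<close> nn[of "n + i"] by simp
      qed simp
      from this[of "j - n"] show False using j by simp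
    qed
  qed
  obtain L where L: "L > 0" "\<And>n. A (Suc n) \<le> L * A n" "\<And>n. L ^ Suc n \<le> A n"
    using log_convex_submultiplicative[of A, OF pos lc sm] by metis
  define B where "B n = A n / L ^ Suc n" for n
  have "decseq B"
    unfolding decseq_Suc_iff B_def using L(1,2) by (simp add: divide_simps mult.commute)
  moreover have B1: "1 \<le> B n" for n using L by (simp add: B_def)
  ultimately obtain b where b: "B \<longlonglongrightarrow> b" using decseq_convergent by blast
  \<comment> \<open>Index 2n + 1 means 2(n + 1) factors \<open>k\<close>, that is n + 1 factors
    \<open>conv k k\<close>; hence the normalisation by L^(n+1) and the eigenvalue \<open>L\<close>
    of convolution by \<open>conv k k\<close>.\<close>
  define S where "S n x = of_real (1 / L ^ Suc n) * ?P (2 * n + 1) x" for n x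
  have S: "cf (S n)" for n unfolding S_def by (intro cont_intros P)
  have ipS: "ip (S i) (S j) = of_real (B (i + j + 1))" for i j
  proof -
    have "ip (S i) (S j) = of_real (1 / L ^ Suc i) * (of_real (1 / L ^ Suc j) * ip (?P (2 * i + 1)) (?P (2 * j + 1)))"
      unfolding S_def by (simp only: ip_scale_left ip_scale_right complex_cnj_complex_of_real)
    also have "ip (?P (2 * i + 1)) (?P (2 * j + 1)) = of_real (A (i + j + 1))"
      unfolding ipP AP by (simp add: algebra_simps)
    finally show ?thesis by (simp add: B_def power_add mult_ac)
  qed
  \<comment> \<open>All three values of \<open>B\<close> tend to the same limit, so \<open>S\<close>
    is Cauchy in L^2.\<close>
  have nsqS: "nsq (\<lambda>x. S i x - S j x) = B (2 * i + 1) + B (2 * j + 1) - 2 * B (i + j + 1)" for i j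
  proof -
    have "nsq (S n) = B (2 * n + 1)" for n
      using ip_self[of "S n"] ipS[of n n] by (simp add: mult_2)
    then show ?thesis using nsq_diff[OF S S, of i j] ipS[of i j] by simp
  qed
  define s where "s = conv k k"
  have s: "cf s" unfolding s_def by (rule cf_conv[OF k k])
  have convS: "conv s (S n) x = of_real L * S (Suc n) x" if x: "x \<in> carrier G" for n x
  proof -
    have "conv s (S n) x = of_real (1 / L ^ Suc n) * conv (?P 1) (?P (2 * n + 1)) x"
      unfolding conv_def[of s] conv_def[of "?P 1"] S_def by (simp add: s_def mult.left_commute)
    also have "\<dots> = of_real (1 / L ^ Suc n) * ?P (2 * Suc n + 1) x"
      unfolding conv_cpow[OF k x] by (simp only: mult_Suc_right add.assoc add.left_commute add.commute flip: one_add_one)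
    finally show ?thesis using L(1) by (simp add: S_def)
  qed
  have "\<exists>M. \<forall>i\<ge>M. \<forall>j\<ge>M. \<forall>x\<in>carrier G. dist (S i x) (S j x) < e" if e: "e > 0" for e
  proof -
    \<comment> \<open>Chosen so that 4 (nsq s + 1) \<delta> = e^2 L^2. The 4 counts the deviations
      of \<open>B\<close> from its limit, the mixed one twice; the summand 1 covers the case that
      \<open>nsq s\<close> is zero.\<close>
    define \<delta> where "\<delta> = e\<^sup>2 * L\<^sup>2 / (4 * (nsq s + 1))"
    have \<delta>: "\<delta> > 0" using e L(1) nsq_nonneg[of s] by (simp add: \<delta>_def)
    obtain M where M: "\<And>n. n \<ge> M \<Longrightarrow> \<bar>B n - b\<bar> < \<delta>"
      using b \<delta> unfolding LIMSEQ_iff real_norm_def by meson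
    have "dist (S i x) (S j x) < e" if ij: "i \<ge> Suc M" "j \<ge> Suc M" and x: "x \<in> carrier G" for i j x
    proof -
      obtain i' j' where ij': "i = Suc i'" "j = Suc j'" "i' \<ge> M" "j' \<ge> M"
        using ij Suc_le_D Suc_le_mono by metis
      have small: "nsq (\<lambda>x. S i' x - S j' x) < 4 * \<delta>"
        unfolding nsqS using M[of "2 * i' + 1"] M[of "2 * j' + 1"] M[of "i' + j' + 1"] ij' by simp
      \<comment> \<open>One further convolution with \<open>s\<close> trades the L^2 estimate for a
        pointwise one, at the cost of one index.\<close>
      have "of_real L * (S i x - S j x) = conv s (S i') x - conv s (S j') x"
        using convS[OF x] ij' by (simp add: algebra_simps)
      also have "\<dots> = conv s (\<lambda>x. S i' x - S j' x) x"
        unfolding conv_def right_diff_distrib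
        by (intro Bochner_Integration.integral_diff[symmetric] int_m cont_intros s
            continuous_map_compose'[OF S] cont_group x)
      finally have "(cmod (of_real L * (S i x - S j x)))\<^sup>2 \<le> nsq s * nsq (\<lambda>x. S i' x - S j' x)"
        using conv_bound[OF s _ x, of "\<lambda>x. S i' x - S j' x"] by (simp add: continuous_map_diff S)
      also have "\<dots> < (nsq s + 1) * (4 * \<delta>)"
      proof -
        have "nsq s * nsq (\<lambda>x. S i' x - S j' x) \<le> nsq s * (4 * \<delta>)"
          using small by (intro mult_left_mono nsq_nonneg) simp
        also have "\<dots> < (nsq s + 1) * (4 * \<delta>)" using \<delta> by simp
        finally show ?thesis .
      qed
      also have "\<dots> = e\<^sup>2 * L\<^sup>2" using nsq_nonneg[of s] by (simp add: \<delta>_def field_simps)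
      finally have "L\<^sup>2 * (cmod (S i x - S j x))\<^sup>2 < L\<^sup>2 * e\<^sup>2"
        by (simp add: norm_mult power_mult_distrib mult.commute)
      then have "(cmod (S i x - S j x))\<^sup>2 < e\<^sup>2" using L(1) by simp
      then show ?thesis using e by (simp add: dist_norm power2_less_imp_less)
    qed
    then show ?thesis by blast
  qed
  then have "uniformly_Cauchy_on (carrier G) S" unfolding uniformly_Cauchy_on_def by blast
  then obtain q where q: "uniform_limit (carrier G) S q sequentially"
    using Cauchy_uniformly_convergent uniformly_convergent_on_def by blast
  have qc: "cf q" using cf_uniform_limit[OF q] S by simp
  have "conv s q x = of_real L * q x" if x: "x \<in> carrier G" for x
  proof (rule LIMSEQ_unique)
    obtain C where C: "C > 0" "\<And>y. y \<in> carrier G \<Longrightarrow> cmod (s y) \<le> C" using cf_bounded[OF s] by blast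
    have "uniform_limit (carrier G) (\<lambda>n y. s y * S n (inv y \<otimes> x)) (\<lambda>y. s y * q (inv y \<otimes> x)) sequentially"
      unfolding uniform_limit_iff
    proof (intro allI impI)
      fix e :: real assume e: "e > 0"
      have "\<forall>\<^sub>F n in sequentially. \<forall>y\<in>carrier G. dist (S n y) (q y) < e / C"
        using q e C(1) unfolding uniform_limit_iff by simp
      then show "\<forall>\<^sub>F n in sequentially. \<forall>y\<in>carrier G. dist (s y * S n (inv y \<otimes> x)) (s y * q (inv y \<otimes> x)) < e"
      proof eventually_elim
        case (elim n)
        show ?case
        proof
          fix y assume y: "y \<in> carrier G"
          have "dist (s y * S n (inv y \<otimes> x)) (s y * q (inv y \<otimes> x)) =
              cmod (s y) * cmod (S n (inv y \<otimes> x) - q (inv y \<otimes> x))"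
            by (simp add: dist_norm norm_mult flip: right_diff_distrib)
          also have "\<dots> \<le> C * cmod (S n (inv y \<otimes> x) - q (inv y \<otimes> x))"
            using C(2)[OF y] by (intro mult_right_mono) auto
          also have "\<dots> < C * (e / C)"
            using elim x y C(1) by (intro mult_strict_left_mono) (auto simp: dist_norm)
          finally show "dist (s y * S n (inv y \<otimes> x)) (s y * q (inv y \<otimes> x)) < e" using C(1) by simp
        qed
      qed
    qed
    then have "(\<lambda>n. conv s (S n) x) \<longlonglongrightarrow> conv s q x"
      unfolding conv_def
      by (rule tendsto_integral_uniform_limit[OF borel_prob_haar])
         (intro always_eventually allI cont_intros s continuous_map_compose'[OF S] continuous_map_compose'[OF qc] cont_group x)+
    then show "(\<lambda>n. of_real L * S (Suc n) x) \<longlonglongrightarrow> conv s q x" using convS[OF x] by simp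
    have "(\<lambda>n. S n x) \<longlonglongrightarrow> q x" using tendsto_uniform_limitI[OF q x] .
    then show "(\<lambda>n. of_real L * S (Suc n) x) \<longlonglongrightarrow> of_real L * q x"
      by (intro tendsto_intros LIMSEQ_Suc)
  qed
  \<comment> \<open>The squared norms \<open>nsq (S n)\<close> are values of \<open>B\<close>, hence
    at least 1, so the uniform limit cannot vanish.\<close>
  moreover have "\<exists>x1\<in>carrier G. q x1 \<noteq> 0"
  proof (rule ccontr)
    assume "\<not> ?thesis"
    then have q0: "\<And>x. x \<in> carrier G \<Longrightarrow> q x = 0" by blast
    obtain n where n: "\<And>x. x \<in> carrier G \<Longrightarrow> dist (S n x) (q x) < 1 / 2"
      using q[unfolded uniform_limit_iff eventually_sequentially, rule_format, of "1 / 2"] by auto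
    have "(cmod (S n x))\<^sup>2 \<le> 1 / 4" if "x \<in> carrier G" for x
      using power_mono[of "cmod (S n x)" "1/2" 2] n[OF that] q0[OF that] by (simp add: power2_eq_square)
    then have "nsq (S n) \<le> 1 / 4" by (rule nsq_le[OF S])
    moreover have "nsq (S n) = B (2 * n + 1)" using ip_self[of "S n"] ipS[of n n] by (simp add: mult_2)
    ultimately show False using B1[of "2 * n + 1"] by simp
  qed
  ultimately show thesis using that L(1) qc unfolding s_def by blast
qed

section \<open>Finite-dimensional spaces stable under right translation\<close>

definition rt :: "'g \<Rightarrow> ('g \<Rightarrow> complex) \<Rightarrow> 'g \<Rightarrow> complex" where
  "rt g w x = (if x \<in> carrier G then w (x \<otimes> g) else 0)"

text \<open>Functions are required to vanish off the group, so that agreement on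
  \<open>carrier G\<close> means equality and expansions are identities of functions.\<close>

definition translation_invariant :: "('g \<Rightarrow> complex) set \<Rightarrow> bool" where
  "translation_invariant V \<longleftrightarrow>
     (\<forall>v\<in>V. cf v \<and> (\<forall>x. x \<notin> carrier G \<longrightarrow> v x = 0)) \<and>
     (\<forall>u\<in>V. \<forall>v\<in>V. (\<lambda>x. u x + v x) \<in> V) \<and> (\<forall>c. \<forall>v\<in>V. (\<lambda>x. c * v x) \<in> V) \<and>
     (\<forall>g\<in>carrier G. \<forall>v\<in>V. rt g v \<in> V)"

definition orthonormal_in :: "('g \<Rightarrow> complex) set \<Rightarrow> nat \<Rightarrow> (nat \<Rightarrow> 'g \<Rightarrow> complex) \<Rightarrow> bool" where
  "orthonormal_in V n w \<longleftrightarrow> orthonormal {..<n} w \<and> (\<forall>i<n. w i \<in> V)"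

lemma cf_rt:
  assumes w: "cf w" and g: "g \<in> carrier G" shows "cf (rt g w)"
proof (rule continuous_map_eq)
  show "cf (\<lambda>x. w (x \<otimes> g))" by (intro continuous_map_compose'[OF w] cont_group g)
qed (auto simp: topspace rt_def)

lemma ip_rt:
  assumes v: "cf v" and w: "cf w" and g: "g \<in> carrier G"
  shows "ip (rt g v) (rt g w) = ip v w"
proof -
  have "ip (rt g v) (rt g w) = (\<integral>x. v (x \<otimes> g) * cnj (w (x \<otimes> g)) \<partial>m)"
    unfolding ip_def by (intro integral_cong'[OF borel_prob_haar]) (simp add: rt_def)
  also have "\<dots> = ip v w" unfolding ip_def
    by (intro right_invariant[OF _ g, of "\<lambda>x. v x * cnj (w x)"] cont_intros v w)
  finally show ?thesis .
qed

lemma rt_rt: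
  assumes "g \<in> carrier G" "h \<in> carrier G" shows "rt (g \<otimes> h) w = rt g (rt h w)"
  using assms by (auto simp: rt_def m_assoc)

lemma translation_invariant_sum:
  assumes V: "translation_invariant V" and "v0 \<in> V" and I: "finite I" and f: "\<And>i. i \<in> I \<Longrightarrow> f i \<in> V"
  shows "(\<lambda>x. \<Sum>i\<in>I. c i * f i x) \<in> V"
  using I f
proof (induction I)
  case empty
  have "(\<lambda>x. 0 * v0 x) \<in> V" using V \<open>v0 \<in> V\<close> unfolding translation_invariant_def by blast
  then show ?case by simp
next
  case (insert i I)
  then have "(\<lambda>x. c i * f i x) \<in> V" "(\<lambda>x. \<Sum>i\<in>I. c i * f i x) \<in> V"
    using V unfolding translation_invariant_def by auto
  then have "(\<lambda>x. c i * f i x + (\<Sum>i\<in>I. c i * f i x)) \<in> V"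
    using V unfolding translation_invariant_def by fast
  with insert show ?case by simp
qed

text \<open>If the remainder of \<open>v\<close> were non-zero, its normalisation would extend the
  system to \<open>Suc n\<close> members.\<close>

lemma orthonormal_expansion:
  assumes V: "translation_invariant V" and on: "orthonormal_in V n w"
    and max: "\<And>w'. \<not> orthonormal_in V (Suc n) w'" and v: "v \<in> V"
  shows "v = (\<lambda>x. \<Sum>i<n. ip v (w i) * w i x)"
proof -
  define h where "h x = (\<Sum>i<n. ip v (w i) * w i x)" for x
  define r where "r x = v x - h x" for x
  have w: "\<And>i. i < n \<Longrightarrow> w i \<in> V" "orthonormal {..<n} w" using on by (auto simp: orthonormal_in_def)
  have cfV: "cf u" if "u \<in> V" for u using V that by (auto simp: translation_invariant_def)
  have h: "h \<in> V" unfolding h_def using w by (intro translation_invariant_sum[OF V v]) auto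
  have "(\<lambda>x. (-1) * h x) \<in> V" using V h unfolding translation_invariant_def by fast
  then have "(\<lambda>x. v x + (-1) * h x) \<in> V" using V v unfolding translation_invariant_def by fast
  then have r: "r \<in> V" unfolding r_def by simp
  have "nsq r = 0"
  proof (rule ccontr)
    assume nz: "nsq r \<noteq> 0"
    then have pos: "nsq r > 0" using nsq_nonneg[of r] by simp
    define c where "c = complex_of_real (1 / sqrt (nsq r))"
    have wr: "ip r (w i) = 0" if i: "i < n" for i
    proof -
      have "ip h (w i) = (\<Sum>j<n. ip v (w j) * ip (w j) (w i))"
        unfolding h_def using cfV w i by (intro ip_sum_left) auto
      also have "\<dots> = (\<Sum>j<n. if j = i then ip v (w j) else 0)"
        using w(2) i by (intro sum.cong) (auto simp: orthonormal_def)
      also have "\<dots> = ip v (w i)" using i by simp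
      finally show ?thesis unfolding r_def using cfV v h w(1)[OF i] by (simp add: ip_diff_left)
    qed
    have wr': "ip (w i) r = 0" if i: "i < n" for i using wr[OF i] ip_cnj[of r "w i"] by simp
    define w' where "w' = w(n := \<lambda>x. c * r x)"
    have cr: "(\<lambda>x. c * r x) \<in> V" using V r unfolding translation_invariant_def by fast
    have cc: "ip (\<lambda>x. c * r x) (\<lambda>x. c * r x) = 1"
    proof -
      have "ip (\<lambda>x. c * r x) (\<lambda>x. c * r x) = c * (cnj c * of_real (nsq r))"
        by (simp only: ip_scale_left ip_scale_right ip_self)
      also have "\<dots> = of_real (1 / sqrt (nsq r) * (1 / sqrt (nsq r) * nsq r))"
        by (simp only: c_def complex_cnj_complex_of_real of_real_mult)
      also have "\<dots> = 1" using pos by simp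
      finally show ?thesis .
    qed
    have "orthonormal_in V (Suc n) w'"
      unfolding orthonormal_in_def orthonormal_def
    proof (intro conjI ballI allI impI)
      fix i j assume "i \<in> {..<Suc n}" "j \<in> {..<Suc n}"
      then show "ip (w' i) (w' j) = (if i = j then 1 else 0)"
        using w(2) wr wr' cc
        by (auto simp: w'_def less_Suc_eq orthonormal_def)
          (auto simp: ip_scale_left ip_scale_right)
    qed (use w cr cfV in \<open>auto simp: w'_def less_Suc_eq\<close>)
    with max show False by blast
  qed
  then have "r x = 0" if "x \<in> carrier G" for x using nsq_eq_0[OF cfV[OF r]] that by blast
  moreover have "v x = 0" "h x = 0" if "x \<notin> carrier G" for x
    using V v h that unfolding translation_invariant_def by auto
  ultimately have "v x = h x" for x by (cases "x \<in> carrier G") (auto simp: r_def)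
  then show ?thesis unfolding h_def by blast
qed

lemma orthonormal_coefficients:
  assumes "orthonormal {..<n} w" "i < (n::nat)"
  shows "ip (\<lambda>x. \<Sum>j<n. c j * w j x) (w i) = c i"
proof -
  have "ip (\<lambda>x. \<Sum>j<n. c j * w j x) (w i) = (\<Sum>j<n. c j * ip (w j) (w i))"
    using assms by (intro ip_sum_left) (auto simp: orthonormal_def)
  also have "\<dots> = (\<Sum>j<n. if j = i then c j else 0)"
    using assms by (intro sum.cong) (auto simp: orthonormal_def)
  finally show ?thesis using assms by simp
qed

text \<open>Among the non-zero invariant subspaces of \<open>E\<close> take one whose longest
  orthonormal system is shortest; right translation on it, written in an orthonormal basis, is the
  representation. The bound \<open>N\<close> makes these lengths finite.\<close>

lemma irreducible_constituent:
  assumes E: "translation_invariant E" and v0: "v0 \<in> E" "x0 \<in> carrier G" "v0 x0 \<noteq> 0"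
    and bound: "\<And>n w. orthonormal_in E n w \<Longrightarrow> n \<le> N"
  obtains \<rho> w where "irreducible_unitary_rep G T \<rho>" "orthonormal_in E (rep_dim G \<rho>) w"
    "\<And>j g x. j < rep_dim G \<rho> \<Longrightarrow> g \<in> carrier G \<Longrightarrow> x \<in> carrier G \<Longrightarrow>
       w j (x \<otimes> g) = (\<Sum>i<rep_dim G \<rho>. \<rho> g $$ (i, j) * w i x)"
proof -
  define Q where "Q V \<longleftrightarrow> translation_invariant V \<and> V \<subseteq> E \<and> (\<exists>v\<in>V. \<exists>x\<in>carrier G. v x \<noteq> 0)" for V
  define sz where "sz V = (GREATEST n. \<exists>w. orthonormal_in V n w)" for V
  have bound': "n \<le> N" if "Q V" "orthonormal_in V n w" for V n w
    using that bound[of n w] by (auto simp: Q_def orthonormal_in_def)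
  have sz_max: "n \<le> sz V" if "Q V" "orthonormal_in V n w" for V n w
    unfolding sz_def using that bound'[OF that(1)] by (intro Greatest_le_nat[of _ n N]) auto
  have sz_ex: "\<exists>w. orthonormal_in V (sz V) w" if "Q V" for V
    unfolding sz_def using bound'[OF that]
    by (intro GreatestI_nat[of "\<lambda>n. \<exists>w. orthonormal_in V n w" 0 N]) (auto simp: orthonormal_in_def orthonormal_def)
  have "Q E" using E v0 by (auto simp: Q_def)
  then obtain V where V: "Q V" and Vmin: "\<And>V'. Q V' \<Longrightarrow> sz V \<le> sz V'"
    using ex_has_least_nat[of Q E sz] by auto
  define n where "n = sz V"
  obtain w where w: "orthonormal_in V n w" using sz_ex[OF V] by (auto simp: n_def)
  have tV: "translation_invariant V" "V \<subseteq> E" using V by (auto simp: Q_def)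
  have nmax: "\<not> orthonormal_in V (Suc n) w'" for w' using sz_max[OF V, of "Suc n" w'] by (auto simp: n_def)
  have expand: "v = (\<lambda>x. \<Sum>i<n. ip v (w' i) * w' i x)" if "v \<in> V" "orthonormal_in V n w'" for v w'
    using orthonormal_expansion[OF tV(1) that(2) nmax that(1)] .
  have wV: "\<And>i. i < n \<Longrightarrow> w i \<in> V" and won: "orthonormal {..<n} w" using w by (auto simp: orthonormal_in_def)
  have cfV: "cf v" if "v \<in> V" for v using tV that by (auto simp: translation_invariant_def)
  have out: "v x = 0" if "v \<in> V" "x \<notin> carrier G" for v x using tV that by (auto simp: translation_invariant_def)
  have cw: "cf (w i)" if "i < n" for i using cfV wV that by blast
  have rtV: "rt g v \<in> V" if "g \<in> carrier G" "v \<in> V" for g v using tV that by (auto simp: translation_invariant_def)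
  obtain v1 x1 where v1: "v1 \<in> V" "x1 \<in> carrier G" "v1 x1 \<noteq> 0" using V by (auto simp: Q_def)
  have n0: "n > 0"
  proof (rule ccontr)
    assume "\<not> n > 0"
    then have "v1 x1 = 0" using fun_cong[OF expand[OF v1(1) w], of x1] by simp
    with v1 show False by simp
  qed
  \<comment> \<open>Column \<open>j\<close> holds the coordinates of the translate of
    \<open>w j\<close>.\<close>
  define \<rho> where "\<rho> g = Matrix.mat n n (\<lambda>(i, j). ip (rt g (w j)) (w i))" for g
  have rc: "\<rho> g \<in> carrier_mat n n" for g by (simp add: \<rho>_def)
  have ent: "\<rho> g $$ (i, j) = ip (rt g (w j)) (w i)" if "i < n" "j < n" for g i j using that by (simp add: \<rho>_def)
  have rtw: "rt g (w j) = (\<lambda>x. \<Sum>i<n. \<rho> g $$ (i, j) * w i x)" if "g \<in> carrier G" "j < n" for g j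
    using expand[OF rtV[OF that(1) wV[OF that(2)]] w] that ent by (auto simp: fun_eq_iff)
  have rt_sum: "rt g (\<lambda>x. \<Sum>j<n. c j * w j x) = (\<lambda>x. \<Sum>i<n. (\<Sum>j<n. \<rho> g $$ (i, j) * c j) * w i x)"
    if g: "g \<in> carrier G" for g c
  proof
    fix x
    have "rt g (\<lambda>x. \<Sum>j<n. c j * w j x) x = (\<Sum>j<n. c j * rt g (w j) x)"
      by (auto simp: rt_def)
    also have "\<dots> = (\<Sum>j<n. \<Sum>i<n. c j * (\<rho> g $$ (i, j) * w i x))"
      using rtw[OF g] by (simp add: sum_distrib_left)
    also have "\<dots> = (\<Sum>i<n. \<Sum>j<n. c j * (\<rho> g $$ (i, j) * w i x))" by (rule sum.swap)
    finally show "rt g (\<lambda>x. \<Sum>j<n. c j * w j x) x = (\<Sum>i<n. (\<Sum>j<n. \<rho> g $$ (i, j) * c j) * w i x)"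
      by (simp add: sum_distrib_right sum_distrib_left mult_ac)
  qed
  have "\<rho> \<one> = 1\<^sub>m n"
  proof (rule eq_matI)
    fix i j assume ij: "i < dim_row (1\<^sub>m n :: complex Matrix.mat)" "j < dim_col (1\<^sub>m n :: complex Matrix.mat)"
    have "rt \<one> (w j) = w j"
    proof
      fix x show "rt \<one> (w j) x = w j x" using out[OF wV, of j x] ij by (auto simp: rt_def)
    qed
    then show "\<rho> \<one> $$ (i, j) = 1\<^sub>m n $$ (i, j)" using ij won by (auto simp: ent orthonormal_def)
  qed (auto simp: \<rho>_def)
  then have dim: "rep_dim G \<rho> = n" by (simp add: rep_dim_def)
  have "unitary_mat n (\<rho> g)" if g: "g \<in> carrier G" for g
  proof (rule unitary_matI[OF rc])
    fix j k assume jk: "j < n" "k < n"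
    have "ip (rt g (w j)) (rt g (w k)) = (\<Sum>i<n. \<rho> g $$ (i, j) * cnj (ip (rt g (w k)) (w i)))"
      unfolding rtw[OF g jk(1)] ip_cnj
      using cw cf_rt[OF cw[OF jk(2)] g] by (intro ip_sum_left) auto
    also have "\<dots> = (\<Sum>i<n. \<rho> g $$ (i, j) * cnj (\<rho> g $$ (i, k)))"
      using jk by (intro sum.cong) (auto simp: ent)
    finally show "(\<Sum>i<n. \<rho> g $$ (i, j) * cnj (\<rho> g $$ (i, k))) = (if j = k then 1 else 0)"
      using ip_rt[OF cw[OF jk(1)] cw[OF jk(2)] g] won jk by (auto simp: orthonormal_def)
  qed
  moreover have "\<rho> (g \<otimes> h) = \<rho> g * \<rho> h" if gh: "g \<in> carrier G" "h \<in> carrier G" for g h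
  proof (rule eq_matI)
    fix i j assume "i < dim_row (\<rho> g * \<rho> h)" "j < dim_col (\<rho> g * \<rho> h)"
    then have ij: "i < n" "j < n" using rc[of g] rc[of h] by auto
    have "rt (g \<otimes> h) (w j) = (\<lambda>x. \<Sum>i<n. (\<Sum>a<n. \<rho> g $$ (i, a) * \<rho> h $$ (a, j)) * w i x)"
      unfolding rt_rt[OF gh] rtw[OF gh(2) ij(2)] by (rule rt_sum[OF gh(1)])
    then have "\<rho> (g \<otimes> h) $$ (i, j) = (\<Sum>a<n. \<rho> g $$ (i, a) * \<rho> h $$ (a, j))"
      unfolding ent[OF ij] by (simp add: orthonormal_coefficients[OF won ij(1)])
    then show "\<rho> (g \<otimes> h) $$ (i, j) = (\<rho> g * \<rho> h) $$ (i, j)" by (simp add: mult_mat_index[OF rc rc ij])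
  qed (auto simp: \<rho>_def)
  moreover have "cf (\<lambda>g. \<rho> g $$ (i, j))" if ij: "i < n" "j < n" for i j
  proof (rule continuous_map_eq)
    let ?F = "\<lambda>z. w j (snd z \<otimes> fst z) * cnj (w i (snd z))"
    have "continuous_map (prod_topology T T) euclidean ?F"
      by (intro continuous_map_mult continuous_map_cnj continuous_map_compose'[OF cw] cont_group ij)
    from continuous_parameter_integral[OF borel_prob_haar this]
    show "cf (\<lambda>g. \<integral>x. w j (x \<otimes> g) * cnj (w i x) \<partial>m)" by simp
    fix g assume "g \<in> topspace T"
    show "(\<integral>x. w j (x \<otimes> g) * cnj (w i x) \<partial>m) = \<rho> g $$ (i, j)"
      unfolding ent[OF ij] ip_def by (intro integral_cong'[OF borel_prob_haar]) (simp add: rt_def)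
  qed
  ultimately have rep: "unitary_rep G T \<rho>"
    using \<open>\<rho> \<one> = 1\<^sub>m n\<close> dim by (simp add: unitary_rep_def Let_def)
  have "W = {0\<^sub>v n} \<or> W = carrier_vec n"
    if W: "W \<subseteq> carrier_vec n" "0\<^sub>v n \<in> W" "\<forall>v\<in>W. \<forall>w\<in>W. v + w \<in> W" "\<forall>a. \<forall>v\<in>W. a \<cdot>\<^sub>v v \<in> W"
      "\<forall>g\<in>carrier G. \<forall>v\<in>W. \<rho> g *\<^sub>v v \<in> W" for W
  proof (cases "W = {0\<^sub>v n}")
    case False
    define f where "f a = (\<lambda>x. \<Sum>i<n. a $ i * w i x)" for a
    have fip: "ip (f a) (w i) = a $ i" if "i < n" for a i
      unfolding f_def by (rule orthonormal_coefficients[OF won that])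
    \<comment> \<open>A non-zero invariant set of coordinate vectors yields a non-zero invariant
      subspace of \<open>V\<close>. Minimality gives it an orthonormal system of length
      \<open>n\<close>, which already spans \<open>V\<close>.\<close>
    define V' where "V' = f ` W"
    have VV: "V' \<subseteq> V" unfolding V'_def f_def using wV translation_invariant_sum[OF tV(1) v1(1), of "{..<n}" w] by auto
    obtain a where a: "a \<in> W" "a \<noteq> 0\<^sub>v n" using False W(2) by auto
    have "a \<in> carrier_vec n" using a W(1) by auto
    then obtain i where i: "i < n" "a $ i \<noteq> 0" using a(2) by (metis carrier_vecD eq_vecI index_zero_vec)
    have "\<exists>x\<in>carrier G. f a x \<noteq> 0"
    proof (rule ccontr)
      assume "\<not> ?thesis"
      then have "ip (f a) (w i) = ip (\<lambda>x. 0) (w i)" by (intro ip_cong) auto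
      then show False using fip[OF i(1), of a] i(2) by (simp add: ip_def)
    qed
    moreover have "translation_invariant V'"
      unfolding translation_invariant_def
    proof (intro conjI ballI allI impI)
      fix u assume u: "u \<in> V'"
      show "cf u" "\<And>x. x \<notin> carrier G \<Longrightarrow> u x = 0" using u VV cfV out by auto
      obtain b where b: "b \<in> W" "u = f b" using u by (auto simp: V'_def)
      have bc: "b \<in> carrier_vec n" using b W(1) by auto
      {
        fix v assume "v \<in> V'"
        then obtain c where c: "c \<in> W" "v = f c" by (auto simp: V'_def)
        have cc: "c \<in> carrier_vec n" using c W(1) by auto
        have "f (b + c) x = f b x + f c x" for x
        proof -
          have "f (b + c) x = (\<Sum>i<n. b $ i * w i x + c $ i * w i x)"
            unfolding f_def using bc cc by (intro sum.cong) (auto simp: distrib_right)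
          then show ?thesis by (simp add: f_def sum.distrib)
        qed
        then have "(\<lambda>x. u x + v x) = f (b + c)" by (simp add: b c fun_eq_iff)
        then show "(\<lambda>x. u x + v x) \<in> V'" using W(3) b c by (auto simp: V'_def)
      }
      {
        fix c
        have "(\<lambda>x. c * u x) = f (c \<cdot>\<^sub>v b)"
          using bc by (auto simp: b f_def fun_eq_iff sum_distrib_left mult.assoc)
        then show "(\<lambda>x. c * u x) \<in> V'" using W(4) b by (auto simp: V'_def)
      }
      fix g assume g: "g \<in> carrier G"
      have "rt g u = f (\<rho> g *\<^sub>v b)"
        unfolding b f_def rt_sum[OF g]
        by (intro ext sum.cong refl arg_cong2[where f="(*)"]) (simp add: mult_mat_vec_index'[OF rc bc])
      then show "rt g u \<in> V'" using W(5) b g by (auto simp: V'_def)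
    qed
    ultimately have "Q V'" using VV tV a by (auto simp: Q_def V'_def)
    then obtain w' where w': "orthonormal_in V' (sz V') w'" using sz_ex by blast
    have "n \<le> sz V'" using Vmin[OF \<open>Q V'\<close>] by (simp add: n_def)
    with w' have w'V': "orthonormal_in V' n w'" by (auto simp: orthonormal_in_def orthonormal_def)
    with VV have w'V: "orthonormal_in V n w'" by (auto simp: orthonormal_in_def)
    have "v \<in> W" if v: "v \<in> carrier_vec n" for v
    proof -
      have "f v \<in> V" unfolding f_def using wV translation_invariant_sum[OF tV(1) v1(1), of "{..<n}" w] by auto
      from expand[OF this w'V] have e: "f v = (\<lambda>x. \<Sum>i<n. ip (f v) (w' i) * w' i x)" .
      have "(\<lambda>x. \<Sum>i<n. ip (f v) (w' i) * w' i x) \<in> V'"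
        using w'V' a by (intro translation_invariant_sum[OF \<open>translation_invariant V'\<close>, of "f a"])
          (auto simp: orthonormal_in_def V'_def)
      then have "f v \<in> V'" by (subst e)
      then obtain b where b: "b \<in> W" "f v = f b" by (auto simp: V'_def)
      have "v = b"
      proof (rule eq_vecI)
        show "dim_vec v = dim_vec b" using v b W(1) by auto
        fix i assume "i < dim_vec b"
        then have "i < n" using b W(1) by auto
        then show "v $ i = b $ i" using fip[of i v] fip[of i b] b(2) by simp
      qed
      with b show ?thesis by simp
    qed
    then show ?thesis using W(1) by auto
  qed simp
  then have "irreducible_unitary_rep G T \<rho>"
    unfolding irreducible_unitary_rep_def Let_def dim using rep n0 by blast
  moreover have "orthonormal_in E (rep_dim G \<rho>) w" using w tV dim by (auto simp: orthonormal_in_def)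
  moreover have "w j (x \<otimes> g) = (\<Sum>i<rep_dim G \<rho>. \<rho> g $$ (i, j) * w i x)"
    if "j < rep_dim G \<rho>" "g \<in> carrier G" "x \<in> carrier G" for j g x
    using fun_cong[OF rtw, of g j x] that by (simp add: dim rt_def)
  ultimately show thesis by (rule that)
qed

text \<open>Hilbert-Schmidt bound: at fixed \<open>x\<close> the numbers L w_i(x) are the inner
  products of \<open>s\<close> with the orthonormal functions sending y to the conjugate of
  w_i(y^(-1) x). Bessel bounds the sum of their squares by \<open>nsq s\<close>, and integration
  over \<open>x\<close> turns that sum into n L^2.\<close>

lemma eigenspace_dimension:
  assumes s: "cf s" and L: "L > 0"
    and on: "orthonormal {..<n} w"
    and eig: "\<And>i x. i < n \<Longrightarrow> x \<in> carrier G \<Longrightarrow> conv s (w i) x = of_real L * w i x"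
  shows "real n \<le> nsq s / L\<^sup>2"
proof -
  have cw: "cf (w i)" if "i < n" for i using on that by (auto simp: orthonormal_def)
  have pt: "(\<Sum>i<n. (cmod (of_real L * w i x))\<^sup>2) \<le> nsq s" if x: "x \<in> carrier G" for x
  proof -
    define u where "u i y = cnj (w i (inv y \<otimes> x))" for i y
    have cu: "cf (u i)" if "i < n" for i
      unfolding u_def by (intro continuous_map_cnj continuous_map_compose'[OF cw] cont_group x that)
    have "ip (u i) (u j) = (if i = j then 1 else 0)" if ij: "i < n" "j < n" for i j
    proof -
      let ?F = "\<lambda>y. w j y * cnj (w i y)"
      have F: "cf ?F" by (intro cont_intros cw ij)
      have F': "cf (\<lambda>y. ?F (y \<otimes> x))" by (rule continuous_map_compose'[OF F]) (intro cont_group x)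
      have "ip (u i) (u j) = (\<integral>y. ?F (inv y \<otimes> x) \<partial>m)" by (simp add: ip_def u_def mult.commute)
      also have "\<dots> = (\<integral>y. ?F (y \<otimes> x) \<partial>m)" by (rule inverse_invariant[OF F'])
      also have "\<dots> = ip (w j) (w i)" unfolding ip_def by (rule right_invariant[OF F x])
      finally show ?thesis using on ij by (auto simp: orthonormal_def)
    qed
    then have "orthonormal {..<n} u" using cu by (auto simp: orthonormal_def)
    from bessel[OF _ this s] have "(\<Sum>i<n. (cmod (ip s (u i)))\<^sup>2) \<le> nsq s" by simp
    moreover have "ip s (u i) = of_real L * w i x" if "i < n" for i
      using eig[OF that x] by (simp add: ip_def u_def conv_def)
    ultimately show ?thesis by simp
  qed
  have "L\<^sup>2 * real n = (\<Sum>i<n. nsq (\<lambda>x. of_real L * w i x))"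
  proof -
    have "nsq (w i) = 1" if "i < n" for i
      using ip_self[of "w i"] on that by (simp add: orthonormal_def)
    then show ?thesis by (simp add: nsq_scale)
  qed
  also have "\<dots> = (\<integral>x. (\<Sum>i<n. (cmod (of_real L * w i x))\<^sup>2) \<partial>m)"
    unfolding nsq_def using cw
    by (intro Bochner_Integration.integral_sum[symmetric] integrable_cf[OF borel_prob_haar] cont_cmod_sq cont_intros) auto
  also have "\<dots> \<le> (\<integral>x. nsq s \<partial>m)"
    using cw pt space_borel_prob[OF borel_prob_haar]
    by (intro integral_mono integrable_cf[OF borel_prob_haar] continuous_map_sum cont_cmod_sq cont_intros) auto
  also have "\<dots> = nsq s" by (rule integral_const[OF borel_prob_haar])
  finally show ?thesis using L by (simp add: field_simps)
qed

text \<open>For \<open>u\<close> not vanishing on the group the kernel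
  \<open>conv (star u) u\<close> is self-adjoint and non-zero, so its convolution square has a
  positive eigenvalue with finite-dimensional eigenspace. An irreducible constituent of that
  eigenspace consists of matrix coefficients, which left convolution by \<open>u\<close>
  annihilates.\<close>

theorem peter_weyl_uniqueness:
  assumes dual: "is_unitary_dual G T R" and u: "cf u"
    and orth: "\<And>\<pi> i j. \<pi> \<in> R \<Longrightarrow> i < rep_dim G \<pi> \<Longrightarrow> j < rep_dim G \<pi> \<Longrightarrow> ip u (\<lambda>g. \<pi> g $$ (i, j)) = 0"
    and x0: "x0 \<in> carrier G"
  shows "u x0 = 0"
proof (rule ccontr)
  assume nz: "u x0 \<noteq> 0"
  define k where "k = conv (star u) u"
  have su: "cf (star u)" by (rule cf_star[OF u])
  have k: "cf k" unfolding k_def by (rule cf_conv[OF su u])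
  have sa: "star k x = k x" if x: "x \<in> carrier G" for x
    unfolding k_def star_conv[OF su u x] using x by (intro conv_cong) (auto simp: star_def)
  have "k \<one> = of_real (nsq u)"
  proof -
    have F: "cf (\<lambda>y. cnj (u y) * u y)" by (intro cont_intros u)
    have "k \<one> = (\<integral>y. cnj (u (inv y)) * u (inv y) \<partial>m)"
      unfolding k_def conv_def star_def by (intro integral_cong'[OF borel_prob_haar]) simp
    also have "\<dots> = (\<integral>y. cnj (u y) * u y \<partial>m)" by (rule inverse_invariant[OF F])
    also have "\<dots> = of_real (nsq u)" unfolding ip_self[symmetric] ip_def by (simp add: mult.commute)
    finally show ?thesis .
  qed
  then have k1: "k \<one> \<noteq> 0" using nsq_pos[OF u x0 nz] by simp
  define s where "s = conv k k"
  have s: "cf s" unfolding s_def by (rule cf_conv[OF k k])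
  obtain L q x1 where L: "L > (0::real)" and q: "cf q" and x1: "x1 \<in> carrier G" "q x1 \<noteq> 0"
    and eq: "\<And>x. x \<in> carrier G \<Longrightarrow> conv s q x = of_real L * q x"
    using convolution_eigenfunction[OF k sa one_closed k1] unfolding s_def by metis
  define E where "E = {v. cf v \<and> (\<forall>x. x \<notin> carrier G \<longrightarrow> v x = 0) \<and>
    (\<forall>x\<in>carrier G. conv s v x = of_real L * v x)}"
  define q' where "q' x = (if x \<in> carrier G then q x else 0)" for x
  have "q' \<in> E"
  proof -
    have "cf q'" by (rule continuous_map_eq[OF q]) (auto simp: q'_def topspace)
    moreover have "conv s q' x = of_real L * q' x" if "x \<in> carrier G" for x
      using eq[OF that] conv_cong[of s s q' q x] that by (simp add: q'_def)
    ultimately show ?thesis by (auto simp: E_def q'_def)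
  qed
  have E: "translation_invariant E"
    unfolding translation_invariant_def
  proof (intro conjI ballI allI impI)
    fix v assume v: "v \<in> E"
    then have cv: "cf v" and ev: "\<And>x. x \<in> carrier G \<Longrightarrow> conv s v x = of_real L * v x" by (auto simp: E_def)
    show "cf v" by (rule cv)
    show "\<And>x. x \<notin> carrier G \<Longrightarrow> v x = 0" using v by (auto simp: E_def)
    {
      fix w assume w: "w \<in> E"
      then have cw: "cf w" and ew: "\<And>x. x \<in> carrier G \<Longrightarrow> conv s w x = of_real L * w x" by (auto simp: E_def)
      have "conv s (\<lambda>x. v x + w x) x = conv s v x + conv s w x" if "x \<in> carrier G" for x
        unfolding conv_def distrib_left
        by (intro Bochner_Integration.integral_add int_m cont_intros s continuous_map_compose'[OF cv]
            continuous_map_compose'[OF cw] cont_group that)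
      then show "(\<lambda>x. v x + w x) \<in> E"
        using v w cv cw ev ew by (auto simp: E_def distrib_left intro: continuous_map_add)
    }
    {
      fix c
      have "conv s (\<lambda>x. c * v x) x = c * conv s v x" for x
        unfolding conv_def by (simp add: mult.left_commute)
      then show "(\<lambda>x. c * v x) \<in> E"
        using v cv ev by (auto simp: E_def intro: continuous_map_mult)
    }
    fix g assume g: "g \<in> carrier G"
    have "conv s (rt g v) x = of_real L * rt g v x" if x: "x \<in> carrier G" for x
    proof -
      have "conv s (rt g v) x = conv s v (x \<otimes> g)"
        unfolding conv_def using x g by (intro integral_cong'[OF borel_prob_haar]) (simp add: rt_def m_assoc)
      then show ?thesis using ev[of "x \<otimes> g"] x g by (simp add: rt_def)
    qed
    then show "rt g v \<in> E" using cf_rt[OF cv g] by (auto simp: E_def rt_def)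
  qed
  have bound: "n \<le> nat \<lceil>nsq s / L\<^sup>2\<rceil>" if "orthonormal_in E n w" for n w
  proof -
    have "real n \<le> nsq s / L\<^sup>2"
      using that by (intro eigenspace_dimension[OF s L, of n w]) (auto simp: orthonormal_in_def E_def)
    then show ?thesis by linarith
  qed
  obtain \<rho> w where irr: "irreducible_unitary_rep G T \<rho>" and w: "orthonormal_in E (rep_dim G \<rho>) w"
    and tr: "\<And>j g x. j < rep_dim G \<rho> \<Longrightarrow> g \<in> carrier G \<Longrightarrow> x \<in> carrier G \<Longrightarrow>
       w j (x \<otimes> g) = (\<Sum>i<rep_dim G \<rho>. \<rho> g $$ (i, j) * w i x)"
    by (rule irreducible_constituent[OF E \<open>q' \<in> E\<close> x1(1) _ bound]) (use x1 in \<open>auto simp: q'_def\<close>)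
  obtain \<pi> where \<pi>: "\<pi> \<in> R" "unitarily_equivalent G \<pi> \<rho>" using dual irr unfolding is_unitary_dual_def by blast
  define d where "d = rep_dim G \<pi>"
  have d\<rho>: "rep_dim G \<rho> = d" using \<pi> by (simp add: unitarily_equivalent_def d_def)
  obtain A where A: "unitary_mat d A" and AI: "\<And>g. g \<in> carrier G \<Longrightarrow> A * \<pi> g = \<rho> g * A"
    using \<pi> by (auto simp: unitarily_equivalent_def d_def)
  have Ac: "A \<in> carrier_mat d d" using A by (simp add: unitary_mat_def)
  have irr\<pi>: "irreducible_unitary_rep G T \<pi>" using dual \<pi> by (auto simp: is_unitary_dual_def)
  note rep = irrepD(1)[OF irr\<pi>] and rep\<rho> = irrepD(1)[OF irr]
  have pc: "\<pi> g \<in> carrier_mat d d" if "g \<in> carrier G" for g using rep_carrier[OF rep that] by (simp add: d_def)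
  have rc: "\<rho> g \<in> carrier_mat d d" if "g \<in> carrier G" for g using rep_carrier[OF rep\<rho> that] by (simp add: d\<rho>)
  have d0: "0 < d" using irrepD(2)[OF irr\<pi>] by (simp add: d_def)
  have wE: "w j \<in> E" if "j < d" for j using w that by (auto simp: orthonormal_in_def d\<rho>)
  \<comment> \<open>Change of basis by the equivalence \<open>A\<close>: translation is now given by
    the representative \<open>\<pi>\<close> in \<open>R\<close>, to which the hypothesis on
    \<open>u\<close> applies.\<close>
  define v where "v l x = (\<Sum>j<d. A $$ (j, l) * w j x)" for l x
  have vE: "v l \<in> E" for l
    unfolding v_def using wE translation_invariant_sum[OF E \<open>q' \<in> E\<close>, of "{..<d}" w] by auto
  have cv: "cf (v l)" for l using vE by (auto simp: E_def)
  have vtr: "v l (x \<otimes> g) = (\<Sum>i<d. \<pi> g $$ (i, l) * v i x)"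
    if l: "l < d" and g: "g \<in> carrier G" and x: "x \<in> carrier G" for l g x
  proof -
    have "v l (x \<otimes> g) = (\<Sum>j<d. \<Sum>i<d. A $$ (j, l) * (\<rho> g $$ (i, j) * w i x))"
      unfolding v_def using tr g x by (simp add: d\<rho> sum_distrib_left)
    also have "\<dots> = (\<Sum>i<d. \<Sum>j<d. A $$ (j, l) * (\<rho> g $$ (i, j) * w i x))" by (rule sum.swap)
    also have "\<dots> = (\<Sum>i<d. (\<rho> g * A) $$ (i, l) * w i x)"
      using l by (intro sum.cong refl) (auto simp: mult_mat_index[OF rc[OF g] Ac] sum_distrib_right sum_distrib_left mult_ac)
    also have "\<dots> = (\<Sum>i<d. \<Sum>a<d. A $$ (i, a) * \<pi> g $$ (a, l) * w i x)"
      unfolding AI[OF g, symmetric]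
      using l by (intro sum.cong refl) (auto simp: mult_mat_index[OF Ac pc[OF g]] sum_distrib_right)
    also have "\<dots> = (\<Sum>a<d. \<Sum>i<d. A $$ (i, a) * \<pi> g $$ (a, l) * w i x)" by (rule sum.swap)
    finally show ?thesis by (simp add: v_def sum_distrib_left mult_ac)
  qed
  \<comment> \<open>The translation formula based at the identity writes v_l(y^(-1) x) as a
    combination of conjugate entries of \<open>\<pi> y\<close>, so the convolution is a combination
    of inner products that vanish by hypothesis.\<close>
  have uv: "conv u (v l) x = 0" if l: "l < d" and x: "x \<in> carrier G" for l x
  proof -
    have "conv u (v l) x = (\<integral>y. (\<Sum>i<d. \<Sum>a<d. (\<pi> x $$ (a, l) * v i \<one>) * (u y * cnj (\<pi> y $$ (a, i)))) \<partial>m)"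
      unfolding conv_def
    proof (rule integral_cong'[OF borel_prob_haar])
      fix y assume y: "y \<in> carrier G"
      have "v l (inv y \<otimes> x) = (\<Sum>i<d. \<pi> (inv y \<otimes> x) $$ (i, l) * v i \<one>)"
        using vtr[OF l, of "inv y \<otimes> x" \<one>] x y by simp
      also have "\<dots> = (\<Sum>i<d. \<Sum>a<d. \<pi> (inv y) $$ (i, a) * \<pi> x $$ (a, l) * v i \<one>)"
        unfolding rep_mult[OF rep inv_closed[OF y] x]
        using l y by (intro sum.cong refl) (auto simp: mult_mat_index[OF pc pc] x sum_distrib_right)
      also have "\<dots> = (\<Sum>i<d. \<Sum>a<d. cnj (\<pi> y $$ (a, i)) * \<pi> x $$ (a, l) * v i \<one>)"
        using pc[OF y] by (intro sum.cong refl) (auto simp: rep_inv[OF rep y])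
      finally show "u y * v l (inv y \<otimes> x) =
          (\<Sum>i<d. \<Sum>a<d. (\<pi> x $$ (a, l) * v i \<one>) * (u y * cnj (\<pi> y $$ (a, i))))"
        by (simp add: sum_distrib_left mult_ac)
    qed
    also have "\<dots> = (\<Sum>i<d. \<integral>y. (\<Sum>a<d. (\<pi> x $$ (a, l) * v i \<one>) * (u y * cnj (\<pi> y $$ (a, i)))) \<partial>m)"
      by (intro Bochner_Integration.integral_sum int_m cont_intros u) (auto intro!: rep_cf rep simp: d_def)
    also have "\<dots> = (\<Sum>i<d. \<Sum>a<d. \<integral>y. (\<pi> x $$ (a, l) * v i \<one>) * (u y * cnj (\<pi> y $$ (a, i))) \<partial>m)"
      by (intro sum.cong refl Bochner_Integration.integral_sum int_m cont_intros u) (auto intro!: rep_cf rep simp: d_def)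
    also have "\<dots> = (\<Sum>i<d. \<Sum>a<d. (\<pi> x $$ (a, l) * v i \<one>) * ip u (\<lambda>g. \<pi> g $$ (a, i)))"
      by (simp add: ip_def)
    also have "\<dots> = 0" using orth[OF \<pi>(1)] by (simp add: d_def)
    finally show ?thesis .
  qed
  have kv: "conv k (v l) x = 0" if l: "l < d" and x: "x \<in> carrier G" for l x
  proof -
    have "conv k (v l) x = conv (star u) (conv u (v l)) x" unfolding k_def by (rule conv_assoc[OF su u cv x])
    also have "\<dots> = conv (star u) (\<lambda>x. 0) x" using uv[OF l] x by (intro conv_cong) auto
    finally show ?thesis by (simp add: conv_def)
  qed
  have "v 0 x = 0" if x: "x \<in> carrier G" for x
  proof -
    have "of_real L * v 0 x = conv s (v 0) x" using vE x by (auto simp: E_def)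
    also have "\<dots> = conv k (conv k (v 0)) x" unfolding s_def by (rule conv_assoc[OF k k cv x])
    also have "\<dots> = conv k (\<lambda>x. 0) x" using kv[OF d0] x by (intro conv_cong) auto
    finally show ?thesis using L by (simp add: conv_def)
  qed
  \<comment> \<open>The inner products with \<open>w i\<close> are the entries of column 0 of
    \<open>A\<close>, which cannot all be zero in a unitary matrix.\<close>
  then have "ip (v 0) (w i) = ip (\<lambda>x. 0) (w i)" for i by (intro ip_cong) auto
  then have "A $$ (i, 0) = 0" if "i < d" for i
    using orthonormal_coefficients[of d w i "\<lambda>j. A $$ (j, 0)"] w that
    by (simp add: v_def[abs_def] orthonormal_in_def d\<rho> ip_def)
  then show False using unitary_mat_columns[OF A d0 d0] by simp
qed

end

section \<open>The Gelfand property of symmetric pairs\<close>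

text \<open>The germs at \<open>e\<close> of the combinations form a finite-dimensional space.
  Either the germ of the new function is independent of the earlier ones, and its coefficient must
  vanish; or it is a combination of them on some neighbourhood, and substitution removes it at the
  price of shrinking \<open>U0\<close>.\<close>

lemma vanishing_germ_uniform:
  fixes b :: "'i \<Rightarrow> 'g \<Rightarrow> complex"
  assumes I: "finite I" and e: "e \<in> topspace T"
  shows "\<exists>U0. openin T U0 \<and> e \<in> U0 \<and>
    (\<forall>c U. openin T U \<and> e \<in> U \<and> (\<forall>x\<in>U. (\<Sum>i\<in>I. c i * b i x) = 0) \<longrightarrow> (\<forall>x\<in>U0. (\<Sum>i\<in>I. c i * b i x) = 0))"
  using I
proof (induction I)
  case empty
  then show ?case using e by (intro exI[of _ "topspace T"]) auto
next
  case (insert k I)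
  then obtain U0 where U0: "openin T U0" "e \<in> U0"
    "\<And>c U. openin T U \<Longrightarrow> e \<in> U \<Longrightarrow> \<forall>x\<in>U. (\<Sum>i\<in>I. c i * b i x) = 0 \<Longrightarrow> \<forall>x\<in>U0. (\<Sum>i\<in>I. c i * b i x) = 0"
    by metis
  show ?case
  proof (cases "\<exists>h U. openin T U \<and> e \<in> U \<and> (\<forall>x\<in>U. b k x + (\<Sum>i\<in>I. h i * b i x) = 0)")
    case False
    have "\<forall>x\<in>U0. (\<Sum>i\<in>insert k I. c i * b i x) = 0"
      if U: "openin T U" "e \<in> U" "\<forall>x\<in>U. (\<Sum>i\<in>insert k I. c i * b i x) = 0" for c U
    proof -
      have "c k = 0"
      proof (rule ccontr)
        assume ck: "c k \<noteq> 0"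
        have "b k x + (\<Sum>i\<in>I. (c i / c k) * b i x) = 0" if "x \<in> U" for x
        proof -
          have "(\<Sum>i\<in>I. (c i / c k) * b i x) = (\<Sum>i\<in>I. c i * b i x) / c k" by (simp add: sum_divide_distrib)
          moreover have "c k * b k x + (\<Sum>i\<in>I. c i * b i x) = 0" using U(3) that insert by simp
          then have "(\<Sum>i\<in>I. c i * b i x) = - (c k * b k x)" by (simp add: eq_neg_iff_add_eq_0 add.commute)
          ultimately show ?thesis using ck by simp
        qed
        then have "\<exists>h U. openin T U \<and> e \<in> U \<and> (\<forall>x\<in>U. b k x + (\<Sum>i\<in>I. h i * b i x) = 0)"
          using U(1,2) by (intro exI[of _ "\<lambda>i. c i / c k"] exI[of _ U]) auto
        with False show False by simp
      qed
      then show ?thesis using U0(3)[OF U(1,2)] U(3) insert by auto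
    qed
    then show ?thesis using U0(1,2) by blast
  next
    case True
    then obtain h U1 where h: "openin T U1" "e \<in> U1" "\<forall>x\<in>U1. b k x + (\<Sum>i\<in>I. h i * b i x) = 0" by blast
    have main: "\<forall>x\<in>U0 \<inter> U1. (\<Sum>i\<in>insert k I. c i * b i x) = 0"
      if c: "openin T U \<and> e \<in> U \<and> (\<forall>x\<in>U. (\<Sum>i\<in>insert k I. c i * b i x) = 0)" for c U
    proof -
      note U = c[THEN conjunct1] c[THEN conjunct2, THEN conjunct1] c[THEN conjunct2, THEN conjunct2]
      have eq: "(\<Sum>i\<in>insert k I. c i * b i x) = (\<Sum>i\<in>I. (c i - c k * h i) * b i x)" if "x \<in> U1" for x
      proof -
        have "b k x = - (\<Sum>i\<in>I. h i * b i x)" using h(3) that by (simp add: eq_neg_iff_add_eq_0)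
        then show ?thesis using insert
          by (simp add: left_diff_distrib sum_subtractf sum_distrib_left mult.assoc)
      qed
      have "\<forall>x\<in>U \<inter> U1. (\<Sum>i\<in>I. (c i - c k * h i) * b i x) = 0" using eq U(3) by auto
      then have "\<forall>x\<in>U0. (\<Sum>i\<in>I. (c i - c k * h i) * b i x) = 0"
        by (intro U0(3)[of "U \<inter> U1"] openin_Int IntI U(1,2) h(1,2))
      then show ?thesis using eq by auto
    qed
    show ?thesis
      by (intro exI[of _ "U0 \<inter> U1"] conjI allI impI openin_Int IntI U0(1,2) h(1,2)) (rule main)
  qed
qed

context compact_group
begin

lemma openin_left_translate:
  assumes U: "openin T U" and x: "x \<in> carrier G"
  shows "openin T {z \<in> topspace T. inv x \<otimes> z \<in> U}"
  by (rule openin_continuous_map_preimage[OF _ U]) (intro cont_group inv_closed x)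

text \<open>A substitute for analytic continuation of matrix coefficients: functions in a finite-dimensional
  space stable under left translations that vanish near the identity vanish on one fixed neighbourhood
  \<open>U0\<close>, hence on all products of elements of \<open>U0\<close>.\<close>

lemma vanishing_near_one:
  fixes b :: "'i \<Rightarrow> 'g \<Rightarrow> complex"
  assumes conn: "connected_space T" and I: "finite I"
    and tr: "\<And>x p. x \<in> carrier G \<Longrightarrow> p \<in> I \<Longrightarrow> \<exists>c. \<forall>g\<in>carrier G. b p (x \<otimes> g) = (\<Sum>q\<in>I. c q * b q g)"
    and U: "openin T U" "\<one> \<in> U" "\<And>g. g \<in> U \<Longrightarrow> (\<Sum>p\<in>I. c p * b p g) = 0"
    and g: "g \<in> carrier G"
  shows "(\<Sum>p\<in>I. c p * b p g) = 0"
proof -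
  obtain U0 where U0: "openin T U0" "\<one> \<in> U0" and U0van:
    "\<And>c U. openin T U \<Longrightarrow> \<one> \<in> U \<Longrightarrow> \<forall>x\<in>U. (\<Sum>i\<in>I. c i * b i x) = 0 \<Longrightarrow> \<forall>x\<in>U0. (\<Sum>i\<in>I. c i * b i x) = 0"
    using vanishing_germ_uniform[OF I, of \<one> T b] topspace one_closed by metis
  have U0c: "U0 \<subseteq> carrier G" using U0 topspace openin_subset by blast
  \<comment> \<open>\<open>Z\<close> contains the identity and is open by construction; the uniform
    neighbourhood \<open>U0\<close> makes it closed, and connectedness gives all of
    \<open>G\<close>.\<close>
  define Z where "Z = {x \<in> carrier G. \<exists>V. openin T V \<and> x \<in> V \<and> (\<forall>z\<in>V. (\<Sum>p\<in>I. c p * b p z) = 0)}"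
  have translate: "\<exists>c'. \<forall>g\<in>carrier G. (\<Sum>p\<in>I. c p * b p (x \<otimes> g)) = (\<Sum>q\<in>I. c' q * b q g)"
    if x: "x \<in> carrier G" for x
  proof -
    obtain C where C: "\<And>p g. p \<in> I \<Longrightarrow> g \<in> carrier G \<Longrightarrow> b p (x \<otimes> g) = (\<Sum>q\<in>I. C p q * b q g)"
      using tr[OF x] by metis
    have "(\<Sum>p\<in>I. c p * b p (x \<otimes> g)) = (\<Sum>q\<in>I. (\<Sum>p\<in>I. c p * C p q) * b q g)" if "g \<in> carrier G" for g
    proof -
      have "(\<Sum>p\<in>I. c p * b p (x \<otimes> g)) = (\<Sum>p\<in>I. \<Sum>q\<in>I. c p * (C p q * b q g))"
        using C that by (simp add: sum_distrib_left)
      also have "\<dots> = (\<Sum>q\<in>I. \<Sum>p\<in>I. c p * (C p q * b q g))" by (rule sum.swap)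
      finally show ?thesis by (simp add: sum_distrib_right mult.assoc)
    qed
    then show ?thesis by (intro exI[of _ "\<lambda>q. \<Sum>p\<in>I. c p * C p q"]) simp
  qed
  \<comment> \<open>Left translation turns vanishing near \<open>x\<close> into vanishing near the
    identity of another combination of the same functions, to which the fixed \<open>U0\<close>
    applies.\<close>
  have grow: "\<forall>u\<in>U0. (\<Sum>p\<in>I. c p * b p (x \<otimes> u)) = 0" if xZ: "x \<in> Z" for x
  proof -
    have x: "x \<in> carrier G" using xZ by (simp add: Z_def)
    obtain V where V: "openin T V" "x \<in> V" "\<forall>z\<in>V. (\<Sum>p\<in>I. c p * b p z) = 0" using xZ by (auto simp: Z_def)
    obtain c' where c': "\<And>g. g \<in> carrier G \<Longrightarrow> (\<Sum>p\<in>I. c p * b p (x \<otimes> g)) = (\<Sum>q\<in>I. c' q * b q g)"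
      using translate[OF x] by blast
    define V' where "V' = {z \<in> topspace T. x \<otimes> z \<in> V}"
    have "openin T V'" unfolding V'_def using openin_left_translate[OF V(1), of "inv x"] x by simp
    moreover have "\<one> \<in> V'" using x V by (simp add: V'_def topspace)
    moreover have "\<forall>z\<in>V'. (\<Sum>i\<in>I. c' i * b i z) = 0" using V(3) c' by (auto simp: V'_def topspace)
    ultimately have "\<forall>u\<in>U0. (\<Sum>i\<in>I. c' i * b i u) = 0" by (rule U0van)
    then show ?thesis using c' U0c by auto
  qed
  have step: "x \<otimes> u \<in> Z" if xZ: "x \<in> Z" and u: "u \<in> U0" for x u
  proof -
    have x: "x \<in> carrier G" using xZ by (simp add: Z_def)
    let ?V = "{z \<in> topspace T. inv x \<otimes> z \<in> U0}"
    have "(\<Sum>p\<in>I. c p * b p z) = 0" if z: "z \<in> ?V" for z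
    proof -
      have "x \<otimes> (inv x \<otimes> z) = z" using z x topspace by (simp flip: m_assoc)
      moreover have "(\<Sum>p\<in>I. c p * b p (x \<otimes> (inv x \<otimes> z))) = 0" using grow[OF xZ] z by blast
      ultimately show ?thesis by simp
    qed
    moreover have "x \<otimes> u \<in> ?V" using x u U0c topspace by (auto simp flip: m_assoc)
    ultimately show ?thesis using openin_left_translate[OF U0(1) x] x u U0c by (auto simp: Z_def)
  qed
  have "\<one> \<in> Z" using U by (auto simp: Z_def)
  moreover have "openin T Z"
    unfolding openin_subopen[of T Z]
  proof
    fix x assume "x \<in> Z"
    then obtain V where "openin T V" "x \<in> V" "\<forall>z\<in>V. (\<Sum>p\<in>I. c p * b p z) = 0" by (auto simp: Z_def)
    moreover from this have "V \<subseteq> Z" using openin_subset[of T V] topspace unfolding Z_def by blast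
    ultimately show "\<exists>V. openin T V \<and> x \<in> V \<and> V \<subseteq> Z" by blast
  qed
  moreover have "closedin T Z"
    unfolding closedin_def openin_subopen[of T "topspace T - Z"]
  proof (intro conjI ballI)
    show "Z \<subseteq> topspace T" by (auto simp: Z_def topspace)
    fix z assume z: "z \<in> topspace T - Z"
    \<comment> \<open>A point of \<open>Z\<close> this close to \<open>z\<close> would reach
      \<open>z\<close> by a factor from \<open>U0\<close>; the size of \<open>U0\<close> does not
      depend on the point.\<close>
    let ?V = "{x \<in> topspace T. inv x \<otimes> z \<in> U0}"
    have "openin T ?V"
      by (rule openin_continuous_map_preimage[OF _ U0(1)]) (intro cont_group; use z topspace in auto)
    moreover have "z \<in> ?V" using z U0 topspace by simp
    moreover have "?V \<subseteq> topspace T - Z"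
    proof
      fix x assume x: "x \<in> ?V"
      have "x \<notin> Z"
      proof
        assume xZ: "x \<in> Z"
        then have "x \<otimes> (inv x \<otimes> z) \<in> Z" using step x by blast
        moreover have "x \<otimes> (inv x \<otimes> z) = z" using x z topspace by (simp flip: m_assoc)
        ultimately show False using z by simp
      qed
      then show "x \<in> topspace T - Z" using x by simp
    qed
    ultimately show "\<exists>V. openin T V \<and> z \<in> V \<and> V \<subseteq> topspace T - Z" by blast
  qed
  ultimately have "Z = topspace T" using conn connected_space_clopen_in by blast
  then have "g \<in> Z" using g topspace by simp
  then show ?thesis by (auto simp: Z_def)
qed

text \<open>Conjugating vectors carries subspaces stable under the conjugate representation to
  subspaces stable under \<open>\<pi>\<close>.\<close>

lemma irreducible_conjugate:
  assumes irr: "irreducible_unitary_rep G T \<pi>"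
  shows "irreducible_unitary_rep G T (\<lambda>g. map_mat cnj (\<pi> g))"
    and "rep_dim G (\<lambda>g. map_mat cnj (\<pi> g)) = rep_dim G \<pi>"
proof -
  let ?\<tau> = "\<lambda>g. map_mat cnj (\<pi> g)"
  note rep = irrepD(1)[OF irr]
  show dim: "rep_dim G ?\<tau> = rep_dim G \<pi>" by (simp add: rep_dim_def)
  define d where "d = rep_dim G \<pi>"
  have pc: "\<pi> g \<in> carrier_mat d d" if "g \<in> carrier G" for g using rep_carrier[OF rep that] by (simp add: d_def)
  have tc: "?\<tau> g \<in> carrier_mat d d" if "g \<in> carrier G" for g using pc[OF that] by simp
  have "unitary_mat d (?\<tau> g)" if g: "g \<in> carrier G" for g
  proof (rule unitary_matI[OF tc[OF g]])
    fix j k assume jk: "j < d" "k < d"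
    have "(\<Sum>i<d. ?\<tau> g $$ (i, j) * cnj (?\<tau> g $$ (i, k))) = cnj (\<Sum>i<d. \<pi> g $$ (i, j) * cnj (\<pi> g $$ (i, k)))"
      unfolding cnj_sum using pc[OF g] jk by (intro sum.cong) auto
    then show "(\<Sum>i<d. ?\<tau> g $$ (i, j) * cnj (?\<tau> g $$ (i, k))) = (if j = k then 1 else 0)"
      using unitary_mat_columns[OF rep_unitary[OF rep g], folded d_def, OF jk] by simp
  qed
  moreover have "?\<tau> \<one> = 1\<^sub>m d" unfolding rep_one[OF rep] d_def[symmetric] by (rule eq_matI) auto
  moreover have "?\<tau> (g \<otimes> h) = ?\<tau> g * ?\<tau> h" if gh: "g \<in> carrier G" "h \<in> carrier G" for g h
  proof (rule eq_matI)
    fix i j assume "i < dim_row (?\<tau> g * ?\<tau> h)" "j < dim_col (?\<tau> g * ?\<tau> h)"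
    then have ij: "i < d" "j < d" using pc[OF gh(1)] pc[OF gh(2)] by auto
    have "?\<tau> (g \<otimes> h) $$ (i, j) = cnj ((\<pi> g * \<pi> h) $$ (i, j))"
      unfolding rep_mult[OF rep gh] using pc[OF gh(1)] pc[OF gh(2)] ij by simp
    also have "\<dots> = (\<Sum>a<d. cnj (\<pi> g $$ (i, a)) * cnj (\<pi> h $$ (a, j)))"
      unfolding mult_mat_index[OF pc[OF gh(1)] pc[OF gh(2)] ij] by simp
    also have "\<dots> = (\<Sum>a<d. ?\<tau> g $$ (i, a) * ?\<tau> h $$ (a, j))"
      using pc[OF gh(1)] pc[OF gh(2)] ij by (intro sum.cong) auto
    finally show "?\<tau> (g \<otimes> h) $$ (i, j) = (?\<tau> g * ?\<tau> h) $$ (i, j)"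
      unfolding mult_mat_index[OF tc[OF gh(1)] tc[OF gh(2)] ij] .
  qed (use pc[OF gh(1)] pc[OF gh(2)] rep_mult[OF rep gh] in auto)
  moreover have "cf (\<lambda>g. ?\<tau> g $$ (i, j))" if ij: "i < d" "j < d" for i j
  proof (rule continuous_map_eq)
    show "cf (\<lambda>g. cnj (\<pi> g $$ (i, j)))" using ij by (intro cont_intros rep_cf[OF rep]) (auto simp: d_def)
    fix g assume "g \<in> topspace T"
    then show "cnj (\<pi> g $$ (i, j)) = ?\<tau> g $$ (i, j)" using pc[of g] ij topspace by simp
  qed
  ultimately have rep': "unitary_rep G T ?\<tau>"
    unfolding unitary_rep_def Let_def dim d_def[symmetric] by blast
  have "W = {0\<^sub>v d} \<or> W = carrier_vec d"
    if W: "W \<subseteq> carrier_vec d" "0\<^sub>v d \<in> W" "\<forall>v\<in>W. \<forall>w\<in>W. v + w \<in> W" "\<forall>a. \<forall>v\<in>W. a \<cdot>\<^sub>v v \<in> W"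
      "\<forall>g\<in>carrier G. \<forall>v\<in>W. ?\<tau> g *\<^sub>v v \<in> W" for W
  proof -
    define W' where "W' = {v \<in> carrier_vec d. conjugate v \<in> W}"
    have W'1: "0\<^sub>v d \<in> W'"
    proof -
      have "conjugate (0\<^sub>v d :: complex Matrix.vec) = 0\<^sub>v d" by (rule eq_vecI) auto
      then show ?thesis using W(2) by (simp add: W'_def)
    qed
    have W'2: "\<forall>v\<in>W'. \<forall>w\<in>W'. v + w \<in> W'"
    proof (intro ballI)
      fix v w assume vw: "v \<in> W'" "w \<in> W'"
      then have "conjugate (v + w) = conjugate v + conjugate w" by (intro eq_vecI) (auto simp: W'_def)
      then show "v + w \<in> W'" using vw W(3) by (auto simp: W'_def)
    qed
    have W'3: "\<forall>a. \<forall>v\<in>W'. a \<cdot>\<^sub>v v \<in> W'"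
    proof (intro allI ballI)
      fix a v assume v: "v \<in> W'"
      then have "conjugate (a \<cdot>\<^sub>v v) = cnj a \<cdot>\<^sub>v conjugate v" by (intro eq_vecI) (auto simp: W'_def)
      then show "a \<cdot>\<^sub>v v \<in> W'" using v W(4) by (auto simp: W'_def)
    qed
    have W'4: "\<forall>g\<in>carrier G. \<forall>v\<in>W'. \<pi> g *\<^sub>v v \<in> W'"
    proof (intro ballI)
      fix g v assume g: "g \<in> carrier G" and v: "v \<in> W'"
      then have vc: "v \<in> carrier_vec d" by (simp add: W'_def)
      have "?\<tau> g *\<^sub>v conjugate v \<in> W" using W(5) g v by (simp add: W'_def)
      then show "\<pi> g *\<^sub>v v \<in> W'"
        unfolding conjugate_mult_mat_vec[OF pc[OF g] vc] using mult_mat_vec_carrier[OF pc[OF g] vc] by (simp add: W'_def)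
    qed
    have "W' = {0\<^sub>v d} \<or> W' = carrier_vec d"
      using irr W'1 W'2 W'3 W'4 unfolding irreducible_unitary_rep_def Let_def d_def[symmetric]
      by (auto simp: W'_def)
    then show ?thesis
    proof
      assume W'0: "W' = {0\<^sub>v d}"
      have "v = 0\<^sub>v d" if v: "v \<in> W" for v
      proof -
        have "conjugate v \<in> W'" using v W(1) by (auto simp: W'_def)
        then have "conjugate v = 0\<^sub>v d" using W'0 by simp
        then have "conjugate (conjugate v) = conjugate (0\<^sub>v d)" by simp
        then show ?thesis by (auto simp: vec_eq_iff)
      qed
      then have "W = {0\<^sub>v d}" using W(2) by blast
      then show ?thesis by simp
    next
      assume W'0: "W' = carrier_vec d"
      have "v \<in> W" if v: "v \<in> carrier_vec d" for v
      proof -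
        have "conjugate v \<in> W'" using W'0 v by simp
        then show ?thesis by (simp add: W'_def)
      qed
      then show ?thesis using W(1) by auto
    qed
  qed
  then show "irreducible_unitary_rep G T ?\<tau>"
    unfolding irreducible_unitary_rep_def Let_def dim d_def[symmetric]
    using rep' irrepD(2)[OF irr] d_def by blast
qed

text \<open>Since \<open>\<theta>\<close> is onto, both representations have the same set of
  operators, hence the same stable subspaces.\<close>

lemma irreducible_compose:
  assumes irr: "irreducible_unitary_rep G T \<pi>" and hom: "\<theta> \<in> hom G G"
    and cont: "continuous_map T T \<theta>" and surj: "\<theta> ` carrier G = carrier G"
  shows "irreducible_unitary_rep G T (\<lambda>g. \<pi> (\<theta> g))" and "rep_dim G (\<lambda>g. \<pi> (\<theta> g)) = rep_dim G \<pi>"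
proof -
  note rep = irrepD(1)[OF irr]
  have one: "\<theta> \<one> = \<one>" by (rule hom_one[OF hom group group])
  show dim: "rep_dim G (\<lambda>g. \<pi> (\<theta> g)) = rep_dim G \<pi>" by (simp add: rep_dim_def one)
  have cl: "\<theta> g \<in> carrier G" if "g \<in> carrier G" for g using hom that by (auto simp: hom_def)
  have mul: "\<theta> (g \<otimes> h) = \<theta> g \<otimes> \<theta> h" if "g \<in> carrier G" "h \<in> carrier G" for g h
    using hom that by (auto simp: hom_def)
  have "unitary_rep G T (\<lambda>g. \<pi> (\<theta> g))"
    unfolding unitary_rep_def Let_def dim
    using rep_unitary[OF rep] rep_one[OF rep] rep_mult[OF rep] cl mul one rep_cf[OF rep]
    by (auto intro: continuous_map_compose'[OF _ cont, of euclidean])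
  then show "irreducible_unitary_rep G T (\<lambda>g. \<pi> (\<theta> g))"
    using irr unfolding irreducible_unitary_rep_def Let_def dim
    by (metis (no_types, lifting) surj imageE)
qed

text \<open>Near the identity \<open>\<theta>(g)\<close> lies in \<open>K g\<^sup>-\<^sup>1 K\<close>, so on \<open>K\<close>-fixed vectors \<open>v, w\<close> the coefficient of
  \<open>\<pi> \<circ> \<theta>\<close> at \<open>(v, w)\<close> is the coefficient of the conjugate of \<open>\<pi>\<close> at \<open>(w, v)\<close>, with the two vectors exchanged.
  By Schur orthogonality an intertwiner \<open>C\<close> of the two representations exists and \<open>C\<close> maps the conjugate
  of \<open>b\<close> to a vector that is a multiple of \<open>b\<close> and not orthogonal to \<open>a\<close>.\<close>

theorem K_fixed_unique:
  assumes conn: "connected_space T" and hom: "\<theta> \<in> hom G G"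
    and cont: "continuous_map T T \<theta>" and surj: "\<theta> ` carrier G = carrier G"
    and K: "K \<subseteq> carrier G" "\<And>k. k \<in> K \<Longrightarrow> inv k \<in> K"
    and U: "openin T U" "\<one> \<in> U" "\<And>g. g \<in> U \<Longrightarrow> \<exists>h\<in>K. \<theta> g = h \<otimes> inv g \<otimes> h"
    and irr: "irreducible_unitary_rep G T \<pi>" and d: "d = rep_dim G \<pi>"
    and a: "a \<in> carrier_vec d" "K_fixed K \<pi> a" and b: "b \<in> carrier_vec d" "K_fixed K \<pi> b"
    and ab: "a \<bullet>c b = 0" and b0: "b \<noteq> 0\<^sub>v d"
  shows "a = 0\<^sub>v d"
proof (rule ccontr)
  assume a0: "a \<noteq> 0\<^sub>v d"
  note rep = irrepD(1)[OF irr]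
  define \<sigma> where "\<sigma> g = \<pi> (\<theta> g)" for g
  define \<tau> where "\<tau> g = map_mat cnj (\<pi> g)" for g
  have \<sigma>: "irreducible_unitary_rep G T \<sigma>" "rep_dim G \<sigma> = d"
    unfolding \<sigma>_def[abs_def] d using irreducible_compose[OF irr hom cont surj] by auto
  have \<tau>: "irreducible_unitary_rep G T \<tau>" "rep_dim G \<tau> = d"
    unfolding \<tau>_def[abs_def] d using irreducible_conjugate[OF irr] by auto
  have pc: "\<pi> g \<in> carrier_mat d d" if "g \<in> carrier G" for g using rep_carrier[OF rep that] d by simp
  have sc: "\<sigma> g \<in> carrier_mat d d" if "g \<in> carrier G" for g using rep_carrier[OF irrepD(1)[OF \<sigma>(1)] that] \<sigma>(2) by simp
  have tc: "\<tau> g \<in> carrier_mat d d" if "g \<in> carrier G" for g using rep_carrier[OF irrepD(1)[OF \<tau>(1)] that] \<tau>(2) by simp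
  have key: "coef \<sigma> v w g = coef \<tau> (conjugate w) (conjugate v) g"
    if v: "v \<in> carrier_vec d" "K_fixed K \<pi> v" and w: "w \<in> carrier_vec d" "K_fixed K \<pi> w" and g: "g \<in> carrier G" for v w g
  proof -
    \<comment> \<open>The Boolean selects the representation: the coordinates of an orbit under
      \<open>\<sigma>\<close> and of one under \<open>\<tau>\<close> form a single family stable
      under left translation, so an identity between the two representations can spread from
      \<open>U\<close> to \<open>G\<close>.\<close>
    define f where "f p g = (if fst p then (\<sigma> g *\<^sub>v v) $ snd p else (\<tau> g *\<^sub>v conjugate w) $ snd p)" for p :: "bool \<times> nat" and g
    define c where "c p = (if fst p then cnj (w $ snd p) else - cnj (conjugate v $ snd p))" for p :: "bool \<times> nat"
    let ?I = "(UNIV :: bool set) \<times> {..<d}"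
    have cw: "conjugate w \<in> carrier_vec d" "conjugate v \<in> carrier_vec d" using v w by auto
    have sum: "(\<Sum>p\<in>?I. c p * f p g) = coef \<sigma> v w g - coef \<tau> (conjugate w) (conjugate v) g" for g
    proof -
      have "(\<Sum>p\<in>?I. c p * f p g) = (\<Sum>s\<in>UNIV. \<Sum>i<d. c (s, i) * f (s, i) g)"
        by (simp add: sum.cartesian_product)
      then show ?thesis
        unfolding coef_def cscalar_sum[OF w(1)] cscalar_sum[OF cw(2)]
        by (simp add: UNIV_bool c_def f_def sum_negf mult.commute)
    qed
    have "(\<Sum>p\<in>?I. c p * f p g) = 0"
    proof (rule vanishing_near_one[OF conn _ _ U(1,2) _ g])
      show "finite ?I" by simp
      fix x p assume x: "x \<in> carrier G" and p: "p \<in> ?I"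
      obtain s i where si: "p = (s, i)" "i < d" using p by auto
      define z where "z = (if s then v else conjugate w)"
      define \<rho> where "\<rho> = (if s then \<sigma> else \<tau>)"
      have \<rho>: "unitary_rep G T \<rho>" "rep_dim G \<rho> = d" using \<sigma> \<tau> irrepD by (auto simp: \<rho>_def)
      have zc: "z \<in> carrier_vec d" using v cw by (simp add: z_def)
      have fz: "f (s, j) g = (\<rho> g *\<^sub>v z) $ j" for j g by (simp add: f_def \<rho>_def z_def)
      have "f p (x \<otimes> g) = (\<Sum>q\<in>?I. (if fst q = s then \<rho> x $$ (i, snd q) else 0) * f q g)" if g: "g \<in> carrier G" for g
      proof -
        have rc: "\<rho> x \<in> carrier_mat d d" using rep_carrier[OF \<rho>(1) x] \<rho>(2) by simp
        have gz: "\<rho> g *\<^sub>v z \<in> carrier_vec d" using rep_vec_carrier[OF \<rho>(1) g] zc \<rho>(2) by simp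
        have "f p (x \<otimes> g) = (\<rho> x *\<^sub>v (\<rho> g *\<^sub>v z)) $ i"
          using rep_mult_vec[OF \<rho>(1) x g] zc \<rho>(2) by (simp add: si fz)
        also have "\<dots> = (\<Sum>j<d. \<rho> x $$ (i, j) * f (s, j) g)"
          unfolding mult_mat_vec_index'[OF rc gz si(2)] fz ..
        also have "\<dots> = (\<Sum>s'\<in>UNIV. \<Sum>j<d. (if s' = s then \<rho> x $$ (i, j) else 0) * f (s', j) g)"
          by (cases s) (simp_all add: UNIV_bool)
        finally show ?thesis by (simp add: sum.cartesian_product case_prod_beta')
      qed
      then show "\<exists>c. \<forall>g\<in>carrier G. f p (x \<otimes> g) = (\<Sum>q\<in>?I. c q * f q g)"
        by (intro exI[of _ "\<lambda>q. if fst q = s then \<rho> x $$ (i, snd q) else 0"]) simp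
    next
      fix g assume gU: "g \<in> U"
      then have g: "g \<in> carrier G" using U(1) openin_subset topspace by blast
      obtain h where h: "h \<in> K" "\<theta> g = h \<otimes> inv g \<otimes> h" using U(3)[OF gU] by blast
      have hc: "h \<in> carrier G" using h K by auto
      have "\<pi> h *\<^sub>v v = v" "\<pi> (inv h) *\<^sub>v w = w" using h K v w by (auto simp: K_fixed_def)
      have "coef \<sigma> v w g = (\<pi> h *\<^sub>v (\<pi> (inv g) *\<^sub>v v)) \<bullet>c w"
        unfolding coef_def \<sigma>_def h(2)
        using rep_mult_vec[OF rep, of "h \<otimes> inv g" h v] rep_mult_vec[OF rep, of h "inv g" v] hc g v d \<open>\<pi> h *\<^sub>v v = v\<close> by simp
      also have "\<dots> = (\<pi> (inv g) *\<^sub>v v) \<bullet>c w"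
        using rep_cscalar[OF rep hc, of "\<pi> (inv g) *\<^sub>v v" w] rep_vec_carrier[OF rep, of "inv g" v] g v w d
          \<open>\<pi> (inv h) *\<^sub>v w = w\<close> by simp
      also have "\<dots> = v \<bullet>c (\<pi> g *\<^sub>v w)" using rep_cscalar[OF rep, of "inv g" v w] g v w d by simp
      also have "\<dots> = coef \<tau> (conjugate w) (conjugate v) g"
        unfolding coef_def \<tau>_def conjugate_mult_mat_vec[OF pc[OF g] w(1)]
        by (rule conjugate_cscalar[symmetric]) (use pc[OF g] w v in auto)
      finally show "(\<Sum>p\<in>?I. c p * f p g) = 0" unfolding sum by simp
    qed
    then show ?thesis unfolding sum by simp
  qed
  have d0: "d > 0" using irrepD(2)[OF irr] d by simp
  have ca: "conjugate a \<in> carrier_vec d" and cb: "conjugate b \<in> carrier_vec d" using a b by auto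
  have na: "a \<bullet>c a \<noteq> 0" using a0 a by (simp add: conjugate_square_eq_0_vec[of _ d])
  have nb: "b \<bullet>c b \<noteq> 0" using b0 b by (simp add: conjugate_square_eq_0_vec[of _ d])
  have ip\<sigma>: "ip (coef \<sigma> v w) (coef \<sigma> v' w') = (v \<bullet>c v') * cnj (w \<bullet>c w') / of_nat d"
    if "v \<in> carrier_vec d" "w \<in> carrier_vec d" "v' \<in> carrier_vec d" "w' \<in> carrier_vec d" for v w v' w'
    by (rule coef_schur[OF \<sigma>(1) \<sigma>(2)[symmetric] that])
  \<comment> \<open>Inequivalent representations have orthogonal coefficients, but by
    \<open>key\<close> both share one that is non-zero.\<close>
  have "unitarily_equivalent G \<tau> \<sigma>"
  proof (rule ccontr)
    assume "\<not> unitarily_equivalent G \<tau> \<sigma>"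
    then have "ip (coef \<sigma> b b) (coef \<tau> (conjugate b) (conjugate b)) = 0"
      using b cb by (intro coef_orthogonal[OF \<sigma>(1) \<tau>(1)]) (auto simp: \<sigma> \<tau>)
    moreover have "ip (coef \<sigma> b b) (coef \<tau> (conjugate b) (conjugate b)) = ip (coef \<sigma> b b) (coef \<sigma> b b)"
      using key[OF b b] by (intro ip_cong) auto
    ultimately show False using ip\<sigma>[OF b(1) b(1) b(1) b(1)] nb d0 by simp
  qed
  then obtain C where C: "unitary_mat d C" "\<And>g. g \<in> carrier G \<Longrightarrow> C * \<tau> g = \<sigma> g * C"
    by (auto simp: unitarily_equivalent_def \<tau>)
  have Cc: "C \<in> carrier_mat d d" using C by (simp add: unitary_mat_def)
  have transfer: "coef \<tau> v w g = coef \<sigma> (C *\<^sub>v v) (C *\<^sub>v w) g"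
    if "v \<in> carrier_vec d" "w \<in> carrier_vec d" "g \<in> carrier G" for v w g
  proof -
    have "coef \<tau> v w g = (C *\<^sub>v (\<tau> g *\<^sub>v v)) \<bullet>c (C *\<^sub>v w)"
      unfolding coef_def using C(1) that mult_mat_vec_carrier[OF tc[OF that(3)] that(1)]
      by (simp add: unitary_mat_def)
    also have "C *\<^sub>v (\<tau> g *\<^sub>v v) = \<sigma> g *\<^sub>v (C *\<^sub>v v)"
      using assoc_mult_mat_vec[OF Cc tc[OF that(3)] that(1)] assoc_mult_mat_vec[OF sc[OF that(3)] Cc that(1)] C(2)[OF that(3)]
      by simp
    finally show ?thesis by (simp add: coef_def)
  qed
  define x where "x = C *\<^sub>v conjugate b"
  define y where "y = C *\<^sub>v conjugate a"
  have xc: "x \<in> carrier_vec d" and yc: "y \<in> carrier_vec d"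
    unfolding x_def y_def using mult_mat_vec_carrier[OF Cc] ca cb by auto
  have xx: "x \<bullet>c x = b \<bullet>c b"
    using C(1) cb conjugate_cscalar[OF b(1) b(1)] by (simp add: x_def unitary_mat_def)
  have "ip (coef \<sigma> b b) (coef \<sigma> x x) = ip (coef \<sigma> b b) (coef \<sigma> b b)"
    unfolding x_def using key[OF b b] transfer[OF cb cb] by (intro ip_cong) auto
  \<comment> \<open>As \<open>x\<close> and \<open>b\<close> have equal norms, this is the equality
    case of Cauchy-Schwarz: \<open>x\<close> is a multiple of \<open>b\<close>.\<close>
  then have e1: "(b \<bullet>c x) * (x \<bullet>c b) = (b \<bullet>c b) * (b \<bullet>c b)"
    using ip\<sigma>[OF b(1) b(1) xc xc] ip\<sigma>[OF b(1) b(1) b(1) b(1)] d0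
    by (simp add: cscalar_commute[OF b(1) xc] cscalar_commute[OF b(1) b(1)])
  have "ip (coef \<sigma> a b) (coef \<sigma> x y) = ip (coef \<sigma> a b) (coef \<sigma> a b)"
    unfolding x_def y_def using key[OF a b] transfer[OF cb ca] by (intro ip_cong) auto
  \<comment> \<open>The inner product equals the squared norm of the coefficient at (a, b), which is
    non-zero, and \<open>a \<bullet>c x\<close> is one of its factors.\<close>
  then have ax: "a \<bullet>c x \<noteq> 0"
    using ip\<sigma>[OF a(1) b(1) xc yc] ip\<sigma>[OF a(1) b(1) a(1) b(1)] d0 na nb by auto
  define k where "k = - (x \<bullet>c b) / (b \<bullet>c b)"
  define r where "r = x + k \<cdot>\<^sub>v b"
  have rc: "r \<in> carrier_vec d" using xc b by (simp add: r_def)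
  have kk: "cnj k = - (b \<bullet>c x) / (b \<bullet>c b)"
    by (simp add: k_def cscalar_commute[OF xc b(1)] cscalar_commute[OF b(1) b(1)])
  have "r \<bullet>c r = 0"
    unfolding r_def cscalar_expand[OF xc b(1)] kk xx using nb e1 by (simp add: k_def field_simps)
  then have "r = 0\<^sub>v d" using conjugate_square_eq_0_vec[OF rc] by simp
  have "x $ i = - k * b $ i" if "i < d" for i
  proof -
    have "r $ i = 0" using \<open>r = 0\<^sub>v d\<close> that by simp
    then show ?thesis using that xc b by (simp add: r_def eq_neg_iff_add_eq_0)
  qed
  then have "a \<bullet>c x = (\<Sum>i<d. - cnj k * (a $ i * cnj (b $ i)))"
    unfolding cscalar_sum[OF xc] by (intro sum.cong) auto
  also have "\<dots> = - cnj k * (a \<bullet>c b)" unfolding cscalar_sum[OF b(1)] sum_distrib_left ..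
  finally show False using ax ab by simp
qed

end

section \<open>Smooth maps and isometries\<close>

lemma times_differentiable_on_subset:
  "times_differentiable_on n S f \<Longrightarrow> S' \<subseteq> S \<Longrightarrow> times_differentiable_on n S' f"
  by (induction n arbitrary: f) (auto intro: continuous_on_subset)

lemma times_differentiable_on_local:
  assumes "\<And>x. x \<in> S \<Longrightarrow> \<exists>N. open N \<and> x \<in> N \<and> times_differentiable_on n N f"
  shows "times_differentiable_on n S f"
  using assms
proof (induction n arbitrary: f)
  case 0
  show ?case unfolding times_differentiable_on.simps
  proof (rule continuous_at_imp_continuous_on, rule ballI)
    fix x assume "x \<in> S"
    then obtain N where "open N" "x \<in> N" "continuous_on N f" using 0[OF \<open>x \<in> S\<close>] by auto
    then show "isCont f x" by (simp add: continuous_on_eq_continuous_at)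
  qed
next
  case (Suc n)
  show ?case unfolding times_differentiable_on.simps
  proof (intro conjI ballI allI)
    fix x assume "x \<in> S"
    from Suc.prems[OF this] show "f differentiable at x" by auto
  next
    fix v
    show "times_differentiable_on n S (\<lambda>x. frechet_derivative f (at x) v)"
    proof (rule Suc.IH)
      fix x assume "x \<in> S"
      from Suc.prems[OF this]
      show "\<exists>N. open N \<and> x \<in> N \<and> times_differentiable_on n N (\<lambda>x. frechet_derivative f (at x) v)" by auto
    qed
  qed
qed

lemma times_differentiable_on_cong:
  assumes "open S" "\<And>x. x \<in> S \<Longrightarrow> f x = g x" "times_differentiable_on n S f"
  shows "times_differentiable_on n S g"
  using assms(2,3)
proof (induction n arbitrary: f g)
  case 0
  then show ?case using continuous_on_cong[of S S f g] by simp
next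
  case (Suc n)
  have d: "f differentiable at x" if "x \<in> S" for x using Suc.prems that by simp
  have d': "g differentiable at x" if x: "x \<in> S" for x
  proof -
    obtain D where "(f has_derivative D) (at x)" using d[OF x] by (auto simp: differentiable_def)
    from has_derivative_transform_within_open[OF this assms(1) x] have "(g has_derivative D) (at x)"
      using Suc.prems(1) by blast
    then show ?thesis by (auto simp: differentiable_def)
  qed
  have e: "frechet_derivative f (at x) v = frechet_derivative g (at x) v" if x: "x \<in> S" for x v
    using frechet_derivative_transform_within_open[OF d[OF x] assms(1) x Suc.prems(1)] by simp
  show ?case unfolding times_differentiable_on.simps
  proof (intro conjI ballI allI d')
    fix v
    show "times_differentiable_on n S (\<lambda>x. frechet_derivative g (at x) v)"
      by (rule Suc.IH[of "\<lambda>x. frechet_derivative f (at x) v"]) (use e Suc.prems in auto)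
  qed
qed

lemma times_differentiable_on_Suc_lower:
  "times_differentiable_on (Suc n) S f \<Longrightarrow> times_differentiable_on n S f"
proof (induction n arbitrary: f)
  case 0
  then show ?case
    by (auto intro!: continuous_at_imp_continuous_on differentiable_imp_continuous_within)
next
  case (Suc n)
  then show ?case unfolding times_differentiable_on.simps(2)[of "Suc n"] times_differentiable_on.simps(2)[of n S f]
    by blast
qed

text \<open>Admits any formula \<open>D\<close> for the derivative in place of
  \<open>frechet_derivative\<close>, which is how the product and chain rules enter the
  inductions.\<close>

lemma times_differentiable_on_SucI:
  assumes S: "open S" and f: "\<And>x. x \<in> S \<Longrightarrow> (f has_derivative D x) (at x)"
    and D: "\<And>v. times_differentiable_on n S (\<lambda>x. D x v)"
  shows "times_differentiable_on (Suc n) S f"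
  unfolding times_differentiable_on.simps
proof (intro conjI ballI allI)
  fix x assume "x \<in> S"
  then show "f differentiable at x" using f by (auto simp: differentiable_def)
next
  fix v
  show "times_differentiable_on n S (\<lambda>x. frechet_derivative f (at x) v)"
    by (rule times_differentiable_on_cong[OF S _ D[of v]]) (use frechet_derivative_at[OF f] in simp)
qed

lemma times_differentiable_onD:
  assumes "times_differentiable_on (Suc n) S f"
  shows "x \<in> S \<Longrightarrow> (f has_derivative frechet_derivative f (at x)) (at x)"
    and "times_differentiable_on n S (\<lambda>x. frechet_derivative f (at x) v)"
  using assms by (auto simp: frechet_derivative_works)

lemma times_differentiable_on_const: "times_differentiable_on n S (\<lambda>x. c)"
  by (induction n arbitrary: c) auto

lemma times_differentiable_on_linear:
  assumes L: "bounded_linear L" and S: "open S"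
  shows "times_differentiable_on n S f \<Longrightarrow> times_differentiable_on n S (\<lambda>x. L (f x))"
proof (induction n arbitrary: f)
  case 0
  then show ?case using linear_continuous_on_compose[of S f L] L by (simp add: bounded_linear.linear)
next
  case (Suc n)
  note d = times_differentiable_onD[OF Suc.prems]
  show ?case
    by (rule times_differentiable_on_SucI[OF S bounded_linear.has_derivative[OF L d(1)]], assumption)
       (rule Suc.IH[OF d(2)])
qed

lemma times_differentiable_on_add:
  assumes S: "open S"
  shows "times_differentiable_on n S f \<Longrightarrow> times_differentiable_on n S g \<Longrightarrow>
    times_differentiable_on n S (\<lambda>x. f x + g x)"
proof (induction n arbitrary: f g)
  case 0
  then show ?case by (auto intro: continuous_on_add)
next
  case (Suc n)
  note d = times_differentiable_onD[OF Suc.prems(1)] and d' = times_differentiable_onD[OF Suc.prems(2)]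
  show ?case
    by (rule times_differentiable_on_SucI[OF S has_derivative_add[OF d(1) d'(1)]]) (auto intro: Suc.IH d d')
qed

lemma times_differentiable_on_sum:
  assumes S: "open S" and I: "finite I" and f: "\<And>i. i \<in> I \<Longrightarrow> times_differentiable_on n S (f i)"
  shows "times_differentiable_on n S (\<lambda>x. \<Sum>i\<in>I. f i x)"
  using I f
  by (induction I) (auto intro: times_differentiable_on_const times_differentiable_on_add[OF S])

lemma times_differentiable_on_scaleR:
  assumes S: "open S"
  shows "times_differentiable_on n S h \<Longrightarrow> times_differentiable_on n S f \<Longrightarrow>
    times_differentiable_on n S (\<lambda>x. h x *\<^sub>R f x)"
proof (induction n arbitrary: h f)
  case 0
  then show ?case by (auto intro: continuous_on_scaleR)
next
  case (Suc n)
  note d = times_differentiable_onD[OF Suc.prems(1)] and d' = times_differentiable_onD[OF Suc.prems(2)]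
  note l = times_differentiable_on_Suc_lower[OF Suc.prems(1)] times_differentiable_on_Suc_lower[OF Suc.prems(2)]
  show ?case
    by (rule times_differentiable_on_SucI[OF S has_derivative_scaleR[OF d(1) d'(1)]])
       (auto intro!: times_differentiable_on_add[OF S] Suc.IH d(2) d'(2) l)
qed

lemma times_differentiable_on_compose:
  fixes g :: "'a::euclidean_space \<Rightarrow> 'b::euclidean_space" and f :: "'b \<Rightarrow> 'c::euclidean_space"
  assumes S: "open S" and im: "g ` S \<subseteq> R"
  shows "times_differentiable_on n S g \<Longrightarrow> times_differentiable_on n R f \<Longrightarrow>
    times_differentiable_on n S (\<lambda>x. f (g x))"
proof (induction n arbitrary: f)
  case 0
  then show ?case using im by (auto intro: continuous_on_compose2)
next
  case (Suc n)
  note d = times_differentiable_onD[OF Suc.prems(1)] and d' = times_differentiable_onD[OF Suc.prems(2)]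
  \<comment> \<open>The chain rule expanded in the basis: the direction fed to the derivative of
    \<open>f\<close> is now constant, so each summand is a scalar derivative of \<open>g\<close>
    times a composite covered by the induction hypothesis.\<close>
  define D where "D x v = (\<Sum>b\<in>Basis. (frechet_derivative g (at x) v \<bullet> b) *\<^sub>R frechet_derivative f (at (g x)) b)" for x v
  have "((\<lambda>x. f (g x)) has_derivative D x) (at x)" if x: "x \<in> S" for x
  proof -
    have f': "(f has_derivative frechet_derivative f (at (g x))) (at (g x))" using d'(1) im x by auto
    have lin: "linear (frechet_derivative f (at (g x)))" using has_derivative_linear[OF f'] .
    have "frechet_derivative f (at (g x)) w = (\<Sum>b\<in>Basis. (w \<bullet> b) *\<^sub>R frechet_derivative f (at (g x)) b)" for w
      using linear_sum[OF lin, of "\<lambda>b. (w \<bullet> b) *\<^sub>R b" Basis] linear_cmul[OF lin] by (simp add: euclidean_representation)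
    then have "D x = (\<lambda>v. frechet_derivative f (at (g x)) (frechet_derivative g (at x) v))"
      unfolding D_def by metis
    then show ?thesis using has_derivative_compose[OF d(1)[OF x] f'] by simp
  qed
  moreover have "times_differentiable_on n S (\<lambda>x. D x v)" for v
    unfolding D_def
    by (intro times_differentiable_on_sum[OF S] times_differentiable_on_scaleR[OF S]
        times_differentiable_on_linear[OF bounded_linear_inner_left S] d(2)
        Suc.IH[OF times_differentiable_on_Suc_lower[OF Suc.prems(1)]] d'(2)) auto
  ultimately show ?case by (rule times_differentiable_on_SucI[OF S])
qed

section \<open>Smooth maps and isometries in charts\<close>

lemma
  assumes "is_chart T (U, c)"
  shows chart_openin: "openin T U" and chart_inj: "inj_on c U" and chart_open_image: "open (c ` U)"
    and chart_open: "V \<subseteq> U \<Longrightarrow> open (c ` V) \<longleftrightarrow> openin T V"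
    and chart_inv: "x \<in> U \<Longrightarrow> inv_into U c (c x) = x"
proof -
  show U: "openin T U" and o: "open (c ` U)" using assms by (auto simp: is_chart_def)
  have hom: "homeomorphic_map (subtopology T U) (top_of_set (c ` U)) c" using assms by (auto simp: is_chart_def)
  have top: "topspace (subtopology T U) = U" using openin_subset[OF U] by auto
  show inj: "inj_on c U" using hom top by (simp add: homeomorphic_map_def)
  show "x \<in> U \<Longrightarrow> inv_into U c (c x) = x" using inj by simp
  show "open (c ` V) \<longleftrightarrow> openin T V" if "V \<subseteq> U"
  proof -
    have "openin (top_of_set (c ` U)) (c ` V) \<longleftrightarrow> openin (subtopology T U) V"
      using homeomorphic_map_openness[OF hom, of V] that top by blast
    moreover have "openin (top_of_set (c ` U)) (c ` V) \<longleftrightarrow> open (c ` V)"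
      using that o by (auto simp: openin_open_eq)
    moreover have "openin (subtopology T U) V \<longleftrightarrow> openin T V"
      using that U by (auto simp: openin_open_subtopology)
    ultimately show ?thesis by simp
  qed
qed

context
  fixes S :: "'x topology" and A :: "('x, 'a::euclidean_space) chart set"
    and T :: "'y topology" and B :: "('y, 'b::euclidean_space) chart set"
    and R :: "'z topology" and C :: "('z, 'c::euclidean_space) chart set"
    and f :: "'x \<Rightarrow> 'y" and g :: "'y \<Rightarrow> 'z"
  assumes A: "smooth_manifold S A" and B: "smooth_manifold T B" and C: "smooth_manifold R C"
    and f: "smooth_map S A T B f" and g: "smooth_map T B R C g"
begin

text \<open>With a chart of the middle manifold around \<open>f x\<close>, the coordinate form of
  the composite factors on an open set \<open>N\<close> around \<open>c x\<close>. Smoothness of the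
  composite and its chain rule are both read off from this factorisation.\<close>

lemma intermediate_chart:
  assumes Uc: "(U, c) \<in> A" and Vd: "(V, d) \<in> C" and x: "x \<in> U" "g (f x) \<in> V"
  obtains W w N where "(W, w) \<in> B" "f x \<in> W" "open N" "c x \<in> N" "N \<subseteq> c ` {x \<in> U. g (f x) \<in> V}"
    "\<And>q. q \<in> N \<Longrightarrow> (d \<circ> (g \<circ> f) \<circ> inv_into U c) q = (d \<circ> g \<circ> inv_into W w) ((w \<circ> f \<circ> inv_into U c) q)"
    "smooth_on N (w \<circ> f \<circ> inv_into U c)"
    "(w \<circ> f \<circ> inv_into U c) ` N \<subseteq> w ` {y \<in> W. g y \<in> V}"
    "smooth_on (w ` {y \<in> W. g y \<in> V}) (d \<circ> g \<circ> inv_into W w)"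
proof -
  have cU: "is_chart S (U, c)" using A Uc by (auto simp: smooth_manifold_def)
  have cV: "is_chart R (V, d)" using C Vd by (auto simp: smooth_manifold_def)
  have fc: "continuous_map S T f" and gc: "continuous_map T R g" using f g by (auto simp: smooth_map_def)
  have "f x \<in> topspace T"
    using fc x(1) openin_subset[OF chart_openin[OF cU]] by (auto simp: continuous_map_def)
  moreover have "(\<Union>(W, w)\<in>B. W) = topspace T" using B by (simp add: smooth_manifold_def)
  ultimately obtain W w where Ww: "(W, w) \<in> B" "f x \<in> W" by blast
  have cW: "is_chart T (W, w)" using B Ww by (auto simp: smooth_manifold_def)
  define P where "P = {x \<in> U. f x \<in> W \<and> g (f x) \<in> V}"
  define Q where "Q = W \<inter> {y \<in> topspace T. g y \<in> V}"
  have Q: "openin T Q"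
    unfolding Q_def by (intro openin_Int chart_openin[OF cW] openin_continuous_map_preimage[OF gc chart_openin[OF cV]])
  have "P = U \<inter> {x \<in> topspace S. f x \<in> Q}"
    using openin_subset[OF chart_openin[OF cU]] openin_subset[OF chart_openin[OF cW]] by (auto simp: P_def Q_def)
  then have P: "openin S P"
    using openin_Int[OF chart_openin[OF cU] openin_continuous_map_preimage[OF fc Q]] by simp
  have oN: "open (c ` P)" using chart_open[OF cU, of P] P by (auto simp: P_def)
  have "smooth_on (c ` {x \<in> U. f x \<in> W}) (w \<circ> f \<circ> inv_into U c)" using f Uc Ww by (fastforce simp: smooth_map_def)
  then have "smooth_on (c ` P) (w \<circ> f \<circ> inv_into U c)"
    unfolding smooth_on_def by (auto intro: times_differentiable_on_subset simp: P_def)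
  moreover have "smooth_on (w ` {y \<in> W. g y \<in> V}) (d \<circ> g \<circ> inv_into W w)" using g Vd Ww by (fastforce simp: smooth_map_def)
  ultimately show thesis
  proof (intro that[of W w "c ` P"] oN Ww)
    show "c x \<in> c ` P" "c ` P \<subseteq> c ` {x \<in> U. g (f x) \<in> V}" using x Ww by (auto simp: P_def)
    show "(w \<circ> f \<circ> inv_into U c) ` c ` P \<subseteq> w ` {y \<in> W. g y \<in> V}"
      by (auto simp: P_def chart_inv[OF cU])
    fix q assume "q \<in> c ` P"
    then show "(d \<circ> (g \<circ> f) \<circ> inv_into U c) q = (d \<circ> g \<circ> inv_into W w) ((w \<circ> f \<circ> inv_into U c) q)"
      by (auto simp: P_def chart_inv[OF cU] chart_inv[OF cW])
  qed
qed

lemma smooth_map_compose: "smooth_map S A R C (g \<circ> f)"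
  unfolding smooth_map_def
proof (intro conjI, goal_cases)
  case 1
  show ?case using f g by (auto simp: smooth_map_def intro: continuous_map_compose)
next
  case 2
  {
    fix U c V d assume Uc: "(U, c) \<in> A" and Vd: "(V, d) \<in> C"
    have "times_differentiable_on n (c ` {x \<in> U. g (f x) \<in> V}) (d \<circ> (g \<circ> f) \<circ> inv_into U c)" for n
    proof (rule times_differentiable_on_local)
      fix q assume "q \<in> c ` {x \<in> U. g (f x) \<in> V}"
      then obtain x where x: "x \<in> U" "g (f x) \<in> V" "q = c x" by blast
      obtain W w N where WN: "(W, w) \<in> B" "f x \<in> W" "open N" "c x \<in> N" "N \<subseteq> c ` {x \<in> U. g (f x) \<in> V}"
        "\<And>q. q \<in> N \<Longrightarrow> (d \<circ> (g \<circ> f) \<circ> inv_into U c) q = (d \<circ> g \<circ> inv_into W w) ((w \<circ> f \<circ> inv_into U c) q)"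
        "smooth_on N (w \<circ> f \<circ> inv_into U c)"
        "(w \<circ> f \<circ> inv_into U c) ` N \<subseteq> w ` {y \<in> W. g y \<in> V}"
        "smooth_on (w ` {y \<in> W. g y \<in> V}) (d \<circ> g \<circ> inv_into W w)"
        by (rule intermediate_chart[OF Uc Vd x(1,2)]) blast
      have "times_differentiable_on n N (\<lambda>q. (d \<circ> g \<circ> inv_into W w) ((w \<circ> f \<circ> inv_into U c) q))"
        by (rule times_differentiable_on_compose[OF WN(3,8) WN(7)[unfolded smooth_on_def, rule_format]
              WN(9)[unfolded smooth_on_def, rule_format]])
      from times_differentiable_on_cong[OF WN(3) _ this] WN(6)
      have "times_differentiable_on n N (d \<circ> (g \<circ> f) \<circ> inv_into U c)" by simp
      then show "\<exists>N. open N \<and> q \<in> N \<and> times_differentiable_on n N (d \<circ> (g \<circ> f) \<circ> inv_into U c)"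
        using WN(3,4) x(3) by blast
    qed
    then have "smooth_on (c ` {x \<in> U. (g \<circ> f) x \<in> V}) (d \<circ> (g \<circ> f) \<circ> inv_into U c)" by (simp add: smooth_on_def)
  }
  then show ?case by blast
qed

lemma derivative_compose_charts:
  assumes Uc: "(U, c) \<in> A" and Vd: "(V, d) \<in> C" and x: "x \<in> U" "g (f x) \<in> V"
  shows "\<exists>(W, w)\<in>B. f x \<in> W \<and> frechet_derivative (d \<circ> (g \<circ> f) \<circ> inv_into U c) (at (c x)) =
    frechet_derivative (d \<circ> g \<circ> inv_into W w) (at (w (f x))) \<circ> frechet_derivative (w \<circ> f \<circ> inv_into U c) (at (c x))"
proof -
  obtain W w N where WN: "(W, w) \<in> B" "f x \<in> W" "open N" "c x \<in> N" "N \<subseteq> c ` {x \<in> U. g (f x) \<in> V}"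
    "\<And>q. q \<in> N \<Longrightarrow> (d \<circ> (g \<circ> f) \<circ> inv_into U c) q = (d \<circ> g \<circ> inv_into W w) ((w \<circ> f \<circ> inv_into U c) q)"
    "smooth_on N (w \<circ> f \<circ> inv_into U c)"
    "(w \<circ> f \<circ> inv_into U c) ` N \<subseteq> w ` {y \<in> W. g y \<in> V}"
    "smooth_on (w ` {y \<in> W. g y \<in> V}) (d \<circ> g \<circ> inv_into W w)"
    by (rule intermediate_chart[OF Uc Vd x]) blast
  let ?F = "w \<circ> f \<circ> inv_into U c" and ?H = "d \<circ> g \<circ> inv_into W w"
  have cU: "is_chart S (U, c)" using A Uc by (auto simp: smooth_manifold_def)
  have Fx: "?F (c x) = w (f x)" using chart_inv[OF cU x(1)] by simp
  have F: "(?F has_derivative frechet_derivative ?F (at (c x))) (at (c x))"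
    by (rule times_differentiable_onD(1)[OF WN(7)[unfolded smooth_on_def, rule_format, of "Suc 0"] WN(4)])
  have H: "(?H has_derivative frechet_derivative ?H (at (w (f x)))) (at (?F (c x)))"
    unfolding Fx
    by (rule times_differentiable_onD(1)[OF WN(9)[unfolded smooth_on_def, rule_format, of "Suc 0"]])
       (use WN(2) x(2) in auto)
  have "((\<lambda>q. ?H (?F q)) has_derivative (\<lambda>v. frechet_derivative ?H (at (w (f x))) (frechet_derivative ?F (at (c x)) v))) (at (c x))"
    by (rule has_derivative_compose[OF F H])
  from has_derivative_transform_within_open[OF this WN(3,4)]
  have "((d \<circ> (g \<circ> f) \<circ> inv_into U c) has_derivative
      (\<lambda>v. frechet_derivative ?H (at (w (f x))) (frechet_derivative ?F (at (c x)) v))) (at (c x))"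
    using WN(6) by simp
  from frechet_derivative_at[OF this]
  have "frechet_derivative (d \<circ> (g \<circ> f) \<circ> inv_into U c) (at (c x)) =
      frechet_derivative ?H (at (w (f x))) \<circ> frechet_derivative ?F (at (c x))"
    unfolding comp_def[of "frechet_derivative ?H (at (w (f x)))"] by (rule sym)
  with WN(1,2) show ?thesis by (intro bexI[of _ "(W, w)"]) simp_all
qed

end

lemma preserves_metricD:
  assumes "preserves_metric A m f" "(U, c) \<in> A" "(V, d) \<in> A" "x \<in> U" "f x \<in> V"
  shows "m (V, d) (d (f x)) (frechet_derivative (d \<circ> f \<circ> inv_into U c) (at (c x)) u)
    (frechet_derivative (d \<circ> f \<circ> inv_into U c) (at (c x)) v) = m (U, c) (c x) u v"
  using bspec[OF bspec[OF assms(1)[unfolded preserves_metric_def] assms(2), unfolded prod.case] assms(3),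
      unfolded prod.case Let_def] assms(4,5)
  by blast

lemma isometries_compose:
  assumes M: "smooth_manifold euclidean A" and f: "f \<in> isometries A m" and g: "g \<in> isometries A m"
  shows "g \<circ> f \<in> isometries A m"
proof -
  have fg: "smooth_map euclidean A euclidean A f" "smooth_map euclidean A euclidean A g" "bij f" "bij g"
    "smooth_map euclidean A euclidean A (inv_into UNIV f)" "smooth_map euclidean A euclidean A (inv_into UNIV g)"
    "preserves_metric A m f" "preserves_metric A m g"
    using f g by (auto simp: isometries_def)
  have "preserves_metric A m (g \<circ> f)"
    unfolding preserves_metric_def
  proof (clarify, unfold Let_def, intro allI)
    fix U c V d x u v
    assume Uc: "(U, c) \<in> A" and Vd: "(V, d) \<in> A" and x: "x \<in> U" "(g \<circ> f) x \<in> V"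
    obtain W w where W: "(W, w) \<in> A" "f x \<in> W"
      and D: "frechet_derivative (d \<circ> (g \<circ> f) \<circ> inv_into U c) (at (c x)) =
       frechet_derivative (d \<circ> g \<circ> inv_into W w) (at (w (f x))) \<circ> frechet_derivative (w \<circ> f \<circ> inv_into U c) (at (c x))"
      using derivative_compose_charts[OF M M M fg(1,2) Uc Vd x(1)] x(2) by auto
    have 1: "m (W, w) (w (f x)) (frechet_derivative (w \<circ> f \<circ> inv_into U c) (at (c x)) u)
        (frechet_derivative (w \<circ> f \<circ> inv_into U c) (at (c x)) v) = m (U, c) (c x) u v" for u v
      by (rule preserves_metricD[OF fg(7) Uc W(1) x(1) W(2)])
    have 2: "m (V, d) (d (g (f x))) (frechet_derivative (d \<circ> g \<circ> inv_into W w) (at (w (f x))) u)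
        (frechet_derivative (d \<circ> g \<circ> inv_into W w) (at (w (f x))) v) = m (W, w) (w (f x)) u v" for u v
      using x(2) by (intro preserves_metricD[OF fg(8) W(1) Vd W(2)]) simp
    show "m (V, d) (d ((g \<circ> f) x)) (frechet_derivative (d \<circ> (g \<circ> f) \<circ> inv_into U c) (at (c x)) u)
        (frechet_derivative (d \<circ> (g \<circ> f) \<circ> inv_into U c) (at (c x)) v) = m (U, c) (c x) u v"
      unfolding D using 1 2 by simp
  qed
  moreover have "inv_into UNIV (g \<circ> f) = inv_into UNIV f \<circ> inv_into UNIV g" by (rule o_inv_distrib[OF fg(4,3)])
  ultimately show ?thesis
    using smooth_map_compose[OF M M M fg(1,2)] smooth_map_compose[OF M M M fg(6,5)] bij_comp[OF fg(3,4)]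
    by (simp add: isometries_def)
qed

text \<open>The preimage of the subbasic set for \<open>C\<close> and \<open>V\<close> is the
  subbasic set for the image of \<open>C\<close> and the preimage of \<open>V\<close> under
  \<open>s\<close>.\<close>

lemma conjugation_continuous:
  fixes s :: "'x::topological_space \<Rightarrow> 'x"
  assumes s: "continuous_on UNIV s"
  shows "continuous_map compact_open_topology compact_open_topology (\<lambda>f. s \<circ> f \<circ> s)"
  unfolding compact_open_topology_def
proof (rule continuous_on_generated_topo)
  let ?B = "{{f :: 'x \<Rightarrow> 'x. f ` C \<subseteq> V} | C V. compact C \<and> open V}"
  have UN: "\<Union> ?B = UNIV"
  proof -
    have "UNIV = {f :: 'x \<Rightarrow> 'x. f ` {} \<subseteq> {}}" by auto
    then have "UNIV \<in> ?B" by blast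
    then show ?thesis by blast
  qed
  show "(\<lambda>f. s \<circ> f \<circ> s) ` topspace (topology_generated_by ?B) \<subseteq> \<Union> ?B" unfolding UN by simp
  fix P assume "P \<in> ?B"
  then obtain C V where CV: "P = {f. f ` C \<subseteq> V}" "compact C" "open V" by blast
  have "(\<lambda>f. s \<circ> f \<circ> s) -` P = {f. f ` (s ` C) \<subseteq> s -` V}" by (auto simp: CV)
  moreover have "compact (s ` C)" using CV(2) continuous_on_subset[OF s] by (intro compact_continuous_image) auto
  moreover have "open (s -` V)" by (rule open_vimage[OF CV(3) s])
  ultimately have "(\<lambda>f. s \<circ> f \<circ> s) -` P \<in> ?B" by blast
  then have "openin (topology_generated_by ?B) ((\<lambda>f. s \<circ> f \<circ> s) -` P)" by (rule topology_generated_by_Basis)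
  then show "openin (topology_generated_by ?B) ((\<lambda>f. s \<circ> f \<circ> s) -` P \<inter> topspace (topology_generated_by ?B))"
    unfolding topology_generated_by_topspace UN by (simp only: Int_UNIV_right)
qed

text \<open>Conjugation by \<open>s\<close> is continuous and fixes \<open>id\<close>, so it maps
  the identity component to a connected set containing \<open>id\<close>.\<close>

lemma isometry_group_conjugation:
  assumes M: "smooth_manifold euclidean A" and s: "s \<in> isometries A m" and ss: "s \<circ> s = id"
    and g: "g \<in> carrier (isometry_group_0 A m)"
  shows "s \<circ> g \<circ> s \<in> carrier (isometry_group_0 A m)"
proof -
  let ?I = "isometries A m"
  let ?T = "subtopology compact_open_topology ?I"
  let ?C = "connected_component_of_set ?T id"
  let ?\<theta> = "\<lambda>f. s \<circ> f \<circ> s"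
  have gC: "g \<in> ?C" using g by (simp add: isometry_group_0_def)
  then have "id \<in> topspace ?T" using connected_component_of_equiv by fastforce
  have "continuous_on UNIV s" using s by (auto simp: isometries_def smooth_map_def)
  then have "continuous_map compact_open_topology compact_open_topology ?\<theta>" by (rule conjugation_continuous)
  moreover have "?\<theta> \<in> ?I \<rightarrow> ?I"
    using isometries_compose[OF M isometries_compose[OF M s] s] isometries_compose[OF M s] s
    by (auto simp: o_assoc intro!: isometries_compose[OF M])
  ultimately have "continuous_map ?T ?T ?\<theta>"
    by (simp add: continuous_map_in_subtopology continuous_map_from_subtopology image_subset_iff Pi_iff)
  then have "connectedin ?T (?\<theta> ` ?C)"
    by (rule connectedin_continuous_map_image) (rule connectedin_connected_component_of)
  moreover have "id \<in> ?\<theta> ` ?C"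
    using \<open>id \<in> topspace ?T\<close> ss by (intro image_eqI[of _ _ id]) (auto simp: connected_component_of_refl)
  ultimately have "?\<theta> ` ?C \<subseteq> ?C" by (rule connected_component_of_maximal)
  with gC show ?thesis by (auto simp: isometry_group_0_def)
qed

text \<open>In a chart the derivative of multiplication at the identity is addition of tangent
  vectors, so squaring has derivative twice the identity there, and the inverse function theorem
  makes it a local homeomorphism.\<close>

lemma lie_group_square_root:
  fixes A :: "('g, 'f::euclidean_space) chart set"
  assumes lie: "lie_group G T A"
  obtains N0 where "openin T N0" "\<one>\<^bsub>G\<^esub> \<in> N0" "inj_on (\<lambda>x. x \<otimes>\<^bsub>G\<^esub> x) N0"
    "\<And>N. openin T N \<Longrightarrow> N \<subseteq> N0 \<Longrightarrow> openin T ((\<lambda>x. x \<otimes>\<^bsub>G\<^esub> x) ` N)"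
proof -
  interpret group G using lie by (simp add: lie_group_def)
  have M: "smooth_manifold T A" and top: "topspace T = carrier G"
    and sm: "smooth_map (prod_topology T T) (prod_atlas A A) T A (\<lambda>(x, y). x \<otimes>\<^bsub>G\<^esub> y)"
    using lie by (auto simp: lie_group_def)
  have "(\<Union>(U, c)\<in>A. U) = carrier G" using M top by (simp add: smooth_manifold_def)
  with one_closed obtain U c where Uc: "(U, c) \<in> A" "\<one>\<^bsub>G\<^esub> \<in> U" by blast
  have ch: "is_chart T (U, c)" using M Uc by (auto simp: smooth_manifold_def)
  have Usub: "U \<subseteq> carrier G" using openin_subset[OF chart_openin[OF ch]] top by simp
  define \<phi> where "\<phi> = inv_into U c"
  have \<phi>: "\<phi> (c x) = x" if "x \<in> U" for x using chart_inv[OF ch that] by (simp add: \<phi>_def)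
  define \<psi> where "\<psi> = inv_into (U \<times> U) (map_prod c c)"
  have inj2: "inj_on (map_prod c c) (U \<times> U)" using chart_inj[OF ch] by (auto simp: inj_on_def)
  have \<psi>: "\<psi> (c x, c y) = (x, y)" if "x \<in> U" "y \<in> U" for x y
    using inv_into_f_f[OF inj2, of "(x, y)"] that by (simp add: \<psi>_def)
  define \<Omega> where "\<Omega> = map_prod c c ` {z \<in> U \<times> U. fst z \<otimes>\<^bsub>G\<^esub> snd z \<in> U}"
  define \<mu> where "\<mu> = c \<circ> (\<lambda>(x, y). x \<otimes>\<^bsub>G\<^esub> y) \<circ> \<psi>"
  have "(U \<times> U, map_prod c c) \<in> prod_atlas A A" using Uc(1) by (force simp: prod_atlas_def)
  then have "smooth_on \<Omega> \<mu>"
    using sm Uc(1) unfolding smooth_map_def \<Omega>_def \<mu>_def \<psi>_def by (fastforce simp: case_prod_beta')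
  then have \<mu>d: "times_differentiable_on n \<Omega> \<mu>" for n by (simp add: smooth_on_def)
  have \<mu>: "\<mu> (c x, c y) = c (x \<otimes>\<^bsub>G\<^esub> y)" if "x \<in> U" "y \<in> U" for x y using \<psi>[OF that] by (simp add: \<mu>_def)
  \<comment> \<open>On \<open>P\<close> the square stays in the chart domain, so squaring has the
    coordinate expression \<open>sq\<close> there.\<close>
  define P where "P = {x \<in> U. x \<otimes>\<^bsub>G\<^esub> x \<in> U}"
  have Pop: "openin T P"
  proof -
    have "continuous_map T (prod_topology T T) (\<lambda>x. (x, x))"
      using continuous_map_id[of T] by (simp add: continuous_map_pairedI id_def)
    then have "continuous_map T T (\<lambda>x. x \<otimes>\<^bsub>G\<^esub> x)"
      using continuous_map_compose'[of "prod_topology T T" T "\<lambda>(x, y). x \<otimes>\<^bsub>G\<^esub> y" T "\<lambda>x. (x, x)"] sm by (simp add: smooth_map_def)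
    then have "openin T (U \<inter> {x \<in> topspace T. x \<otimes>\<^bsub>G\<^esub> x \<in> U})"
      using openin_continuous_map_preimage[OF _ chart_openin[OF ch]] chart_openin[OF ch] by auto
    moreover have "P = U \<inter> {x \<in> topspace T. x \<otimes>\<^bsub>G\<^esub> x \<in> U}" using Usub top by (auto simp: P_def)
    ultimately show ?thesis by simp
  qed
  have PU: "P \<subseteq> U" by (auto simp: P_def)
  have oP: "open (c ` P)" using chart_open[OF ch PU] Pop by simp
  define sq where "sq a = \<mu> (a, a)" for a
  have sq: "sq (c x) = c (x \<otimes>\<^bsub>G\<^esub> x)" if "x \<in> U" for x using \<mu>[OF that that] by (simp add: sq_def)
  have diag: "(\<lambda>a. (a, a)) ` (c ` P) \<subseteq> \<Omega>"
    by (force simp: \<Omega>_def P_def)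
  have lindiag: "bounded_linear (\<lambda>a::'f. (a, a))" by (intro bounded_linear_Pair bounded_linear_ident)
  have tdid: "times_differentiable_on n (c ` P) (\<lambda>a. a)" for n
  proof (cases n)
    case (Suc k)
    show ?thesis unfolding Suc
      by (rule times_differentiable_on_SucI[OF oP has_derivative_ident]) (rule times_differentiable_on_const)
  qed simp
  have sqd: "times_differentiable_on n (c ` P) sq" for n
    unfolding sq_def
    by (rule times_differentiable_on_compose[OF oP diag times_differentiable_on_linear[OF lindiag oP tdid] \<mu>d])
  define a0 where "a0 = c \<one>\<^bsub>G\<^esub>"
  have 1: "\<one>\<^bsub>G\<^esub> \<in> P" using Uc(2) by (simp add: P_def)
  then have a0P: "a0 \<in> c ` P" by (auto simp: a0_def)
  define D where "D = frechet_derivative \<mu> (at (a0, a0))"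
  have D: "(\<mu> has_derivative D) (at (a0, a0))"
    unfolding D_def
    by (rule times_differentiable_onD(1)[OF \<mu>d[of "Suc 0"] subsetD[OF diag imageI[OF a0P]]])
  \<comment> \<open>Multiplication by the identity is the identity map, which determines each
    partial derivative of \<open>\<mu>\<close>.\<close>
  have Dl: "D (v, 0) = v" for v
  proof -
    have "((\<lambda>a. (a, a0)) has_derivative (\<lambda>v. (v, 0))) (at a0)" by (auto intro!: derivative_eq_intros)
    from has_derivative_compose[OF this D]
    have "((\<lambda>a. \<mu> (a, a0)) has_derivative (\<lambda>v. D (v, 0))) (at a0)" by simp
    moreover have "((\<lambda>a. \<mu> (a, a0)) has_derivative (\<lambda>v. v)) (at a0)"
    proof (rule has_derivative_transform_within_open[OF has_derivative_ident chart_open_image[OF ch]])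
      show "a0 \<in> c ` U" using Uc by (simp add: a0_def)
      fix a assume "a \<in> c ` U"
      then show "a = \<mu> (a, a0)" using \<mu> Uc(2) Usub by (auto simp: a0_def)
    qed
    ultimately show ?thesis using has_derivative_unique by metis
  qed
  have Dr: "D (0, v) = v" for v
  proof -
    have "((\<lambda>a. (a0, a)) has_derivative (\<lambda>v. (0, v))) (at a0)" by (auto intro!: derivative_eq_intros)
    from has_derivative_compose[OF this D]
    have "((\<lambda>a. \<mu> (a0, a)) has_derivative (\<lambda>v. D (0, v))) (at a0)" by simp
    moreover have "((\<lambda>a. \<mu> (a0, a)) has_derivative (\<lambda>v. v)) (at a0)"
    proof (rule has_derivative_transform_within_open[OF has_derivative_ident chart_open_image[OF ch]])
      show "a0 \<in> c ` U" using Uc by (simp add: a0_def)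
      fix a assume "a \<in> c ` U"
      then show "a = \<mu> (a0, a)" using \<mu> Uc(2) Usub by (auto simp: a0_def)
    qed
    ultimately show ?thesis using has_derivative_unique by metis
  qed
  have "((\<lambda>a. (a, a)) has_derivative (\<lambda>v. (v, v))) (at a0)" by (auto intro!: derivative_eq_intros)
  from has_derivative_compose[OF this D]
  have "(sq has_derivative (\<lambda>v. D (v, v))) (at a0)" by (simp add: sq_def[abs_def])
  moreover have "D (v, v) = 2 *\<^sub>R v" for v
    using linear_add[OF has_derivative_linear[OF D], of "(v, 0)" "(0, v)"] Dl Dr by (simp add: scaleR_2)
  ultimately have Dsq: "(sq has_derivative (\<lambda>v. 2 *\<^sub>R v)) (at a0)" by simp
  \<comment> \<open>The inverse function theorem asks for a continuous family of bounded operators;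
    in finite dimension continuity may be checked on each basis direction.\<close>
  define F where "F x = Blinfun (frechet_derivative sq (at x))" for x
  have Fd: "(sq has_derivative frechet_derivative sq (at x)) (at x)" if "x \<in> c ` P" for x
    by (rule times_differentiable_onD(1)[OF sqd[of "Suc 0"] that])
  have Fap: "blinfun_apply (F x) = frechet_derivative sq (at x)" if "x \<in> c ` P" for x
    unfolding F_def using has_derivative_bounded_linear[OF Fd[OF that]] by (rule bounded_linear_Blinfun_apply)
  have Fc: "continuous_on (c ` P) F"
  proof (rule continuous_on_blinfun_componentwise)
    fix i :: 'f
    have "continuous_on (c ` P) (\<lambda>x. frechet_derivative sq (at x) i)" using sqd[of "Suc 0"] by simp
    then show "continuous_on (c ` P) (\<lambda>x. blinfun_apply (F x) i)"
      using Fap by (simp cong: continuous_on_cong)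
  qed
  have inv: "Blinfun (\<lambda>v::'f. (1/2) *\<^sub>R v) o\<^sub>L F a0 = id_blinfun"
  proof (rule blinfun_eqI)
    fix v
    have "frechet_derivative sq (at a0) = (\<lambda>v. 2 *\<^sub>R v)" using frechet_derivative_at[OF Dsq] by simp
    then show "blinfun_apply (Blinfun (\<lambda>v::'f. (1/2) *\<^sub>R v) o\<^sub>L F a0) v = blinfun_apply id_blinfun v"
      using Fap[OF a0P] by (simp add: bounded_linear_Blinfun_apply bounded_linear_scaleR_right)
  qed
  obtain U' V g g' where UV: "open U'" "U' \<subseteq> c ` P" "a0 \<in> U'" "open V" "homeomorphism U' V sq g"
    using inverse_function_theorem[OF oP, of sq F a0 "Blinfun (\<lambda>v::'f. (1/2) *\<^sub>R v)"] Fd Fap Fc a0P inv by metis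
  define N0 where "N0 = {x \<in> U. c x \<in> U'}"
  have cN0: "c ` N0 = U'" using UV(2) PU by (auto simp: N0_def)
  have N0P: "N0 \<subseteq> P"
  proof
    fix x assume "x \<in> N0"
    then have x: "x \<in> U" "c x \<in> U'" by (auto simp: N0_def)
    then obtain y where "y \<in> P" "c x = c y" using UV(2) by auto
    then show "x \<in> P" using x chart_inj[OF ch] PU by (auto dest: inj_onD)
  qed
  have opsq: "open (sq ` Q)" if "open Q" "Q \<subseteq> U'" for Q
  proof -
    have "openin (top_of_set V) (sq ` Q)"
      using homeomorphism_imp_open_map[OF UV(5)] that UV(1) by (simp add: openin_open_eq)
    then show ?thesis using UV(4) by (simp add: openin_open_eq)
  qed
  show thesis
  proof (rule that[of N0])
    show N0: "openin T N0" using chart_open[OF ch, of N0] cN0 UV(1) by (auto simp: N0_def)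
    show "\<one>\<^bsub>G\<^esub> \<in> N0" using Uc(2) UV(3) by (simp add: N0_def a0_def)
    show "inj_on (\<lambda>x. x \<otimes>\<^bsub>G\<^esub> x) N0"
    proof (rule inj_onI)
      fix x y assume xy: "x \<in> N0" "y \<in> N0" "x \<otimes>\<^bsub>G\<^esub> x = y \<otimes>\<^bsub>G\<^esub> y"
      then have "sq (c x) = sq (c y)" using sq by (auto simp: N0_def)
      moreover have "c x \<in> U'" "c y \<in> U'" using xy by (auto simp: N0_def)
      ultimately have "c x = c y" using UV(5) by (metis homeomorphism_apply1)
      then show "x = y" using xy chart_inj[OF ch] by (auto simp: N0_def dest: inj_onD)
    qed
    fix N assume N: "openin T N" "N \<subseteq> N0"
    have NU: "N \<subseteq> U" using N by (auto simp: N0_def)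
    have "(\<lambda>x. x \<otimes>\<^bsub>G\<^esub> x) ` N \<subseteq> U" using N N0P by (auto simp: P_def)
    moreover have "c ` ((\<lambda>x. x \<otimes>\<^bsub>G\<^esub> x) ` N) = sq ` (c ` N)" using sq NU by (force simp: image_image)
    moreover have "open (sq ` (c ` N))"
      using N chart_open[OF ch NU] cN0 by (intro opsq) auto
    ultimately show "openin T ((\<lambda>x. x \<otimes>\<^bsub>G\<^esub> x) ` N)" using chart_open[OF ch] by metis
  qed
qed

context compact_group
begin

text \<open>With \<open>b\<close> the local square root of \<open>a = \<theta>(g)\<^sup>-\<^sup>1 g\<close>, uniqueness of square roots gives \<open>\<theta>(b) = b\<^sup>-\<^sup>1\<close>;
  then \<open>h = g b\<^sup>-\<^sup>1\<close> is fixed by \<open>\<theta>\<close> and close to the identity.\<close>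

lemma local_cartan_decomposition:
  assumes hom: "\<theta> \<in> hom G G" and cont: "continuous_map T T \<theta>"
    and invol: "\<And>g. g \<in> carrier G \<Longrightarrow> \<theta> (\<theta> g) = g"
    and N0: "openin T N0" "\<one> \<in> N0" "inj_on (\<lambda>x. x \<otimes> x) N0"
    and sq: "\<And>N. openin T N \<Longrightarrow> N \<subseteq> N0 \<Longrightarrow> openin T ((\<lambda>x. x \<otimes> x) ` N)"
    and W: "openin T W" "\<one> \<in> W" "\<And>h. h \<in> W \<Longrightarrow> \<theta> h = h \<Longrightarrow> h \<in> K"
  shows "\<exists>U. openin T U \<and> \<one> \<in> U \<and> (\<forall>g\<in>U. \<exists>h\<in>K. \<theta> g = h \<otimes> inv g \<otimes> h)"
proof -
  have th1: "\<theta> \<one> = \<one>" by (rule hom_one[OF hom group group])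
  have cl: "\<theta> g \<in> carrier G" if "g \<in> carrier G" for g using hom that by (auto simp: hom_def)
  have mul: "\<theta> (g \<otimes> h) = \<theta> g \<otimes> \<theta> h" if "g \<in> carrier G" "h \<in> carrier G" for g h
    using hom that by (auto simp: hom_def)
  have thinv: "\<theta> (inv g) = inv (\<theta> g)" if "g \<in> carrier G" for g
    using group_hom.hom_inv[of G G \<theta>] hom that group by (simp add: group_hom_def group_hom_axioms_def)
  have "openin (prod_topology T T) {z \<in> topspace (prod_topology T T). fst z \<otimes> inv (snd z) \<in> W}"
    by (rule openin_continuous_map_preimage[OF _ W(1)]) (intro cont_group)
  moreover have "(\<one>, \<one>) \<in> {z \<in> topspace (prod_topology T T). fst z \<otimes> inv (snd z) \<in> W}"
    using W(2) topspace by simp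
  ultimately have "\<exists>W1 W2. openin T W1 \<and> openin T W2 \<and> \<one> \<in> W1 \<and> \<one> \<in> W2 \<and>
      W1 \<times> W2 \<subseteq> {z \<in> topspace (prod_topology T T). fst z \<otimes> inv (snd z) \<in> W}"
    unfolding openin_prod_topology_alt by blast
  then obtain W1 W2 where W12: "openin T W1" "openin T W2" "\<one> \<in> W1" "\<one> \<in> W2"
    and sub: "W1 \<times> W2 \<subseteq> {z \<in> topspace (prod_topology T T). fst z \<otimes> inv (snd z) \<in> W}" by blast
  have W12': "g \<otimes> inv b \<in> W" if "g \<in> W1" "b \<in> W2" for g b using subsetD[OF sub, of "(g, b)"] that by simp
  \<comment> \<open>Room for the square root \<open>b\<close>: its image under
    \<open>\<theta>\<close> and its inverse must lie in \<open>N0\<close>, where square roots are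
    unique, and \<open>b\<close> must lie in \<open>W2\<close> to keep
    \<open>g \<otimes> inv b\<close> in \<open>W\<close>.\<close>
  define N where "N = N0 \<inter> W2 \<inter> {x \<in> topspace T. \<theta> x \<in> N0} \<inter> {x \<in> topspace T. inv x \<in> N0}"
  have N: "openin T N"
    unfolding N_def
    by (intro openin_Int N0(1) W12(2) openin_continuous_map_preimage[OF cont] openin_continuous_map_preimage[OF continuous_inv])
  have N1: "\<one> \<in> N" using N0(2) W12 th1 topspace by (simp add: N_def)
  have NN0: "N \<subseteq> N0" by (auto simp: N_def)
  define U where "U = W1 \<inter> {g \<in> topspace T. inv (\<theta> g) \<otimes> g \<in> (\<lambda>x. x \<otimes> x) ` N}"
  have "continuous_map T T (\<lambda>g. inv (\<theta> g) \<otimes> g)" by (intro cont_group cont)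
  then have "openin T U" unfolding U_def
    by (intro openin_Int W12(1) openin_continuous_map_preimage[OF _ sq[OF N NN0]])
  moreover have "\<one> \<in> U"
    unfolding U_def using W12(3) topspace th1 N1 by (auto intro!: image_eqI[of _ _ \<one>])
  moreover have "\<exists>h\<in>K. \<theta> g = h \<otimes> inv g \<otimes> h" if gU: "g \<in> U" for g
  proof -
    have g: "g \<in> carrier G" "g \<in> W1" using gU topspace by (auto simp: U_def)
    obtain b where b: "b \<in> N" "inv (\<theta> g) \<otimes> g = b \<otimes> b" using gU by (auto simp: U_def)
    have bc: "b \<in> carrier G" using b(1) topspace by (auto simp: N_def)
    have tg: "\<theta> g \<in> carrier G" using cl g by simp
    have gtb: "g = \<theta> g \<otimes> (b \<otimes> b)" using g tg by (simp flip: b(2) m_assoc)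
    \<comment> \<open>The involution maps \<theta>(g)^(-1) g to its inverse, so
      \<open>\<theta> b\<close> and \<open>inv b\<close> have the same square.\<close>
    have "\<theta> b \<otimes> \<theta> b = \<theta> (inv (\<theta> g) \<otimes> g)" using mul[OF bc bc] b(2) by simp
    also have "\<dots> = inv g \<otimes> \<theta> g" using mul[of "inv (\<theta> g)" g] thinv[OF tg] invol g tg by simp
    also have "\<dots> = inv (inv (\<theta> g) \<otimes> g)" using g tg by (simp add: inv_mult_group)
    also have "\<dots> = inv b \<otimes> inv b" unfolding b(2) using bc by (simp add: inv_mult_group)
    finally have "\<theta> b \<otimes> \<theta> b = inv b \<otimes> inv b" .
    then have tb: "\<theta> b = inv b" by (rule inj_onD[OF N0(3)]) (use b(1) in \<open>auto simp: N_def\<close>)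
    define h where "h = g \<otimes> inv b"
    have hc: "h \<in> carrier G" using g bc by (simp add: h_def)
    have htb: "h = \<theta> g \<otimes> b"
    proof -
      have "h = \<theta> g \<otimes> (b \<otimes> b) \<otimes> inv b" unfolding h_def using gtb by simp
      then show ?thesis using tg bc by (simp add: m_assoc)
    qed
    have "\<theta> h = \<theta> g \<otimes> b" unfolding h_def using mul[OF g(1), of "inv b"] thinv[OF bc] tb bc by simp
    then have "\<theta> h = h" using htb by simp
    moreover have "h \<in> W" unfolding h_def using W12' g b by (auto simp: N_def)
    ultimately have "h \<in> K" using W(3) by blast
    moreover have "\<theta> g = h \<otimes> inv g \<otimes> h"
    proof -
      have "inv g \<otimes> h = inv b" unfolding h_def using g bc by (simp flip: m_assoc)
      then have "h \<otimes> inv g \<otimes> h = h \<otimes> inv b" using g hc by (simp add: m_assoc)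
      also have "\<dots> = \<theta> g" unfolding htb using tg bc by (simp add: m_assoc)
      finally show ?thesis by simp
    qed
    ultimately show ?thesis by blast
  qed
  ultimately show ?thesis by blast
qed

end

section \<open>Characteristic exponents\<close>

text \<open>A single time would leave the periods of the exponential open. At t = 1 / |c' - c| the
  difference of the exponents has modulus 1, too small for a non-zero period, whose modulus is at
  least 2 pi.\<close>

lemma exp_all_eq_imp_eq:
  fixes c c' :: complex
  assumes "\<And>t. t \<ge> 0 \<Longrightarrow> exp (- of_real t * c) = exp (- of_real t * c')"
  shows "c = c'"
proof (rule ccontr)
  assume ne: "c \<noteq> c'"
  define z where "z = c' - c"
  define t where "t = 1 / cmod z"
  define w where "w = of_real t * z"
  have z: "z \<noteq> 0" using ne by (simp add: z_def)
  have w1: "cmod w = 1" using z by (simp add: w_def t_def norm_divide)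
  have "exp w = exp (- of_real t * c) * exp (of_real t * c')"
    by (simp add: w_def z_def algebra_simps flip: exp_add)
  also have "\<dots> = 1" using assms[of t] by (simp add: t_def flip: exp_add)
  finally obtain n :: int where n: "Re w = 0" "Im w = of_int (2 * n) * pi" unfolding exp_eq_1 by blast
  have "\<bar>Im w\<bar> = 1" using w1 n(1) by (simp add: cmod_def)
  then have e: "2 * \<bar>real_of_int n\<bar> * pi = 1" using n(2) by (simp add: abs_mult)
  then have "n \<noteq> 0" by auto
  then have "1 \<le> \<bar>real_of_int n\<bar>" by linarith
  then have "2 * pi \<le> 2 * \<bar>real_of_int n\<bar> * pi" by simp
  then show False using e pi_gt3 by simp
qed

text \<open>Near \<open>0\<close> the values have positive real part, so \<open>p (\<delta> / 2\<^sup>n)\<close> is the principal \<open>2\<^sup>n\<close>-th root of \<open>p \<delta>\<close>; this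
  fixes \<open>p\<close> on a dense set.\<close>

lemma exponential_semigroup:
  fixes p :: "real \<Rightarrow> complex"
  assumes mul: "\<And>s t. s \<ge> 0 \<Longrightarrow> t \<ge> 0 \<Longrightarrow> p (s + t) = p s * p t"
    and p0: "p 0 = 1" and lim: "(p \<longlongrightarrow> 1) (at_right 0)"
  shows "\<exists>c. \<forall>t\<ge>0. p t = exp (- of_real t * c)"
proof -
  obtain \<delta>0 where \<delta>0: "\<delta>0 > 0" "\<And>t. 0 < t \<Longrightarrow> t < \<delta>0 \<Longrightarrow> dist (p t) 1 < 1 / 2"
    using tendstoD[OF lim, of "1/2"] unfolding eventually_at by (force simp: dist_real_def)
  define \<delta> where "\<delta> = \<delta>0 / 2"
  have \<delta>: "\<delta> > 0" using \<delta>0 by (simp add: \<delta>_def)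
  have Rep: "Re (p t) > 0" if "0 < t" "t \<le> \<delta>" for t
  proof -
    have "cmod (p t - 1) < 1 / 2" using \<delta>0(2)[of t] that \<delta>0(1) by (simp add: \<delta>_def dist_norm)
    then have "\<bar>Re (p t - 1)\<bar> < 1 / 2" using abs_Re_le_cmod[of "p t - 1"] by linarith
    then show ?thesis by (simp add: abs_if split: if_splits)
  qed
  define z where "z = Ln (p \<delta>)"
  have pd: "p \<delta> \<noteq> 0" using Rep[of \<delta>] \<delta> by auto
  have Imz: "\<bar>Im z\<bar> < pi / 2" unfolding z_def using Re_Ln_pos_lt[OF pd] Rep[of \<delta>] \<delta> by simp
  have dy: "p (\<delta> / 2 ^ n) = exp (z / 2 ^ n)" for n
  proof (induction n)
    case 0
    show ?case using pd by (simp add: z_def)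
  next
    case (Suc n)
    let ?y = "exp (z / 2 ^ Suc n)"
    have "p (\<delta> / 2 ^ Suc n) * p (\<delta> / 2 ^ Suc n) = p (\<delta> / 2 ^ n)"
      using \<delta> by (simp flip: mul)
    also have "\<dots> = ?y * ?y" unfolding Suc.IH by (simp flip: exp_add)
    finally have "(p (\<delta> / 2 ^ Suc n) - ?y) * (p (\<delta> / 2 ^ Suc n) + ?y) = 0" by (simp add: algebra_simps)
    \<comment> \<open>This excludes the other square root: both numbers have positive real part, the
      argument of \<open>?y\<close> being less than pi / 2 in absolute value.\<close>
    moreover have "p (\<delta> / 2 ^ Suc n) + ?y \<noteq> 0"
    proof -
      have "(1::real) \<le> 2 ^ Suc n" by (rule one_le_power) simp
      then have "\<bar>Im z\<bar> / 2 ^ Suc n \<le> \<bar>Im z\<bar>" and le: "\<delta> / 2 ^ Suc n \<le> \<delta>"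
        using \<delta> by (simp_all add: divide_le_eq mult_le_cancel_left1)
      moreover have "Im (z / 2 ^ Suc n) = Im z / 2 ^ Suc n"
        using Im_divide_of_real[of z "2 ^ Suc n"] by simp
      ultimately have "\<bar>Im (z / 2 ^ Suc n)\<bar> < pi / 2" using Imz by (simp add: abs_divide)
      then have "cos (Im (z / 2 ^ Suc n)) > 0" by (intro cos_gt_zero_pi) linarith+
      then have "Re ?y > 0" unfolding Re_exp by simp
      moreover have "Re (p (\<delta> / 2 ^ Suc n)) > 0" using Rep le \<delta> by simp
      ultimately show ?thesis by (metis add_pos_pos complex.sel(1) less_irrefl plus_complex.sel(1) zero_complex.sel(1))
    qed
    ultimately show ?case by simp
  qed
  have mult: "p (of_nat k * s) = p s ^ k" if "s \<ge> 0" for k s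
    by (induction k) (use that in \<open>auto simp: p0 mul algebra_simps\<close>)
  define c where "c = - z / of_real \<delta>"
  have grid: "p (of_nat k * (\<delta> / 2 ^ n)) = exp (- of_real (of_nat k * (\<delta> / 2 ^ n)) * c)" for k n
  proof -
    have "p (of_nat k * (\<delta> / 2 ^ n)) = exp (z / 2 ^ n) ^ k" using mult[of "\<delta> / 2 ^ n"] \<delta> dy by simp
    also have "\<dots> = exp (of_nat k * (z / 2 ^ n))" by (rule exp_of_nat_mult[symmetric])
    also have "of_nat k * (z / 2 ^ n) = - of_real (of_nat k * (\<delta> / 2 ^ n)) * c" using \<delta> by (simp add: c_def)
    finally show ?thesis .
  qed
  have "p t = exp (- of_real t * c)" if t: "t \<ge> 0" for t
  proof -
    \<comment> \<open>Rounding up keeps the grid points at or above \<open>t\<close>, since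
      continuity of \<open>p\<close> is given only from the right at 0.\<close>
    define k where "k n = nat \<lceil>t / (\<delta> / 2 ^ n)\<rceil>" for n :: nat
    define u where "u n = real (k n) * (\<delta> / 2 ^ n)" for n
    have h: "\<delta> / 2 ^ n > 0" for n :: nat using \<delta> by simp
    have kb: "t / (\<delta> / 2 ^ n) \<le> real (k n)" "real (k n) \<le> t / (\<delta> / 2 ^ n) + 1" for n
    proof -
      have "0 \<le> t / (\<delta> / 2 ^ n)" using t h[of n] by (intro divide_nonneg_pos)
      then show "t / (\<delta> / 2 ^ n) \<le> real (k n)" "real (k n) \<le> t / (\<delta> / 2 ^ n) + 1" unfolding k_def by linarith+
    qed
    have ub: "t \<le> u n" "u n \<le> t + \<delta> / 2 ^ n" for n
    proof -
      show "t \<le> u n" unfolding u_def using kb(1)[of n] by (simp only: pos_divide_le_eq[OF h])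
      have "u n \<le> (t / (\<delta> / 2 ^ n) + 1) * (\<delta> / 2 ^ n)"
        unfolding u_def by (rule mult_right_mono[OF kb(2) less_imp_le[OF h]])
      also have "\<dots> = t + \<delta> / 2 ^ n" using \<delta> by (simp add: field_simps)
      finally show "u n \<le> t + \<delta> / 2 ^ n" .
    qed
    have z0: "(\<lambda>n. \<delta> / 2 ^ n) \<longlonglongrightarrow> 0"
      using tendsto_mult_right_zero[OF LIMSEQ_power_zero[of "1 / 2 :: real"], of \<delta>] by (simp add: power_one_over)
    have dl: "(\<lambda>n. u n - t) \<longlonglongrightarrow> 0"
      by (rule real_tendsto_sandwich[OF _ _ tendsto_const z0]) (use ub in \<open>auto simp: algebra_simps\<close>)
    then have ul: "u \<longlonglongrightarrow> t" by (simp add: LIM_zero_iff)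
    have "(\<lambda>n. p (u n - t)) \<longlonglongrightarrow> 1"
      unfolding tendsto_iff
    proof (intro allI impI)
      fix e :: real assume e: "e > 0"
      obtain d where d: "d > 0" "\<And>s. 0 < s \<Longrightarrow> s < d \<Longrightarrow> dist (p s) 1 < e"
        using tendstoD[OF lim e] unfolding eventually_at by (force simp: dist_real_def)
      have "\<forall>\<^sub>F n in sequentially. u n - t < d" using order_tendstoD(2)[OF dl d(1)] .
      then show "\<forall>\<^sub>F n in sequentially. dist (p (u n - t)) 1 < e"
      proof eventually_elim
        case (elim n)
        show ?case
        proof (cases "u n - t = 0")
          case False
          then show ?thesis using d(2) elim ub(1)[of n] by simp
        qed (use p0 e in simp)
      qed
    qed
    then have "(\<lambda>n. p t * p (u n - t)) \<longlonglongrightarrow> p t * 1" by (intro tendsto_intros)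
    moreover have "p t * p (u n - t) = exp (- of_real (u n) * c)" for n
      using mul[of t "u n - t"] t ub(1)[of n] grid[of "k n" n] by (simp add: u_def)
    moreover have "(\<lambda>n. exp (- of_real (u n) * c)) \<longlonglongrightarrow> exp (- of_real t * c)"
      by (intro tendsto_intros ul)
    ultimately show ?thesis using LIMSEQ_unique by fastforce
  qed
  then show ?thesis by blast
qed

section \<open>Spherical functions and bi-invariant semigroups\<close>

text \<open>Of the geometry only one consequence is kept: in an irreducible representation two
  orthogonal \<open>K\<close>-fixed vectors cannot both be non-zero, so the fixed vectors form at
  most a line.\<close>

locale gelfand_pair = compact_group +
  fixes K :: "'a set" and mK :: "'a measure" and \<mu> :: "real \<Rightarrow> 'a measure"
  assumes K: "subgroup K G"
    and K_fixed_proportional: "\<And>\<pi> v w. irreducible_unitary_rep G T \<pi> \<Longrightarrow> v \<in> carrier_vec (rep_dim G \<pi>) \<Longrightarrow>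
      K_fixed K \<pi> v \<Longrightarrow> w \<in> carrier_vec (rep_dim G \<pi>) \<Longrightarrow> K_fixed K \<pi> w \<Longrightarrow> v \<bullet>c w = 0 \<Longrightarrow>
      w \<noteq> 0\<^sub>v (rep_dim G \<pi>) \<Longrightarrow> v = 0\<^sub>v (rep_dim G \<pi>)"
    and haar_K: "normalised_haar_measure (G\<lparr>carrier := K\<rparr>) (subtopology T K) mK"
    and semigroup: "K_biinvariant_semigroup G T K mK \<mu>"
begin

lemma K_sub: "k \<in> K \<Longrightarrow> k \<in> carrier G" and K_inv: "k \<in> K \<Longrightarrow> inv k \<in> K"
  using K by (auto simp: subgroup_def)

lemma borel_prob_\<mu>: "t \<ge> 0 \<Longrightarrow> borel_prob (\<mu> t)"
  using semigroup by (auto simp: K_biinvariant_semigroup_def convolution_semigroup_def borel_prob_def)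

lemma left_K_invariant:
  assumes f: "cf f" and t: "t \<ge> 0" and k: "k \<in> K"
  shows "(\<integral>x. f (k \<otimes> x) \<partial>\<mu> t) = (\<integral>x. f x \<partial>\<mu> t)"
  using semigroup t k
  by (intro integral_distr_left[OF borel_prob_\<mu>[OF t] _ f] cont_group K_sub) (auto simp: K_biinvariant_semigroup_def)

lemma right_K_invariant:
  assumes f: "cf f" and t: "t \<ge> 0" and k: "k \<in> K"
  shows "(\<integral>x. f (x \<otimes> k) \<partial>\<mu> t) = (\<integral>x. f x \<partial>\<mu> t)"
  using semigroup t k
  by (intro integral_distr_left[OF borel_prob_\<mu>[OF t] _ f] cont_group K_sub) (auto simp: K_biinvariant_semigroup_def)

lemma integral_convolution:
  assumes f: "cf f" and s: "s \<ge> 0" and t: "t \<ge> 0"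
  shows "(\<integral>x. f x \<partial>\<mu> (s + t)) = (\<integral>x. (\<integral>y. f (x \<otimes> y) \<partial>\<mu> t) \<partial>\<mu> s)"
proof -
  have M: "borel_prob (\<mu> s)" and N: "borel_prob (\<mu> t)" using borel_prob_\<mu> s t by auto
  have sets: "sets (\<mu> s \<Otimes>\<^sub>M \<mu> t) = sets (borel_of_topology T \<Otimes>\<^sub>M borel_of_topology T)"
    using M N by (intro sets_pair_measure_cong) (auto simp: borel_prob_def)
  have meas: "(\<lambda>(x, y). x \<otimes> y) \<in> \<mu> s \<Otimes>\<^sub>M \<mu> t \<rightarrow>\<^sub>M borel_of_topology T"
    using continuous_map_prod_measurable[OF second_countable second_countable continuous_mult]
      measurable_cong_sets[OF sets refl] by blast
  have "\<mu> (s + t) = convolve G T (\<mu> s) (\<mu> t)"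
    using semigroup s t by (auto simp: K_biinvariant_semigroup_def convolution_semigroup_def)
  then have "(\<integral>x. f x \<partial>\<mu> (s + t)) = (\<integral>z. f (case z of (x, y) \<Rightarrow> x \<otimes> y) \<partial>(\<mu> s \<Otimes>\<^sub>M \<mu> t))"
    unfolding convolve_def using integral_distr[OF meas continuous_map_borel_measurable[OF f]] by simp
  also have "\<dots> = (\<integral>x. (\<integral>y. f (x \<otimes> y) \<partial>\<mu> t) \<partial>\<mu> s)"
    using integral_pair[OF M N continuous_map_compose'[OF f continuous_mult]] by simp
  finally show ?thesis .
qed

section \<open>Averages of an irreducible representation over the semigroup\<close>

context
  fixes \<pi> :: "'a rep" and d :: nat
  assumes irr: "irreducible_unitary_rep G T \<pi>" and d: "d = rep_dim G \<pi>"
begin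

lemma rep: "unitary_rep G T \<pi>" by (rule irrepD(1)[OF irr])

lemma coef_cf: "v \<in> carrier_vec d \<Longrightarrow> w \<in> carrier_vec d \<Longrightarrow> cf (coef \<pi> v w)"
  using cf_coef[OF rep] d by simp

lemma coef_translate_left:
  assumes "v \<in> carrier_vec d" "w \<in> carrier_vec d" "g \<in> carrier G" "h \<in> carrier G"
  shows "coef \<pi> v w (g \<otimes> h) = coef \<pi> v (\<pi> (inv g) *\<^sub>v w) h"
  unfolding coef_def using assms d rep_mult_vec[OF rep] rep_cscalar[OF rep] rep_vec_carrier[OF rep] by simp

lemma coef_translate_right:
  assumes "v \<in> carrier_vec d" "w \<in> carrier_vec d" "g \<in> carrier G" "h \<in> carrier G"
  shows "coef \<pi> v w (g \<otimes> h) = coef \<pi> (\<pi> h *\<^sub>v v) w g"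
  unfolding coef_def using assms d rep_mult_vec[OF rep] by simp

text \<open>\<open>a\<close> is the integral of \<open>\<pi> g *\<^sub>v v\<close>, defined through
  its coordinates; invariance of the measure under left translation by \<open>K\<close> makes it
  fixed.\<close>

lemma averaged_vector:
  assumes t: "t \<ge> 0" and v: "v \<in> carrier_vec d"
  obtains a where "a \<in> carrier_vec d" "K_fixed K \<pi> a"
    "\<And>w. w \<in> carrier_vec d \<Longrightarrow> (\<integral>g. coef \<pi> v w g \<partial>\<mu> t) = a \<bullet>c w"
proof -
  note M = borel_prob_\<mu>[OF t]
  define a where "a = Matrix.vec d (\<lambda>i. \<integral>g. coef \<pi> v (unit_vec d i) g \<partial>\<mu> t)"
  have a: "a \<in> carrier_vec d" by (simp add: a_def)
  have ip: "(\<integral>g. coef \<pi> v w g \<partial>\<mu> t) = a \<bullet>c w" if w: "w \<in> carrier_vec d" for w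
  proof -
    have "(\<integral>g. coef \<pi> v w g \<partial>\<mu> t) = (\<integral>g. (\<Sum>i<d. cnj (w $ i) * coef \<pi> v (unit_vec d i) g) \<partial>\<mu> t)"
    proof (rule integral_cong'[OF M])
      fix g assume g: "g \<in> carrier G"
      have "\<pi> g *\<^sub>v v \<in> carrier_vec d" using rep_vec_carrier[OF rep g] v d by simp
      then show "coef \<pi> v w g = (\<Sum>i<d. cnj (w $ i) * coef \<pi> v (unit_vec d i) g)"
        unfolding coef_def cscalar_sum[OF w] by (intro sum.cong) (auto simp: cscalar_unit_vec)
    qed
    also have "\<dots> = (\<Sum>i<d. \<integral>g. cnj (w $ i) * coef \<pi> v (unit_vec d i) g \<partial>\<mu> t)"
      by (intro Bochner_Integration.integral_sum integrable_cf[OF M] cont_intros coef_cf v) auto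
    also have "\<dots> = a \<bullet>c w" unfolding cscalar_sum[OF w] by (simp add: a_def mult.commute)
    finally show ?thesis .
  qed
  have "K_fixed K \<pi> a"
    unfolding K_fixed_def
  proof
    fix k assume k: "k \<in> K"
    have kc: "k \<in> carrier G" "inv k \<in> K" using k K_sub K_inv by auto
    have ka: "\<pi> k *\<^sub>v a \<in> carrier_vec d" using rep_vec_carrier[OF rep kc(1)] a d by simp
    have "(\<pi> k *\<^sub>v a) $ i = a $ i" if i: "i < d" for i
    proof -
      let ?w = "\<pi> (inv k) *\<^sub>v unit_vec d i"
      have wc: "?w \<in> carrier_vec d" using rep_vec_carrier[OF rep, of "inv k"] kc d by simp
      have "(\<pi> k *\<^sub>v a) \<bullet>c unit_vec d i = a \<bullet>c ?w" using rep_cscalar[OF rep kc(1)] a d by simp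
      also have "\<dots> = (\<integral>g. coef \<pi> v (unit_vec d i) (k \<otimes> g) \<partial>\<mu> t)"
        unfolding ip[OF wc, symmetric]
        using kc v by (intro integral_cong'[OF M] coef_translate_left[symmetric]) auto
      also have "\<dots> = a \<bullet>c unit_vec d i"
        unfolding left_K_invariant[OF coef_cf[OF v unit_vec_carrier] t k] by (rule ip) simp
      finally show ?thesis using ka a i by (simp add: cscalar_unit_vec)
    qed
    then show "\<pi> k *\<^sub>v a = a" using carrier_vecD[OF ka] carrier_vecD[OF a] by (intro eq_vecI) simp_all
  qed
  with a ip that show thesis by blast
qed

text \<open>The adjoint counterpart: \<open>a\<close> is the adjoint of the averaged operator
  applied to \<open>w\<close>, and invariance under right translation by \<open>K\<close> makes it
  fixed.\<close>

lemma averaged_covector: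
  assumes t: "t \<ge> 0" and w: "w \<in> carrier_vec d"
  obtains a where "a \<in> carrier_vec d" "K_fixed K \<pi> a"
    "\<And>v. v \<in> carrier_vec d \<Longrightarrow> (\<integral>g. coef \<pi> v w g \<partial>\<mu> t) = v \<bullet>c a"
proof -
  note M = borel_prob_\<mu>[OF t]
  define a where "a = Matrix.vec d (\<lambda>i. cnj (\<integral>g. coef \<pi> (unit_vec d i) w g \<partial>\<mu> t))"
  have a: "a \<in> carrier_vec d" by (simp add: a_def)
  have expand: "coef \<pi> v w g = (\<Sum>i<d. v $ i * coef \<pi> (unit_vec d i) w g)"
    if g: "g \<in> carrier G" and v: "v \<in> carrier_vec d" for g v
  proof -
    have pc: "\<pi> g \<in> carrier_mat d d" using rep_carrier[OF rep g] d by simp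
    have pg: "\<pi> (inv g) *\<^sub>v w \<in> carrier_vec d" using rep_vec_carrier[OF rep, of "inv g"] g w d by simp
    have c: "coef \<pi> u w g = u \<bullet>c (\<pi> (inv g) *\<^sub>v w)" if "u \<in> carrier_vec d" for u
      unfolding coef_def using rep_cscalar[OF rep g] that w d by simp
    have u: "unit_vec d i \<bullet>c (\<pi> (inv g) *\<^sub>v w) = cnj ((\<pi> (inv g) *\<^sub>v w) $ i)" if "i < d" for i
      using cscalar_commute[OF pg unit_vec_carrier, of i] cscalar_unit_vec[OF pg that] by simp
    show ?thesis unfolding c[OF v] c[OF unit_vec_carrier] cscalar_sum[OF pg, of v]
      by (intro sum.cong) (auto simp: u)
  qed
  have ip: "(\<integral>g. coef \<pi> v w g \<partial>\<mu> t) = v \<bullet>c a" if v: "v \<in> carrier_vec d" for v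
  proof -
    have "(\<integral>g. coef \<pi> v w g \<partial>\<mu> t) = (\<integral>g. (\<Sum>i<d. v $ i * coef \<pi> (unit_vec d i) w g) \<partial>\<mu> t)"
      by (rule integral_cong'[OF M expand[OF _ v]])
    also have "\<dots> = (\<Sum>i<d. \<integral>g. v $ i * coef \<pi> (unit_vec d i) w g \<partial>\<mu> t)"
      by (intro Bochner_Integration.integral_sum integrable_cf[OF M] cont_intros coef_cf w) auto
    also have "\<dots> = v \<bullet>c a" unfolding cscalar_sum[OF a] by (simp add: a_def)
    finally show ?thesis .
  qed
  have "K_fixed K \<pi> a"
    unfolding K_fixed_def
  proof
    fix k assume k: "k \<in> K"
    have kc: "k \<in> carrier G" "inv k \<in> K" "inv k \<in> carrier G" using k K_sub K_inv by auto
    have ka: "\<pi> k *\<^sub>v a \<in> carrier_vec d" using rep_vec_carrier[OF rep kc(1)] a d by simp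
    have "v \<bullet>c (\<pi> k *\<^sub>v a) = v \<bullet>c a" if v: "v \<in> carrier_vec d" for v
    proof -
      have vc: "\<pi> (inv k) *\<^sub>v v \<in> carrier_vec d" using rep_vec_carrier[OF rep kc(3)] v d by simp
      have "v \<bullet>c (\<pi> k *\<^sub>v a) = (\<pi> (inv k) *\<^sub>v v) \<bullet>c a"
        using rep_cscalar[OF rep kc(3), of v a] v a d kc by simp
      also have "\<dots> = (\<integral>g. coef \<pi> v w (g \<otimes> inv k) \<partial>\<mu> t)"
        unfolding ip[OF vc, symmetric]
        using kc v w by (intro integral_cong'[OF M] coef_translate_right[symmetric]) auto
      also have "\<dots> = v \<bullet>c a"
        unfolding right_K_invariant[OF coef_cf[OF v w] t kc(2)] by (rule ip[OF v])
      finally show ?thesis .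
    qed
    then have "cnj ((\<pi> k *\<^sub>v a) $ i) = cnj (a $ i)" if "i < d" for i
      using cscalar_commute[OF ka unit_vec_carrier, of i] cscalar_unit_vec[OF ka that]
        cscalar_commute[OF a unit_vec_carrier, of i] cscalar_unit_vec[OF a that] by simp
    then show "\<pi> k *\<^sub>v a = a" using carrier_vecD[OF ka] carrier_vecD[OF a]
      by (intro eq_vecI) (simp_all only: complex_cnj_cancel_iff)
  qed
  with a ip that show thesis by blast
qed

lemma integral_coef_nonspherical:
  assumes no: "\<And>v. v \<in> carrier_vec d \<Longrightarrow> K_fixed K \<pi> v \<Longrightarrow> v = 0\<^sub>v d"
    and t: "t \<ge> 0" and v: "v \<in> carrier_vec d" and w: "w \<in> carrier_vec d"
  shows "(\<integral>g. coef \<pi> v w g \<partial>\<mu> t) = 0"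
proof -
  obtain a where a: "a \<in> carrier_vec d" "K_fixed K \<pi> a" "\<And>w. w \<in> carrier_vec d \<Longrightarrow> (\<integral>g. coef \<pi> v w g \<partial>\<mu> t) = a \<bullet>c w"
    using averaged_vector[OF t v] by metis
  have "a = 0\<^sub>v d" by (rule no[OF a(1,2)])
  then show ?thesis unfolding a(3)[OF w] cscalar_sum[OF w] by simp
qed

context
  fixes u :: "complex Matrix.vec"
  assumes u: "u \<in> carrier_vec d" "K_fixed K \<pi> u" "u \<bullet>c u = 1"
begin

text \<open>Subtracting the projection onto \<open>u\<close> leaves a \<open>K\<close>-fixed vector
  orthogonal to \<open>u\<close>, which must vanish.\<close>

lemma K_fixed_multiple:
  assumes a: "a \<in> carrier_vec d" "K_fixed K \<pi> a"
  shows "a = (a \<bullet>c u) \<cdot>\<^sub>v u"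
proof -
  define k where "k = - (a \<bullet>c u)"
  define r where "r = a + k \<cdot>\<^sub>v u"
  have r: "r \<in> carrier_vec d" using a u by (simp add: r_def)
  have "K_fixed K \<pi> r"
    unfolding K_fixed_def
  proof
    fix k' assume k': "k' \<in> K"
    have pc: "\<pi> k' \<in> carrier_mat d d" using rep_carrier[OF rep K_sub[OF k']] d by simp
    show "\<pi> k' *\<^sub>v r = r"
      unfolding r_def using a u k' pc
      by (simp add: mult_add_distrib_mat_vec[of _ d d] mult_mat_vec[of _ d d] K_fixed_def)
  qed
  moreover have "r \<bullet>c u = 0"
  proof -
    have "r \<bullet>c u = (\<Sum>i<d. a $ i * cnj (u $ i) + k * (u $ i * cnj (u $ i)))"
      unfolding cscalar_sum[OF u(1)] r_def using a u by (intro sum.cong) (auto simp: algebra_simps)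
    also have "\<dots> = a \<bullet>c u + k * (u \<bullet>c u)" by (simp add: cscalar_sum[OF u(1)] sum.distrib sum_distrib_left)
    finally show ?thesis using u(3) by (simp add: k_def)
  qed
  moreover have "u \<noteq> 0\<^sub>v d" using u by auto
  ultimately have "r = 0\<^sub>v d" using K_fixed_proportional[OF irr] r u d by blast
  show ?thesis
  proof (rule eq_vecI)
    fix i assume "i < dim_vec ((a \<bullet>c u) \<cdot>\<^sub>v u)"
    then have i: "i < d" using u by simp
    have "r $ i = 0" using \<open>r = 0\<^sub>v d\<close> i by simp
    then show "a $ i = ((a \<bullet>c u) \<cdot>\<^sub>v u) $ i" using i a u by (simp add: r_def k_def)
  qed (use a u in auto)
qed

text \<open>The averaged operator and its adjoint both have range in the line of \<open>u\<close>,
  so the operator is a scalar times the orthogonal projection onto that line.\<close>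

lemma integral_coef_spherical:
  assumes t: "t \<ge> 0" and v: "v \<in> carrier_vec d" and w: "w \<in> carrier_vec d"
  shows "(\<integral>g. coef \<pi> v w g \<partial>\<mu> t) = (\<integral>g. coef \<pi> u u g \<partial>\<mu> t) * (v \<bullet>c u) * (u \<bullet>c w)"
proof -
  obtain a where a: "a \<in> carrier_vec d" "K_fixed K \<pi> a" "\<And>w. w \<in> carrier_vec d \<Longrightarrow> (\<integral>g. coef \<pi> v w g \<partial>\<mu> t) = a \<bullet>c w"
    using averaged_vector[OF t v] by metis
  obtain b where b: "b \<in> carrier_vec d" "K_fixed K \<pi> b" "\<And>v. v \<in> carrier_vec d \<Longrightarrow> (\<integral>g. coef \<pi> v u g \<partial>\<mu> t) = v \<bullet>c b"
    using averaged_covector[OF t u(1)] by metis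
  have "(\<integral>g. coef \<pi> v w g \<partial>\<mu> t) = ((a \<bullet>c u) \<cdot>\<^sub>v u) \<bullet>c w" using a(3)[OF w] K_fixed_multiple[OF a(1,2)] by simp
  also have "\<dots> = (a \<bullet>c u) * (u \<bullet>c w)"
    unfolding cscalar_sum[OF w] using u by (auto simp: sum_distrib_left mult.assoc intro!: sum.cong)
  also have "a \<bullet>c u = v \<bullet>c b" using a(3)[OF u(1)] b(3)[OF v] by simp
  also have "v \<bullet>c b = v \<bullet>c ((b \<bullet>c u) \<cdot>\<^sub>v u)" using K_fixed_multiple[OF b(1,2)] by simp
  also have "\<dots> = cnj (b \<bullet>c u) * (v \<bullet>c u)"
    using u by (subst cscalar_sum[of _ d]) (auto simp: cscalar_sum[OF u(1), of v] sum_distrib_left mult_ac intro!: sum.cong)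
  also have "cnj (b \<bullet>c u) = (\<integral>g. coef \<pi> u u g \<partial>\<mu> t)" using cscalar_commute[OF b(1) u(1)] b(3)[OF u(1)] by simp
  finally show ?thesis by simp
qed

text \<open>The component of \<pi>(g) u orthogonal to \<open>u\<close> has non-negative squared
  norm.\<close>

lemma coef_norm_le:
  assumes g: "g \<in> carrier G" shows "cmod (coef \<pi> u u g) \<le> 1"
proof -
  define x where "x = \<pi> g *\<^sub>v u"
  have x: "x \<in> carrier_vec d" unfolding x_def using rep_vec_carrier[OF rep g] u d by simp
  have xx: "x \<bullet>c x = 1" using rep_unitary[OF rep g] u d by (simp add: x_def unitary_mat_def)
  define k where "k = - (x \<bullet>c u)"
  have "x + k \<cdot>\<^sub>v u \<in> carrier_vec d" using x u by simp
  from cscalar_sum[OF this, of "x + k \<cdot>\<^sub>v u"]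
  have "Re ((x + k \<cdot>\<^sub>v u) \<bullet>c (x + k \<cdot>\<^sub>v u)) \<ge> 0" by (simp add: sum_nonneg)
  moreover have "(x + k \<cdot>\<^sub>v u) \<bullet>c (x + k \<cdot>\<^sub>v u) = 1 - (x \<bullet>c u) * cnj (x \<bullet>c u)"
    unfolding cscalar_expand[OF x u(1)] xx u(3) using cscalar_commute[OF x u(1)] by (simp add: k_def)
  ultimately have "0 \<le> 1 - (cmod (x \<bullet>c u))\<^sup>2"
    by (simp add: complex_norm_square[symmetric] del: of_real_power)
  then have "(cmod (x \<bullet>c u))\<^sup>2 \<le> 1\<^sup>2" by simp
  then show ?thesis unfolding coef_def x_def[symmetric] by (rule power2_le_imp_le) simp
qed

text \<open>The conjugate coefficient is the spherical function of the unit vector \<open>u\<close>,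
  so this is the spherical transform of \<open>\<mu> t\<close>; it turns out to be e^(-t
  chi).\<close>

definition fourier :: "real \<Rightarrow> complex" where
  "fourier t = (\<integral>g. cnj (coef \<pi> u u g) \<partial>\<mu> t)"

lemma fourier_eq: "(\<integral>g. coef \<pi> u u g \<partial>\<mu> t) = cnj (fourier t)"
  by (simp add: fourier_def)

text \<open>Translation by \<open>g\<close> moves into the second vector, and averaging projects
  onto \<open>u\<close>, which recovers the coefficient at \<open>g\<close>.\<close>

lemma transition_spherical:
  assumes t: "t \<ge> 0" and g: "g \<in> carrier G"
  shows "(\<integral>h. cnj (coef \<pi> u u (g \<otimes> h)) \<partial>\<mu> t) = fourier t * cnj (coef \<pi> u u g)"
proof -
  have w: "\<pi> (inv g) *\<^sub>v u \<in> carrier_vec d" using rep_vec_carrier[OF rep, of "inv g"] g u d by simp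
  have "(\<integral>h. cnj (coef \<pi> u u (g \<otimes> h)) \<partial>\<mu> t) = (\<integral>h. cnj (coef \<pi> u (\<pi> (inv g) *\<^sub>v u) h) \<partial>\<mu> t)"
    using g u by (intro integral_cong'[OF borel_prob_\<mu>[OF t]]) (simp add: coef_translate_left)
  also have "\<dots> = cnj (cnj (fourier t) * (u \<bullet>c u) * (u \<bullet>c (\<pi> (inv g) *\<^sub>v u)))"
    by (simp add: integral_coef_spherical[OF t u(1) w] fourier_eq)
  also have "u \<bullet>c (\<pi> (inv g) *\<^sub>v u) = coef \<pi> u u g"
    using rep_cscalar[OF rep g] u d by (simp add: coef_def)
  finally show ?thesis using u by simp
qed

text \<open>The eigenvalue equation makes \<open>fourier\<close> multiplicative along the
  convolution semigroup; at time 0 the measure is Haar measure of \<open>K\<close>, where the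
  coefficient is 1.\<close>

lemma fourier_exponential: "\<exists>c. \<forall>t\<ge>0. fourier t = exp (- of_real t * c)"
proof (rule exponential_semigroup)
  have c: "cf (\<lambda>g. cnj (coef \<pi> u u g))" by (intro cont_intros coef_cf u)
  show "fourier (s + t) = fourier s * fourier t" if "s \<ge> 0" "t \<ge> 0" for s t
  proof -
    have "fourier (s + t) = (\<integral>x. (\<integral>y. cnj (coef \<pi> u u (x \<otimes> y)) \<partial>\<mu> t) \<partial>\<mu> s)"
      unfolding fourier_def by (rule integral_convolution[OF c that])
    also have "\<dots> = (\<integral>x. fourier t * cnj (coef \<pi> u u x) \<partial>\<mu> s)"
      by (intro integral_cong'[OF borel_prob_\<mu>[OF that(1)]] transition_spherical that)
    finally show ?thesis by (simp add: fourier_def mult.commute)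
  qed
  show "fourier 0 = 1"
  proof -
    have mK: "prob_space mK" "sets mK = sets (borel_of_topology (subtopology T K))"
      using haar_K by (auto simp: normalised_haar_measure_def)
    then have sp: "space mK = K"
      using sets_eq_imp_space_eq[OF mK(2)] K_sub topspace by auto
    have "(\<lambda>x. x) \<in> borel_of_topology (subtopology T K) \<rightarrow>\<^sub>M borel_of_topology T"
      by (intro continuous_map_measurable continuous_map_from_subtopology continuous_id')
    then have id: "(\<lambda>x. x) \<in> mK \<rightarrow>\<^sub>M borel_of_topology T" using measurable_cong_sets[OF mK(2) refl] by blast
    have "\<mu> 0 = distr mK (borel_of_topology T) (\<lambda>x. x)" using semigroup by (simp add: K_biinvariant_semigroup_def)
    then have "fourier 0 = (\<integral>x. cnj (coef \<pi> u u x) \<partial>mK)"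
      unfolding fourier_def using integral_distr[OF id continuous_map_borel_measurable[OF c]] by simp
    also have "\<dots> = (\<integral>x. 1 \<partial>mK)"
      using u sp by (intro Bochner_Integration.integral_cong) (auto simp: coef_def K_fixed_def)
    also have "\<dots> = 1" using mK(1) prob_space.prob_space by fastforce
    finally show ?thesis .
  qed
  then have f0: "(\<integral>x. cnj (coef \<pi> u u x) \<partial>\<mu> 0) = 1" by (simp add: fourier_def)
  \<comment> \<open>Weak continuity is stated for real bounded functions: compactness supplies
    boundedness, and real and imaginary parts are treated separately.\<close>
  have wk: "((\<lambda>t. \<integral>x. f x \<partial>\<mu> t) \<longlongrightarrow> (\<integral>x. f x \<partial>\<mu> 0)) (at_right 0)" if "continuous_map T euclideanreal f" for f
    using semigroup that compact_space_bounded_image[OF compact that]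
    by (auto simp: K_biinvariant_semigroup_def convolution_semigroup_def)
  have int: "integrable (\<mu> t) (\<lambda>x. cnj (coef \<pi> u u x))" if "t \<ge> 0" for t
    by (rule integrable_cf[OF borel_prob_\<mu>[OF that] c])
  have dec: "fourier t = Complex (\<integral>x. Re (cnj (coef \<pi> u u x)) \<partial>\<mu> t) (\<integral>x. Im (cnj (coef \<pi> u u x)) \<partial>\<mu> t)"
    if "t \<ge> 0" for t
    unfolding fourier_def using int[OF that]
    by (intro complex_eqI) (simp_all only: complex.sel integral_Re integral_Im)
  have "((\<lambda>t. Complex (\<integral>x. Re (cnj (coef \<pi> u u x)) \<partial>\<mu> t) (\<integral>x. Im (cnj (coef \<pi> u u x)) \<partial>\<mu> t)) \<longlongrightarrow>
      Complex (\<integral>x. Re (cnj (coef \<pi> u u x)) \<partial>\<mu> 0) (\<integral>x. Im (cnj (coef \<pi> u u x)) \<partial>\<mu> 0)) (at_right 0)"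
    by (intro tendsto_Complex wk continuous_map_Re continuous_map_Im c)
  moreover have "\<forall>\<^sub>F t in at_right 0. Complex (\<integral>x. Re (cnj (coef \<pi> u u x)) \<partial>\<mu> t) (\<integral>x. Im (cnj (coef \<pi> u u x)) \<partial>\<mu> t) = fourier t"
    using eventually_at_right_less[of 0] by eventually_elim (simp add: dec)
  ultimately have "(fourier \<longlongrightarrow> fourier 0) (at_right 0)"
    using tendsto_cong dec[of 0] by fastforce
  then show "(fourier \<longlongrightarrow> 1) (at_right 0)" by (simp add: \<open>fourier 0 = 1\<close>)
qed

lemma characteristic_exponent_fourier:
  assumes e: "\<And>g. g \<in> carrier G \<Longrightarrow> spherical_function e \<pi> g = cnj (coef \<pi> u u g)" and t: "t \<ge> 0"
  shows "fourier t = exp (- of_real t * characteristic_exponent \<mu> e \<pi>)"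
proof -
  have eq: "(\<integral>g. spherical_function e \<pi> g \<partial>\<mu> t) = fourier t" if "t \<ge> 0" for t
    unfolding fourier_def using e by (intro integral_cong'[OF borel_prob_\<mu>[OF that]])
  obtain c where c: "\<forall>t\<ge>0. fourier t = exp (- of_real t * c)" using fourier_exponential by blast
  have "characteristic_exponent \<mu> e \<pi> = c"
    unfolding characteristic_exponent_def
  proof (rule the_equality)
    show "\<forall>t\<ge>0. (\<integral>g. spherical_function e \<pi> g \<partial>\<mu> t) = exp (- of_real t * c)" using c eq by simp
    fix c' assume c': "\<forall>t\<ge>0. (\<integral>g. spherical_function e \<pi> g \<partial>\<mu> t) = exp (- of_real t * c')"
    show "c' = c"
    proof (rule exp_all_eq_imp_eq)
      fix t :: real assume t: "t \<ge> 0"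
      show "exp (- of_real t * c') = exp (- of_real t * c)"
        using c'[rule_format, OF t] c[rule_format, OF t] eq[OF t] by metis
    qed
  qed
  then show ?thesis using c t by simp
qed

end

end

end

section \<open>Expansion of the density\<close>

context compact_group
begin

lemma unitarily_equivalent_refl:
  assumes "unitary_rep G T \<pi>" shows "unitarily_equivalent G \<pi> \<pi>"
  unfolding unitarily_equivalent_def
proof (intro conjI exI[of _ "1\<^sub>m (rep_dim G \<pi>)"] ballI)
  show "unitary_mat (rep_dim G \<pi>) (1\<^sub>m (rep_dim G \<pi>))" by (auto simp: unitary_mat_def)
  fix g assume "g \<in> carrier G"
  from rep_carrier[OF assms this]
  show "1\<^sub>m (rep_dim G \<pi>) * \<pi> g = \<pi> g * 1\<^sub>m (rep_dim G \<pi>)" by simp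
qed simp

lemma unitary_dual_inequivalent:
  assumes dual: "is_unitary_dual G T R" and "\<pi> \<in> R" "\<rho> \<in> R" "\<pi> \<noteq> \<rho>"
  shows "\<not> unitarily_equivalent G \<rho> \<pi>"
proof
  assume "unitarily_equivalent G \<rho> \<pi>"
  moreover have "irreducible_unitary_rep G T \<pi>" using assms by (simp add: is_unitary_dual_def)
  moreover from this have "unitarily_equivalent G \<pi> \<pi>" using unitarily_equivalent_refl irrepD by blast
  ultimately show False using assms unfolding is_unitary_dual_def by metis
qed

lemma tendsto_ip_uniform_limit:
  assumes lim: "uniform_limit (carrier G) f l F" and f: "\<forall>\<^sub>F n in F. cf (f n)" and l: "cf l" and h: "cf h"
  shows "((\<lambda>n. ip (f n) h) \<longlongrightarrow> ip l h) F"
  unfolding ip_def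
proof (rule tendsto_integral_uniform_limit[OF borel_prob_haar])
  show "cf (\<lambda>x. l x * cnj (h x))" by (intro cont_intros l h)
  show "\<forall>\<^sub>F n in F. cf (\<lambda>x. f n x * cnj (h x))"
    using f by eventually_elim (intro cont_intros h)
  obtain C where C: "C > 0" "\<And>x. x \<in> carrier G \<Longrightarrow> cmod (h x) \<le> C" using cf_bounded[OF h] by blast
  show "uniform_limit (carrier G) (\<lambda>n x. f n x * cnj (h x)) (\<lambda>x. l x * cnj (h x)) F"
    unfolding uniform_limit_iff
  proof (intro allI impI)
    fix e :: real assume e: "e > 0"
    have "\<forall>\<^sub>F n in F. \<forall>x\<in>carrier G. dist (f n x) (l x) < e / C"
      using lim e C(1) unfolding uniform_limit_iff by simp
    then show "\<forall>\<^sub>F n in F. \<forall>x\<in>carrier G. dist (f n x * cnj (h x)) (l x * cnj (h x)) < e"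
    proof eventually_elim
      case (elim n)
      show ?case
      proof
        fix x assume x: "x \<in> carrier G"
        have "dist (f n x * cnj (h x)) (l x * cnj (h x)) = cmod (f n x - l x) * cmod (h x)"
          by (simp add: dist_norm norm_mult flip: left_diff_distrib)
        also have "\<dots> \<le> cmod (f n x - l x) * C" using C(2)[OF x] by (intro mult_left_mono) auto
        also have "\<dots> < e / C * C" using elim x C(1) by (intro mult_strict_right_mono) (auto simp: dist_norm)
        finally show "dist (f n x * cnj (h x)) (l x * cnj (h x)) < e" using C(1) by simp
      qed
    qed
  qed
qed

lemma integral_density_cf:
  assumes f: "continuous_map T euclideanreal f" and nonneg: "\<And>x. x \<in> carrier G \<Longrightarrow> 0 \<le> f x" and g: "cf g"
  shows "integral\<^sup>L (density m (\<lambda>x. ennreal (f x))) g = (\<integral>x. of_real (f x) * g x \<partial>m)"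
proof -
  have "integral\<^sup>L (density m (\<lambda>x. ennreal (f x))) g = (\<integral>x. f x *\<^sub>R g x \<partial>m)"
    using nonneg space_borel_prob[OF borel_prob_haar]
    by (intro integral_density measurable_borel_prob[OF borel_prob_haar] f g) auto
  then show ?thesis by (simp add: scaleR_conv_of_real)
qed

text \<open>Testing with the conjugate of the difference makes its squared L^2 norm vanish.\<close>

lemma cf_eq_if_integrals_eq:
  assumes f: "cf f" and h: "cf h" and eq: "\<And>g. cf g \<Longrightarrow> (\<integral>x. f x * g x \<partial>m) = (\<integral>x. h x * g x \<partial>m)"
    and x: "x \<in> carrier G"
  shows "f x = h x"
proof -
  have c: "cf (\<lambda>x. cnj (f x - h x))" by (intro cont_intros f h)
  have fh: "cf (\<lambda>x. f x - h x)" by (intro cont_intros f h)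
  have "ip (\<lambda>x. f x - h x) (\<lambda>x. f x - h x) = (\<integral>x. f x * cnj (f x - h x) - h x * cnj (f x - h x) \<partial>m)"
    by (simp add: ip_def left_diff_distrib)
  also have "\<dots> = (\<integral>x. f x * cnj (f x - h x) \<partial>m) - (\<integral>x. h x * cnj (f x - h x) \<partial>m)"
    by (intro Bochner_Integration.integral_diff int_m continuous_map_mult f h c)
  finally have "nsq (\<lambda>x. f x - h x) = 0" using eq[OF c] by (simp add: ip_self)
  from nsq_eq_0[OF fh this x] show ?thesis by simp
qed

end

text \<open>The basis vectors are the columns of a unitary \<open>U\<close>, and the sum is the
  inner product of \<open>adj U *\<^sub>v x\<close> and \<open>adj U *\<^sub>v y\<close>. The basis
  is numbered from 1 and matrix columns from 0, hence the \<open>Suc\<close>.\<close>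

lemma parseval_cscalar:
  fixes x y :: "complex Matrix.vec"
  assumes b: "\<And>i. i \<in> {1..d} \<Longrightarrow> b i \<in> carrier_vec d"
    and on: "\<And>i j. i \<in> {1..d} \<Longrightarrow> j \<in> {1..d} \<Longrightarrow> b i \<bullet>c b j = (if i = j then 1 else 0)"
    and x: "x \<in> carrier_vec d" and y: "y \<in> carrier_vec d"
  shows "(\<Sum>j=1..d. cnj (y \<bullet>c b j) * (x \<bullet>c b j)) = x \<bullet>c y"
proof -
  define U where "U = Matrix.mat d d (\<lambda>(i, j). b (Suc j) $ i)"
  have U: "U \<in> carrier_mat d d" by (simp add: U_def)
  have uU: "unitary_mat d U"
  proof (rule unitary_matI[OF U])
    fix j k assume "j < d" "k < d"
    then have "b (Suc j) \<bullet>c b (Suc k) = (if j = k then 1 else 0)" "b (Suc k) \<in> carrier_vec d" using on b by auto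
    then show "(\<Sum>i<d. U $$ (i, j) * cnj (U $$ (i, k))) = (if j = k then 1 else 0)"
      using \<open>j < d\<close> \<open>k < d\<close> by (simp add: U_def cscalar_sum)
  qed
  have aU: "adj U \<in> carrier_mat d d" using U by simp
  have ent: "(adj U *\<^sub>v v) $ j = v \<bullet>c b (Suc j)" if v: "v \<in> carrier_vec d" and j: "j < d" for v j
    unfolding mult_mat_vec_index'[OF aU v j] cscalar_sum[OF b[of "Suc j"], simplified, OF j[unfolded Suc_le_eq[symmetric]]]
    using U j by (intro sum.cong) (auto simp: U_def)
  have av: "adj U *\<^sub>v v \<in> carrier_vec d" if "v \<in> carrier_vec d" for v
    using mult_mat_vec_carrier[OF aU that] .
  have "(\<Sum>j=1..d. cnj (y \<bullet>c b j) * (x \<bullet>c b j)) = (\<Sum>j<d. cnj (y \<bullet>c b (Suc j)) * (x \<bullet>c b (Suc j)))"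
    by (rule sum.reindex_bij_witness[of _ Suc "\<lambda>j. j - 1"]) auto
  also have "\<dots> = (adj U *\<^sub>v x) \<bullet>c (adj U *\<^sub>v y)"
    unfolding cscalar_sum[OF av[OF y]] using x y by (intro sum.cong) (auto simp: ent)
  also have "\<dots> = x \<bullet>c (U *\<^sub>v (adj U *\<^sub>v y))" using adj_cscalar[OF aU x av[OF y]] by simp
  also have "U *\<^sub>v (adj U *\<^sub>v y) = y"
    using assoc_mult_mat_vec[OF U aU y] unitary_mat_adj_right[OF uU] y by simp
  finally show ?thesis .
qed

context gelfand_pair
begin

section \<open>Bi-invariance of the continuous density\<close>

context
  fixes t :: real and f :: "'a \<Rightarrow> real"
  assumes t: "t \<ge> 0" and f: "continuous_map T euclideanreal f" and nonneg: "\<And>x. x \<in> carrier G \<Longrightarrow> 0 \<le> f x"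
    and dens: "\<mu> t = density m (\<lambda>x. ennreal (f x))"
begin

lemma integral_\<mu>_density: "cf g \<Longrightarrow> (\<integral>x. g x \<partial>\<mu> t) = (\<integral>x. of_real (f x) * g x \<partial>m)"
  unfolding dens by (rule integral_density_cf[OF f nonneg])

lemma cf_density: "cf (\<lambda>x. of_real (f x))"
  by (rule continuous_map_of_real[OF f])

lemma ip_density: "cf h \<Longrightarrow> ip (\<lambda>x. of_real (f x)) h = cnj (\<integral>x. h x \<partial>\<mu> t)"
  using integral_\<mu>_density[OF continuous_map_cnj] by (simp add: ip_def)

text \<open>Invariance of \<open>\<mu> t\<close> and of Haar measure gives both continuous functions
  the same integral against every continuous function.\<close>

lemma density_right_K:
  assumes k: "k \<in> K" and x: "x \<in> carrier G" shows "f (x \<otimes> k) = f x"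
proof -
  note kc = K_sub[OF k]
  have c: "cf (\<lambda>x. complex_of_real (f (x \<otimes> k)))"
    by (rule continuous_map_compose'[OF cf_density]) (intro cont_group kc)
  have "complex_of_real (f (x \<otimes> k)) = of_real (f x)"
  proof (rule cf_eq_if_integrals_eq[OF c cf_density _ x])
    fix g assume g: "cf g"
    let ?h = "\<lambda>x. complex_of_real (f x) * g (x \<otimes> inv k)"
    have gk: "cf (\<lambda>x. g (x \<otimes> inv k))" by (rule continuous_map_compose'[OF g]) (intro cont_group inv_closed kc)
    have h: "cf ?h" by (intro continuous_map_mult cf_density gk)
    have "(\<integral>x. of_real (f (x \<otimes> k)) * g x \<partial>m) = (\<integral>x. ?h (x \<otimes> k) \<partial>m)"
      using kc by (intro integral_cong'[OF borel_prob_haar]) (simp add: m_assoc)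
    also have "\<dots> = (\<integral>x. g (x \<otimes> inv k) \<partial>\<mu> t)" unfolding right_invariant[OF h kc] integral_\<mu>_density[OF gk] ..
    also have "\<dots> = (\<integral>x. g x \<partial>\<mu> t)" by (rule right_K_invariant[OF g t K_inv[OF k]])
    finally show "(\<integral>x. of_real (f (x \<otimes> k)) * g x \<partial>m) = (\<integral>x. of_real (f x) * g x \<partial>m)"
      unfolding integral_\<mu>_density[OF g] .
  qed
  then show ?thesis by simp
qed

lemma density_left_K:
  assumes k: "k \<in> K" and x: "x \<in> carrier G" shows "f (k \<otimes> x) = f x"
proof -
  note kc = K_sub[OF k]
  have c: "cf (\<lambda>x. complex_of_real (f (k \<otimes> x)))"
    by (rule continuous_map_compose'[OF cf_density]) (intro cont_group kc)
  have "complex_of_real (f (k \<otimes> x)) = of_real (f x)"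
  proof (rule cf_eq_if_integrals_eq[OF c cf_density _ x])
    fix g assume g: "cf g"
    let ?h = "\<lambda>x. complex_of_real (f x) * g (inv k \<otimes> x)"
    have gk: "cf (\<lambda>x. g (inv k \<otimes> x))" by (rule continuous_map_compose'[OF g]) (intro cont_group inv_closed kc)
    have h: "cf ?h" by (intro continuous_map_mult cf_density gk)
    have "(\<integral>x. of_real (f (k \<otimes> x)) * g x \<partial>m) = (\<integral>x. ?h (k \<otimes> x) \<partial>m)"
      using kc by (intro integral_cong'[OF borel_prob_haar]) (simp flip: m_assoc)
    also have "\<dots> = (\<integral>x. g (inv k \<otimes> x) \<partial>\<mu> t)" unfolding left_invariant[OF h kc] integral_\<mu>_density[OF gk] ..
    also have "\<dots> = (\<integral>x. g x \<partial>\<mu> t)" by (rule left_K_invariant[OF g t K_inv[OF k]])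
    finally show "(\<integral>x. of_real (f (k \<otimes> x)) * g x \<partial>m) = (\<integral>x. of_real (f x) * g x \<partial>m)"
      unfolding integral_\<mu>_density[OF g] .
  qed
  then show ?thesis by simp
qed

end

section \<open>The spherical series of the density\<close>

context
  fixes R :: "'a rep set" and e :: "'a rep \<Rightarrow> nat \<Rightarrow> complex Matrix.vec"
  assumes dual: "is_unitary_dual G T R"
    and basis: "\<And>\<pi>. \<pi> \<in> spherical_part G K R \<Longrightarrow> adapted_basis G K \<pi> (e \<pi>)"
  notes [simp del] = One_nat_def
begin

abbreviation "Ghat_s \<equiv> spherical_part G K R"

lemma spherical:
  assumes "\<pi> \<in> Ghat_s"
  shows "\<pi> \<in> R" "irreducible_unitary_rep G T \<pi>" "e \<pi> 1 \<in> carrier_vec (rep_dim G \<pi>)"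
    "K_fixed K \<pi> (e \<pi> 1)" "e \<pi> 1 \<bullet>c e \<pi> 1 = 1"
proof -
  show "\<pi> \<in> R" using assms by (simp add: spherical_part_def)
  then show irr: "irreducible_unitary_rep G T \<pi>" using dual by (simp add: is_unitary_dual_def)
  show "e \<pi> 1 \<in> carrier_vec (rep_dim G \<pi>)" "K_fixed K \<pi> (e \<pi> 1)" "e \<pi> 1 \<bullet>c e \<pi> 1 = 1"
    using basis[OF assms] irrepD(2)[OF irr] by (auto simp: adapted_basis_def)
qed

lemma spherical_function_coef:
  assumes "\<pi> \<in> Ghat_s" "g \<in> carrier G"
  shows "spherical_function e \<pi> g = cnj (coef \<pi> (e \<pi> 1) (e \<pi> 1) g)"
  unfolding spherical_function_def coef_def
  using cscalar_commute[OF rep_vec_carrier[OF irrepD(1)[OF spherical(2)]]] spherical[OF assms(1)] assms by simp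

lemma spherical_fourier:
  assumes "\<pi> \<in> Ghat_s" "t \<ge> 0"
  shows "fourier \<pi> (e \<pi> 1) t = exp (- of_real t * characteristic_exponent \<mu> e \<pi>)"
  using characteristic_exponent_fourier[OF spherical(2) refl spherical(3-5)] spherical_function_coef assms by blast

lemma transition_operator_spherical:
  assumes \<pi>: "\<pi> \<in> Ghat_s" and t: "t \<ge> 0" and g: "g \<in> carrier G"
  shows "transition_operator G \<mu> t (spherical_function e \<pi>) g =
    exp (- of_real t * characteristic_exponent \<mu> e \<pi>) * spherical_function e \<pi> g"
proof -
  have "transition_operator G \<mu> t (spherical_function e \<pi>) g = (\<integral>h. cnj (coef \<pi> (e \<pi> 1) (e \<pi> 1) (g \<otimes> h)) \<partial>\<mu> t)"
    unfolding transition_operator_def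
    using g by (intro integral_cong'[OF borel_prob_\<mu>[OF t]]) (simp add: spherical_function_coef[OF \<pi>])
  also have "\<dots> = fourier \<pi> (e \<pi> 1) t * cnj (coef \<pi> (e \<pi> 1) (e \<pi> 1) g)"
    by (rule transition_spherical[OF spherical(2)[OF \<pi>] refl spherical(3-5)[OF \<pi>] t g])
  finally show ?thesis by (simp add: spherical_fourier[OF \<pi> t] spherical_function_coef[OF \<pi> g])
qed

lemma ip_spherical:
  assumes \<pi>: "\<pi> \<in> Ghat_s" and \<rho>: "\<rho> \<in> R" and vw: "v \<in> carrier_vec (rep_dim G \<rho>)" "w \<in> carrier_vec (rep_dim G \<rho>)"
  shows "ip (coef \<pi> (e \<pi> 1) (e \<pi> 1)) (coef \<rho> v w) =
    (if \<pi> = \<rho> then (e \<pi> 1 \<bullet>c v) * cnj (e \<pi> 1 \<bullet>c w) / of_nat (rep_dim G \<pi>) else 0)"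
proof (cases "\<pi> = \<rho>")
  case True
  then show ?thesis using coef_schur[OF spherical(2)[OF \<pi>] refl spherical(3)[OF \<pi>] spherical(3)[OF \<pi>]] vw by simp
next
  case False
  have "irreducible_unitary_rep G T \<rho>" using dual \<rho> by (simp add: is_unitary_dual_def)
  then show ?thesis
    using coef_orthogonal[OF spherical(2)[OF \<pi>] _ unitary_dual_inequivalent[OF dual spherical(1)[OF \<pi>] \<rho> False]
      spherical(3)[OF \<pi>] spherical(3)[OF \<pi>] vw] False by simp
qed

lemma cf_spherical: "\<pi> \<in> Ghat_s \<Longrightarrow> cf (coef \<pi> (e \<pi> 1) (e \<pi> 1))"
  using cf_coef[OF irrepD(1)[OF spherical(2)] spherical(3) spherical(3)] .

text \<open>The coefficients at the fixed vectors, scaled by sqrt d, are orthonormal, and the inner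
  products of the density with them are sqrt d times \<open>fourier\<close>.\<close>

lemma fourier_bessel:
  assumes t: "t \<ge> 0" and f: "continuous_map T euclideanreal f" "\<And>x. x \<in> carrier G \<Longrightarrow> 0 \<le> f x"
      "\<mu> t = density m (\<lambda>x. ennreal (f x))"
    and F: "finite F" "F \<subseteq> Ghat_s"
  shows "(\<Sum>\<pi>\<in>F. real (rep_dim G \<pi>) * (cmod (fourier \<pi> (e \<pi> 1) t))\<^sup>2) \<le> nsq (\<lambda>x. of_real (f x))"
proof -
  define w where "w \<pi> x = of_real (sqrt (rep_dim G \<pi>)) * coef \<pi> (e \<pi> 1) (e \<pi> 1) x" for \<pi> x
  have d0: "rep_dim G \<pi> > 0" if "\<pi> \<in> Ghat_s" for \<pi> using irrepD(2)[OF spherical(2)[OF that]] .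
  have "orthonormal F w"
    unfolding orthonormal_def
  proof (intro conjI ballI)
    show "cf (w \<pi>)" if "\<pi> \<in> F" for \<pi> unfolding w_def using that F by (intro cont_intros cf_spherical) auto
    fix \<pi> \<rho> assume "\<pi> \<in> F" "\<rho> \<in> F"
    then have S: "\<pi> \<in> Ghat_s" "\<rho> \<in> Ghat_s" using F by auto
    have "ip (w \<pi>) (w \<rho>) = of_real (sqrt (rep_dim G \<pi>)) * (of_real (sqrt (rep_dim G \<rho>)) *
        ip (coef \<pi> (e \<pi> 1) (e \<pi> 1)) (coef \<rho> (e \<rho> 1) (e \<rho> 1)))"
      unfolding w_def by (simp only: ip_scale_left ip_scale_right complex_cnj_complex_of_real)
    also have "\<dots> = (if \<pi> = \<rho> then 1 else 0)"
      using d0[OF S(1)] d0[OF S(2)] spherical(5)[OF S(1)] spherical(5)[OF S(2)]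
      by (simp add: ip_spherical[OF S(1) spherical(1,3,3)[OF S(2)]] flip: of_real_mult mult.assoc)
    finally show "ip (w \<pi>) (w \<rho>) = (if \<pi> = \<rho> then 1 else 0)" .
  qed
  from bessel[OF F(1) this continuous_map_of_real[OF f(1)]]
  have "(\<Sum>\<pi>\<in>F. (cmod (ip (\<lambda>x. of_real (f x)) (w \<pi>)))\<^sup>2) \<le> nsq (\<lambda>x. of_real (f x))" .
  moreover have "(cmod (ip (\<lambda>x. of_real (f x)) (w \<pi>)))\<^sup>2 = real (rep_dim G \<pi>) * (cmod (fourier \<pi> (e \<pi> 1) t))\<^sup>2"
    if "\<pi> \<in> F" for \<pi>
  proof -
    have S: "\<pi> \<in> Ghat_s" using that F by auto
    have "ip (\<lambda>x. of_real (f x)) (w \<pi>) = of_real (sqrt (rep_dim G \<pi>)) * fourier \<pi> (e \<pi> 1) t"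
    proof -
      have "ip (\<lambda>x. of_real (f x)) (coef \<pi> (e \<pi> 1) (e \<pi> 1)) = cnj (\<integral>g. coef \<pi> (e \<pi> 1) (e \<pi> 1) g \<partial>\<mu> t)"
        by (rule ip_density[OF t f cf_spherical[OF S]])
      then show ?thesis
        unfolding w_def ip_scale_right fourier_eq[OF spherical(2)[OF S] refl spherical(3-5)[OF S]] by simp
    qed
    then show ?thesis by (simp add: norm_mult power_mult_distrib)
  qed
  ultimately show ?thesis by simp
qed

text \<open>The series converges uniformly to a continuous \<open>H\<close>; \<open>f\<close> and
  \<open>H\<close> have the same inner products with the matrix coefficients of all members of
  \<open>R\<close>, non-spherical ones included, so Peter-Weyl uniqueness identifies them.\<close>

theorem density_expansion:
  assumes t: "t > 0"
    and f: "continuous_map T euclideanreal f" "\<And>x. x \<in> carrier G \<Longrightarrow> 0 \<le> f x" "\<mu> t = density m (\<lambda>x. ennreal (f x))"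
    and f2: "continuous_map T euclideanreal f2" "\<And>x. x \<in> carrier G \<Longrightarrow> 0 \<le> f2 x"
      "\<mu> (t / 2) = density m (\<lambda>x. ennreal (f2 x))"
    and x: "x \<in> carrier G"
  shows "((\<lambda>\<pi>. of_nat (rep_dim G \<pi>) * fourier \<pi> (e \<pi> 1) t * coef \<pi> (e \<pi> 1) (e \<pi> 1) x) has_sum of_real (f x)) Ghat_s"
proof -
  have t0: "t \<ge> 0" "t / 2 \<ge> 0" using t by auto
  define a where "a \<pi> y = of_nat (rep_dim G \<pi>) * fourier \<pi> (e \<pi> 1) t * coef \<pi> (e \<pi> 1) (e \<pi> 1) y" for \<pi> y
  \<comment> \<open>Uniform majorant of the terms: \<open>fourier\<close> at \<open>t\<close> is the
    square of its value at t / 2, and the partial sums of \<open>b\<close> are bounded by Bessel for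
    the density at t / 2.\<close>
  define b where "b \<pi> = real (rep_dim G \<pi>) * (cmod (fourier \<pi> (e \<pi> 1) (t / 2)))\<^sup>2" for \<pi>
  have half: "cmod (fourier \<pi> (e \<pi> 1) t) = (cmod (fourier \<pi> (e \<pi> 1) (t / 2)))\<^sup>2" if "\<pi> \<in> Ghat_s" for \<pi>
  proof -
    have "fourier \<pi> (e \<pi> 1) t = (fourier \<pi> (e \<pi> 1) (t / 2))\<^sup>2"
      unfolding spherical_fourier[OF that t0(1)] spherical_fourier[OF that t0(2)]
      by (simp add: power2_eq_square flip: exp_add)
    then show ?thesis by (simp add: norm_power)
  qed
  have "b summable_on Ghat_s"
  proof (rule nonneg_bdd_above_summable_on)
    show "bdd_above (sum b ` {F. F \<subseteq> Ghat_s \<and> finite F})"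
      unfolding b_def using fourier_bessel[OF t0(2) f2] by (intro bdd_aboveI) auto
  qed (simp add: b_def)
  moreover have ab: "norm (a \<pi> y) \<le> b \<pi>" if "\<pi> \<in> Ghat_s" "y \<in> carrier G" for \<pi> y
  proof -
    have "norm (a \<pi> y) = b \<pi> * cmod (coef \<pi> (e \<pi> 1) (e \<pi> 1) y)"
      using half[OF that(1)] by (simp add: a_def b_def norm_mult)
    also have "\<dots> \<le> b \<pi> * 1"
      using coef_norm_le[OF spherical(2)[OF that(1)] refl spherical(3-5)[OF that(1)] that(2)]
      by (intro mult_left_mono) (simp_all add: b_def)
    finally show ?thesis by simp
  qed
  ultimately have ul: "uniform_limit (carrier G) (\<lambda>F y. \<Sum>\<pi>\<in>F. a \<pi> y) (\<lambda>y. \<Sum>\<^sub>\<infinity>\<pi>\<in>Ghat_s. a \<pi> y) (finite_subsets_at_top Ghat_s)"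
    by (intro Weierstrass_m_test_general[of Ghat_s "carrier G" a b])
  define H where "H y = (\<Sum>\<^sub>\<infinity>\<pi>\<in>Ghat_s. a \<pi> y)" for y
  have ca: "cf (a \<pi>)" if "\<pi> \<in> Ghat_s" for \<pi> unfolding a_def using cf_spherical[OF that] by (intro cont_intros)
  have evF: "\<forall>\<^sub>F F in finite_subsets_at_top Ghat_s. F \<subseteq> Ghat_s \<and> finite F"
    unfolding eventually_finite_subsets_at_top by auto
  have cF: "\<forall>\<^sub>F F in finite_subsets_at_top Ghat_s. cf (\<lambda>y. \<Sum>\<pi>\<in>F. a \<pi> y)"
    using evF by eventually_elim (auto intro!: continuous_map_sum ca)
  have cH: "cf H" unfolding H_def by (rule cf_uniform_limit[OF ul cF]) simp
  have cff: "cf (\<lambda>x. complex_of_real (f x))" by (rule continuous_map_of_real[OF f(1)])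
  have "of_real (f y) - H y = 0" if y: "y \<in> carrier G" for y
  proof (rule peter_weyl_uniqueness[OF dual _ _ y])
    show "cf (\<lambda>y. of_real (f y) - H y)" by (intro cont_intros cff cH)
    fix \<rho> i j assume \<rho>: "\<rho> \<in> R" and ij: "i < rep_dim G \<rho>" "j < rep_dim G \<rho>"
    let ?v = "unit_vec (rep_dim G \<rho>) j" and ?w = "unit_vec (rep_dim G \<rho>) i"
    have irr: "irreducible_unitary_rep G T \<rho>" using dual \<rho> by (simp add: is_unitary_dual_def)
    have vw: "?v \<in> carrier_vec (rep_dim G \<rho>)" "?w \<in> carrier_vec (rep_dim G \<rho>)" by auto
    have cc: "cf (coef \<rho> ?v ?w)" by (rule cf_coef[OF irrepD(1)[OF irr] vw])
    \<comment> \<open>The common inner product of \<open>f\<close> and \<open>H\<close> with the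
      coefficient at \<open>?v\<close> and \<open>?w\<close>. It is zero for non-spherical
      \<open>\<rho>\<close>, whose averages vanish and which has no term in the series.\<close>
    define c where "c = (if \<rho> \<in> Ghat_s then fourier \<rho> (e \<rho> 1) t * (e \<rho> 1 \<bullet>c ?v) * cnj (e \<rho> 1 \<bullet>c ?w) else 0)"
    have ipf: "ip (\<lambda>x. of_real (f x)) (coef \<rho> ?v ?w) = c"
    proof (cases "\<rho> \<in> Ghat_s")
      case True
      note sp = spherical[OF True]
      have "ip (\<lambda>x. of_real (f x)) (coef \<rho> ?v ?w) = cnj (\<integral>g. coef \<rho> ?v ?w g \<partial>\<mu> t)"
        by (rule ip_density[OF t0(1) f cc])
      also have "(\<integral>g. coef \<rho> ?v ?w g \<partial>\<mu> t) = cnj (fourier \<rho> (e \<rho> 1) t) * (?v \<bullet>c e \<rho> 1) * (e \<rho> 1 \<bullet>c ?w)"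
        using integral_coef_spherical[OF sp(2) refl sp(3-5) t0(1) vw] fourier_eq[OF sp(2) refl sp(3-5)] by simp
      finally show ?thesis
        using True cscalar_commute[OF vw(1) sp(3)] by (simp add: c_def)
    next
      case False
      then have "v = 0\<^sub>v (rep_dim G \<rho>)" if "v \<in> carrier_vec (rep_dim G \<rho>)" "K_fixed K \<rho> v" for v
        using that \<rho> by (auto simp: spherical_part_def)
      from integral_coef_nonspherical[OF irr refl this t0(1) vw]
      have "cnj (\<integral>g. coef \<rho> ?v ?w g \<partial>\<mu> t) = 0" by simp
      then show ?thesis using False ip_density[OF t0(1) f cc] by (simp add: c_def)
    qed
    have part: "ip (\<lambda>y. \<Sum>\<pi>\<in>F. a \<pi> y) (coef \<rho> ?v ?w) = (if \<rho> \<in> F then c else 0)" if F: "F \<subseteq> Ghat_s" "finite F" for F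
    proof -
      have "ip (\<lambda>y. \<Sum>\<pi>\<in>F. a \<pi> y) (coef \<rho> ?v ?w) =
          (\<Sum>\<pi>\<in>F. (of_nat (rep_dim G \<pi>) * fourier \<pi> (e \<pi> 1) t) * ip (coef \<pi> (e \<pi> 1) (e \<pi> 1)) (coef \<rho> ?v ?w))"
        unfolding a_def using F by (intro ip_sum_left cc cf_spherical) auto
      also have "\<dots> = (\<Sum>\<pi>\<in>F. if \<pi> = \<rho> then c else 0)"
      proof (intro sum.cong refl)
        fix \<pi> assume "\<pi> \<in> F"
        then have S: "\<pi> \<in> Ghat_s" using F by auto
        show "(of_nat (rep_dim G \<pi>) * fourier \<pi> (e \<pi> 1) t) * ip (coef \<pi> (e \<pi> 1) (e \<pi> 1)) (coef \<rho> ?v ?w) =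
            (if \<pi> = \<rho> then c else 0)"
          unfolding ip_spherical[OF S \<rho> vw]
          using irrepD(2)[OF spherical(2)[OF S]] S by (cases "\<pi> = \<rho>") (simp_all add: c_def)
      qed
      finally show ?thesis using F by simp
    qed
    have "\<forall>\<^sub>F F in finite_subsets_at_top Ghat_s. ip (\<lambda>y. \<Sum>\<pi>\<in>F. a \<pi> y) (coef \<rho> ?v ?w) = c"
      unfolding eventually_finite_subsets_at_top
    \<comment> \<open>The witness is {\<rho>} for spherical \<open>\<rho>\<close> and empty
      otherwise: by orthogonality only the term of \<open>\<rho>\<close> contributes, so the inner
      products are constant from there on.\<close>
    proof (intro exI[of _ "Ghat_s \<inter> {\<rho>}"] conjI allI impI)
      fix F assume F: "finite F \<and> Ghat_s \<inter> {\<rho>} \<subseteq> F \<and> F \<subseteq> Ghat_s"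
      then have "ip (\<lambda>y. \<Sum>\<pi>\<in>F. a \<pi> y) (coef \<rho> ?v ?w) = (if \<rho> \<in> F then c else 0)" by (intro part) auto
      also have "\<dots> = c" using F by (auto simp: c_def)
      finally show "ip (\<lambda>y. \<Sum>\<pi>\<in>F. a \<pi> y) (coef \<rho> ?v ?w) = c" .
    qed auto
    then have "((\<lambda>F. ip (\<lambda>y. \<Sum>\<pi>\<in>F. a \<pi> y) (coef \<rho> ?v ?w)) \<longlongrightarrow> c) (finite_subsets_at_top Ghat_s)"
      by (rule tendsto_eventually)
    moreover have "((\<lambda>F. ip (\<lambda>y. \<Sum>\<pi>\<in>F. a \<pi> y) (coef \<rho> ?v ?w)) \<longlongrightarrow> ip H (coef \<rho> ?v ?w)) (finite_subsets_at_top Ghat_s)"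
      unfolding H_def by (rule tendsto_ip_uniform_limit[OF ul cF cH[unfolded H_def] cc])
    ultimately have ipH: "ip H (coef \<rho> ?v ?w) = c"
      using tendsto_unique[OF finite_subsets_at_top_neq_bot] by blast
    have "ip (\<lambda>y. of_real (f y) - H y) (\<lambda>g. \<rho> g $$ (i, j)) = ip (\<lambda>y. of_real (f y) - H y) (coef \<rho> ?v ?w)"
    proof (intro ip_cong refl)
      fix g assume g: "g \<in> carrier G"
      note rc = rep_carrier[OF irrepD(1)[OF irr] g]
      show "\<rho> g $$ (i, j) = coef \<rho> ?v ?w g"
        unfolding coef_def
        using cscalar_unit_vec[OF mult_mat_vec_carrier[OF rc vw(1)] ij(1)] mult_unit_vec_index[OF rc ij(2,1)] by simp
    qed
    also have "\<dots> = 0" using ip_diff_left[OF cff cH cc] ipf ipH by simp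
    finally show "ip (\<lambda>y. of_real (f y) - H y) (\<lambda>g. \<rho> g $$ (i, j)) = 0" .
  qed
  then have "of_real (f x) = H x" using x by simp
  moreover have "((\<lambda>F. \<Sum>\<pi>\<in>F. a \<pi> x) \<longlongrightarrow> H x) (finite_subsets_at_top Ghat_s)"
    unfolding H_def using tendsto_uniform_limitI[OF ul x] .
  ultimately show ?thesis unfolding has_sum_def a_def by simp
qed

text \<open>Parseval in the adapted basis: the sum is the inner product of \<pi>(h) e_1 and \<pi>(g)
  e_1. This links the inner sum of (b) to the coefficient at g^(-1) h.\<close>

lemma sum_matrix_coeff:
  assumes \<pi>: "\<pi> \<in> Ghat_s" and g: "g \<in> carrier G" and h: "h \<in> carrier G"
  shows "(\<Sum>j=1..rep_dim G \<pi>. cnj (matrix_coeff e \<pi> 1 j g) * matrix_coeff e \<pi> 1 j h) =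
    coef \<pi> (e \<pi> 1) (e \<pi> 1) (inv g \<otimes> h)"
proof -
  note sp = spherical[OF \<pi>] and rep = irrepD(1)[OF spherical(2)[OF \<pi>]]
  have v: "\<pi> g *\<^sub>v e \<pi> 1 \<in> carrier_vec (rep_dim G \<pi>)" "\<pi> h *\<^sub>v e \<pi> 1 \<in> carrier_vec (rep_dim G \<pi>)"
    using rep_vec_carrier[OF rep] sp g h by auto
  have "(\<Sum>j=1..rep_dim G \<pi>. cnj (matrix_coeff e \<pi> 1 j g) * matrix_coeff e \<pi> 1 j h) =
      (\<pi> h *\<^sub>v e \<pi> 1) \<bullet>c (\<pi> g *\<^sub>v e \<pi> 1)"
    unfolding matrix_coeff_def
    using basis[OF \<pi>] by (intro parseval_cscalar v) (auto simp: adapted_basis_def)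
  also have "\<dots> = coef \<pi> (e \<pi> 1) (e \<pi> 1) (inv g \<otimes> h)"
    unfolding coef_def using rep_mult_vec[OF rep _ h sp(3), of "inv g"] rep_cscalar[OF rep, of "inv g"] v sp g by simp
  finally show ?thesis .
qed

end

end

section \<open>The transition density on the symmetric space\<close>

text \<open>Bi-invariance lets f(g^(-1) h) descend to pairs of points, and the descended kernel has
  the defining property of the transition density. Full support of Haar measure gives uniqueness, so
  the definite description denotes this kernel.\<close>

lemma transition_density_eq:
  fixes G :: "('x::topological_space \<Rightarrow> 'x) monoid"
  assumes cg: "compact_group G T m" and comp: "\<And>g h x. (g \<otimes>\<^bsub>G\<^esub> h) x = g (h x)" and one: "\<And>x. \<one>\<^bsub>G\<^esub> x = x"
    and ev: "continuous_map T euclidean (\<lambda>g. g p)" and H: "Hausdorff_space (euclidean :: 'x topology)"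
    and trans: "(\<lambda>g. g p) ` carrier G = UNIV" and K: "K = {g \<in> carrier G. g p = p}"
    and f: "continuous_map T euclideanreal f" and nonneg: "\<And>x. x \<in> carrier G \<Longrightarrow> 0 \<le> f x"
    and dens: "\<mu> t = density m (\<lambda>x. ennreal (f x))"
    and fr: "\<And>k x. k \<in> K \<Longrightarrow> x \<in> carrier G \<Longrightarrow> f (x \<otimes>\<^bsub>G\<^esub> k) = f x"
    and fl: "\<And>k x. k \<in> K \<Longrightarrow> x \<in> carrier G \<Longrightarrow> f (k \<otimes>\<^bsub>G\<^esub> x) = f x"
    and g: "g \<in> carrier G" and h: "h \<in> carrier G"
  shows "transition_density G p m \<mu> t (g p) (h p) = f (inv\<^bsub>G\<^esub> g \<otimes>\<^bsub>G\<^esub> h)"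
proof -
  interpret compact_group G T m by (rule cg)
  note mp = borel_prob_haar
  let ?\<sigma> = "distr m borel (\<lambda>g. g p)"
  \<comment> \<open>An arbitrary choice of coset representatives, with no continuity claimed; that
    \<open>k\<close> is continuous is obtained later from a quotient map.\<close>
  define \<gamma> where "\<gamma> x = (SOME g. g \<in> carrier G \<and> g p = x)" for x
  have \<gamma>: "\<gamma> x \<in> carrier G \<and> \<gamma> x p = x" for x
  proof -
    have "x \<in> (\<lambda>g. g p) ` carrier G" unfolding trans by simp
    then have "\<exists>g. g \<in> carrier G \<and> g p = x" by blast
    then show ?thesis unfolding \<gamma>_def by (rule someI_ex)
  qed
  define k where "k x y = f (inv\<^bsub>G\<^esub> (\<gamma> x) \<otimes>\<^bsub>G\<^esub> \<gamma> y)" for x y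
  have inK: "inv\<^bsub>G\<^esub> a \<otimes>\<^bsub>G\<^esub> b \<in> K" if "a \<in> carrier G" "b \<in> carrier G" "a p = b p" for a b
  proof -
    have "(inv\<^bsub>G\<^esub> a \<otimes>\<^bsub>G\<^esub> b) p = (inv\<^bsub>G\<^esub> a \<otimes>\<^bsub>G\<^esub> a) p" unfolding comp using that by simp
    then show ?thesis using that by (simp add: K one)
  qed
  have k: "k (a p) (b p) = f (inv\<^bsub>G\<^esub> a \<otimes>\<^bsub>G\<^esub> b)" if a: "a \<in> carrier G" and b: "b \<in> carrier G" for a b
  proof -
    let ?a = "\<gamma> (a p)" and ?b = "\<gamma> (b p)"
    have ab: "?a \<in> carrier G" "?b \<in> carrier G" using \<gamma> by auto
    have k1: "inv\<^bsub>G\<^esub> ?a \<otimes>\<^bsub>G\<^esub> a \<in> K" and k2: "inv\<^bsub>G\<^esub> b \<otimes>\<^bsub>G\<^esub> ?b \<in> K" using inK a b \<gamma> by auto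
    have "f (inv\<^bsub>G\<^esub> ?a \<otimes>\<^bsub>G\<^esub> ?b) = f ((inv\<^bsub>G\<^esub> ?a \<otimes>\<^bsub>G\<^esub> a) \<otimes>\<^bsub>G\<^esub> (inv\<^bsub>G\<^esub> a \<otimes>\<^bsub>G\<^esub> ?b))"
      using ab a by (simp add: m_assoc) (simp flip: m_assoc)
    also have "\<dots> = f (inv\<^bsub>G\<^esub> a \<otimes>\<^bsub>G\<^esub> ?b)" using k1 a ab by (intro fl) auto
    also have "\<dots> = f ((inv\<^bsub>G\<^esub> a \<otimes>\<^bsub>G\<^esub> b) \<otimes>\<^bsub>G\<^esub> (inv\<^bsub>G\<^esub> b \<otimes>\<^bsub>G\<^esub> ?b))"
      using ab a b by (simp add: m_assoc) (simp flip: m_assoc)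
    also have "\<dots> = f (inv\<^bsub>G\<^esub> a \<otimes>\<^bsub>G\<^esub> b)" using k2 a b by (intro fr) auto
    finally show ?thesis by (simp add: k_def)
  qed
  have evm: "(\<lambda>g. g p) \<in> m \<rightarrow>\<^sub>M borel" by (rule measurable_borel_prob[OF mp ev])
  have int\<sigma>: "(\<integral>y. \<phi> y \<partial>?\<sigma>) = (\<integral>g. \<phi> (g p) \<partial>m)" if "continuous_on UNIV \<phi>" for \<phi> :: "'x \<Rightarrow> real"
    by (rule integral_distr[OF evm borel_measurable_continuous_onI[OF that]])
  have cev: "continuous_map T euclideanreal (\<lambda>g. \<phi> (g p))" if "continuous_on UNIV \<phi>" for \<phi> :: "'x \<Rightarrow> real"
    using continuous_map_compose'[OF _ ev, of euclideanreal \<phi>] that by simp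
  have left_real: "(\<integral>x. \<phi> (a \<otimes>\<^bsub>G\<^esub> x) \<partial>m) = (\<integral>x. \<phi> x \<partial>m)"
    if "continuous_map T euclideanreal \<phi>" "a \<in> carrier G" for \<phi> a
  proof -
    have "complex_of_real (\<integral>x. \<phi> (a \<otimes>\<^bsub>G\<^esub> x) \<partial>m) = complex_of_real (\<integral>x. \<phi> x \<partial>m)"
      using left_invariant[OF continuous_map_of_real[OF that(1)] that(2)] by simp
    then show ?thesis by simp
  qed
  have kc: "continuous_on UNIV (\<lambda>(x, y). k x y)"
  proof -
    \<comment> \<open>A continuous surjection from a compact to a Hausdorff space is closed, hence a
      quotient map, so continuity of \<open>k\<close> may be tested on pairs of group
      elements.\<close>
    let ?q = "\<lambda>(a, b). (a p, b p)" and ?P = "prod_topology T T"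
    have PX: "prod_topology euclidean euclidean = (euclidean :: ('x \<times> 'x) topology)" by (rule prod_topology_euclidean)
    have qc: "continuous_map ?P euclidean ?q"
      unfolding PX[symmetric] case_prod_beta'
      by (intro continuous_map_pairedI continuous_map_compose'[OF ev] continuous_map_fst continuous_map_snd)
    have "Hausdorff_space (prod_topology (euclidean :: 'x topology) (euclidean :: 'x topology))"
      using H by (simp only: Hausdorff_space_prod_topology simp_thms)
    then have "Hausdorff_space (euclidean :: ('x \<times> 'x) topology)" unfolding PX .
    moreover have "compact_space ?P" using compact by (simp add: compact_space_prod_topology)
    ultimately have "closed_map ?P euclidean ?q" using continuous_imp_closed_map[OF qc] by blast
    moreover have "?q ` topspace ?P = topspace euclidean"
    proof -
      have "z \<in> ?q ` (carrier G \<times> carrier G)" for z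
        using \<gamma>[of "fst z"] \<gamma>[of "snd z"] by (intro image_eqI[of _ _ "(\<gamma> (fst z), \<gamma> (snd z))"]) auto
      then show ?thesis using topspace by auto
    qed
    ultimately have quot: "quotient_map ?P euclidean ?q" by (rule continuous_closed_imp_quotient_map[OF qc])
    have "continuous_map ?P euclideanreal (\<lambda>z. f (inv\<^bsub>G\<^esub> (fst z) \<otimes>\<^bsub>G\<^esub> snd z))"
      by (intro continuous_map_compose'[OF f] cont_group)
    then have "continuous_map ?P euclideanreal ((\<lambda>(x, y). k x y) \<circ> ?q)"
      by (rule continuous_map_eq) (auto simp: topspace k)
    then have "continuous_map euclidean euclideanreal (\<lambda>(x, y). k x y)"
      by (simp only: continuous_compose_quotient_map_eq[OF quot])
    then show ?thesis by simp
  qed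
  have slice: "continuous_on UNIV (k' x)" if "continuous_on UNIV (\<lambda>(x, y). k' x y)" for k' :: "'x \<Rightarrow> 'x \<Rightarrow> real" and x
    using continuous_on_compose2[OF that, of UNIV "\<lambda>y. (x, y)"] by (simp add: continuous_on_Pair)
  have kd: "is_continuous_transition_density G p m (\<mu> t) k"
    unfolding is_continuous_transition_density_def
  proof (intro conjI allI impI ballI kc)
    fix x y show "0 \<le> k x y" unfolding k_def using \<gamma> by (intro nonneg) auto
  next
    fix \<phi> :: "'x \<Rightarrow> real" and a assume \<phi>: "continuous_on UNIV \<phi>" and a: "a \<in> carrier G"
    let ?F = "\<lambda>b. \<phi> (b p) * f (inv\<^bsub>G\<^esub> a \<otimes>\<^bsub>G\<^esub> b)"
    have ca: "continuous_map T T (\<lambda>b. a \<otimes>\<^bsub>G\<^esub> b)" "continuous_map T T (\<lambda>b. inv\<^bsub>G\<^esub> a \<otimes>\<^bsub>G\<^esub> b)"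
      using a by (intro cont_group; simp)+
    have F: "continuous_map T euclideanreal ?F"
      by (intro continuous_map_mult cev[OF \<phi>] continuous_map_compose'[OF f ca(2)])
    have "(\<integral>y. \<phi> y * k (a p) y \<partial>?\<sigma>) = (\<integral>b. \<phi> (b p) * k (a p) (b p) \<partial>m)"
      by (intro int\<sigma>[of "\<lambda>y. \<phi> y * k (a p) y"] continuous_on_mult \<phi> slice kc)
    also have "\<dots> = (\<integral>b. ?F b \<partial>m)" using k a by (intro integral_cong'[OF mp]) simp
    also have "\<dots> = (\<integral>b. ?F (a \<otimes>\<^bsub>G\<^esub> b) \<partial>m)" by (rule left_real[OF F a, symmetric])
    also have "\<dots> = (\<integral>b. f b * \<phi> ((a \<otimes>\<^bsub>G\<^esub> b) p) \<partial>m)"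
      using a by (intro integral_cong'[OF mp]) (simp flip: m_assoc)
    also have "\<dots> = (\<integral>b. \<phi> ((a \<otimes>\<^bsub>G\<^esub> b) p) \<partial>\<mu> t)"
    proof -
      have "continuous_map T euclideanreal (\<lambda>b. \<phi> ((a \<otimes>\<^bsub>G\<^esub> b) p))"
        by (rule continuous_map_compose'[OF cev[OF \<phi>] ca(1)])
      then show ?thesis unfolding dens
        using nonneg space_borel_prob[OF mp]
        by (subst integral_density) (auto intro!: measurable_borel_prob[OF mp] f)
    qed
    finally show "(\<integral>y. \<phi> y * k (a p) y \<partial>?\<sigma>) = (\<integral>b. \<phi> ((a \<otimes>\<^bsub>G\<^esub> b) p) \<partial>\<mu> t)" .
  qed
  have "k' = k" if k': "is_continuous_transition_density G p m (\<mu> t) k'" for k'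
  proof (intro ext)
    fix x y
    have k'c: "continuous_on UNIV (\<lambda>(x, y). k' x y)" using k' by (simp add: is_continuous_transition_density_def)
    \<comment> \<open>Testing both kernels with their own difference at \<open>x\<close> makes the
      integral of its square zero.\<close>
    define \<phi> where "\<phi> y = k' x y - k x y" for y
    have c: "continuous_on UNIV (k' x)" "continuous_on UNIV (k x)" using slice kc k'c by auto
    then have \<phi>: "continuous_on UNIV \<phi>" unfolding \<phi>_def by (intro continuous_on_diff)
    have D: "(\<integral>y. \<phi> y * \<kappa> x y \<partial>?\<sigma>) = (\<integral>h. \<phi> ((\<gamma> x \<otimes>\<^bsub>G\<^esub> h) p) \<partial>\<mu> t)"
      if "is_continuous_transition_density G p m (\<mu> t) \<kappa>" for \<kappa>
    proof -
      have "\<forall>g\<in>carrier G. (\<integral>y. \<phi> y * \<kappa> (g p) y \<partial>?\<sigma>) = (\<integral>h. \<phi> ((g \<otimes>\<^bsub>G\<^esub> h) p) \<partial>\<mu> t)"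
        using that \<phi> unfolding is_continuous_transition_density_def by blast
      from bspec[OF this, of "\<gamma> x"] show ?thesis using \<gamma>[of x] by simp
    qed
    have "(\<integral>y. \<phi> y * k' x y \<partial>?\<sigma>) = (\<integral>y. \<phi> y * k x y \<partial>?\<sigma>)"
      unfolding D[OF k'] D[OF kd] ..
    then have eq: "(\<integral>b. \<phi> (b p) * k' x (b p) \<partial>m) = (\<integral>b. \<phi> (b p) * k x (b p) \<partial>m)"
      using int\<sigma>[OF continuous_on_mult[OF \<phi> c(1)]] int\<sigma>[OF continuous_on_mult[OF \<phi> c(2)]] by simp
    have c2: "continuous_map T euclideanreal (\<lambda>b. \<phi> (b p) * k' x (b p))"
        "continuous_map T euclideanreal (\<lambda>b. \<phi> (b p) * k x (b p))"
      using cev[OF continuous_on_mult[OF \<phi> c(1)]] cev[OF continuous_on_mult[OF \<phi> c(2)]] by auto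
    have "(\<integral>b. \<phi> (b p) * k' x (b p) - \<phi> (b p) * k x (b p) \<partial>m) = 0"
      using eq by (simp add: Bochner_Integration.integral_diff integrable_cf[OF mp] c2)
    then have zero: "(\<integral>b. (\<phi> (b p))\<^sup>2 \<partial>m) = 0"
      by (simp add: \<phi>_def power2_eq_square right_diff_distrib)
    have "(\<phi> (\<gamma> y p))\<^sup>2 = 0"
      by (rule haar_full_support[OF _ _ zero]) (use \<gamma> cev[OF \<phi>] in \<open>auto intro: continuous_map_real_pow\<close>)
    then show "k' x y = k x y" using \<gamma>[of y] by (simp add: \<phi>_def)
  qed
  then have "transition_density G p m \<mu> t = k"
    unfolding transition_density_def by (intro the_equality kd)
  then show ?thesis using k[OF g h] by simp
qed

lemma symmetric_space_gelfand_pair: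
  fixes AX :: "('x::topological_space, 'e::euclidean_space) chart set"
    and AG :: "('x \<Rightarrow> 'x, 'f::euclidean_space) chart set"
  assumes X: "compact_irreducible_symmetric_space AX m p G T AG K"
    and mG: "normalised_haar_measure G T mG"
    and mK: "normalised_haar_measure (G\<lparr>carrier := K\<rparr>) (subtopology T K) mK"
    and \<mu>: "K_biinvariant_semigroup G T K mK \<mu>"
  shows "gelfand_pair G T mG K mK \<mu>"
proof -
  have sym: "riemannian_symmetric_space AX m" and G: "G = isometry_group_0 AX m"
    and T: "T = subtopology compact_open_topology (carrier G)" and lie: "lie_group G T AG" and cpt: "compact_space T"
    and act: "smooth_map (prod_topology T euclidean) (prod_atlas AG AX) euclidean AX (\<lambda>(g, x). g x)"
    and K: "K = {g \<in> carrier G. g p = p}"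
    using X by (auto simp: compact_irreducible_symmetric_space_def)
  have M: "smooth_manifold euclidean AX" using sym by (simp add: riemannian_symmetric_space_def)
  have grp: "group G" and top: "topspace T = carrier G" and MG: "smooth_manifold T AG"
    and mul: "continuous_map (prod_topology T T) T (\<lambda>(x, y). x \<otimes>\<^bsub>G\<^esub> y)"
    and inv: "continuous_map T T (\<lambda>x. inv\<^bsub>G\<^esub> x)"
    using lie by (auto simp: lie_group_def smooth_map_def)
  have cg: "compact_group G T mG"
    using MG by (intro compact_group.intro grp top cpt mul inv mG) (simp_all add: smooth_manifold_def)
  interpret compact_group G T mG by (rule cg)
  have comp: "g \<otimes>\<^bsub>G\<^esub> h = g \<circ> h" and one: "\<one>\<^bsub>G\<^esub> = id" for g h
    unfolding G by (simp_all add: isometry_group_0_def)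
  have sub: "subgroup K G"
  proof
    show "K \<subseteq> carrier G" "\<one>\<^bsub>G\<^esub> \<in> K" using one_closed by (auto simp: K one)
    show "x \<otimes>\<^bsub>G\<^esub> y \<in> K" if "x \<in> K" "y \<in> K" for x y using that m_closed[of x y] by (auto simp: K comp)
    show "inv\<^bsub>G\<^esub> x \<in> K" if "x \<in> K" for x
    proof -
      have x: "x \<in> carrier G" "x p = p" using that by (auto simp: K)
      have "(inv\<^bsub>G\<^esub> x \<otimes>\<^bsub>G\<^esub> x) p = p" using l_inv[OF x(1)] by (simp add: one)
      then show ?thesis using x by (simp add: K comp)
    qed
  qed
  obtain s U where s: "s \<in> isometries AX m" "s \<circ> s = id" "s p = p" "open U" "p \<in> U" "\<forall>x\<in>U. s x = x \<longrightarrow> x = p"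
    using sym unfolding riemannian_symmetric_space_def by blast
  define \<theta> where "\<theta> g = s \<circ> g \<circ> s" for g
  have ss: "s (s x) = x" for x using fun_cong[OF s(2), of x] by simp
  have invol: "\<theta> (\<theta> g) = g" for g by (auto simp: \<theta>_def ss)
  have cl: "\<theta> g \<in> carrier G" if "g \<in> carrier G" for g
    using isometry_group_conjugation[OF M s(1,2)] that by (simp add: \<theta>_def G)
  have "\<theta> (g \<otimes>\<^bsub>G\<^esub> h) = \<theta> g \<otimes>\<^bsub>G\<^esub> \<theta> h" for g h by (simp add: comp \<theta>_def fun_eq_iff ss)
  then have hom: "\<theta> \<in> hom G G" using cl by (intro homI)
  have surj: "\<theta> ` carrier G = carrier G"
  proof
    show "\<theta> ` carrier G \<subseteq> carrier G" using cl by blast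
    show "carrier G \<subseteq> \<theta> ` carrier G"
    proof
      fix g assume "g \<in> carrier G"
      then show "g \<in> \<theta> ` carrier G" using invol[of g] cl by (intro image_eqI[of _ _ "\<theta> g"]) simp_all
    qed
  qed
  have "continuous_on UNIV s" using s(1) by (auto simp: isometries_def smooth_map_def)
  then have "continuous_map compact_open_topology compact_open_topology \<theta>"
    unfolding \<theta>_def by (rule conjugation_continuous)
  then have cont: "continuous_map T T \<theta>"
    using cl unfolding T
    by (auto simp: continuous_map_in_subtopology continuous_map_from_subtopology)
  have ev: "continuous_map T euclidean (\<lambda>g. g p)"
  proof -
    have "continuous_map (prod_topology T euclidean) euclidean (\<lambda>(g, x). g x)" using act by (simp add: smooth_map_def)
    from continuous_map_compose'[OF this, of T "\<lambda>g. (g, p)"] show ?thesis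
      using continuous_id' by (simp add: continuous_map_pairedI)
  qed
  obtain N0 where N0: "openin T N0" "\<one>\<^bsub>G\<^esub> \<in> N0" "inj_on (\<lambda>x. x \<otimes>\<^bsub>G\<^esub> x) N0"
    "\<And>N. openin T N \<Longrightarrow> N \<subseteq> N0 \<Longrightarrow> openin T ((\<lambda>x. x \<otimes>\<^bsub>G\<^esub> x) ` N)"
    by (rule lie_group_square_root[OF lie]) blast
  \<comment> \<open>For \<open>h\<close> in \<open>W\<close> fixed by \<open>\<theta>\<close> the
    point \<open>h p\<close> is a fixed point of \<open>s\<close> inside \<open>U\<close>, hence
    equal to \<open>p\<close>: this is how the isolated fixed point places \<open>h\<close> in
    \<open>K\<close>.\<close>
  define W where "W = {g \<in> topspace T. g p \<in> U}"
  have W: "openin T W" unfolding W_def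
    using openin_continuous_map_preimage[OF ev, of U] s(4) by simp
  have W1: "\<one>\<^bsub>G\<^esub> \<in> W" using one_closed s(5) top by (simp add: W_def) (simp add: one)
  have WK: "h \<in> K" if "h \<in> W" "\<theta> h = h" for h
  proof -
    have "s (h p) = (\<theta> h) p" using s(3) by (simp add: \<theta>_def)
    then have "h p = p" using s(6) that by (simp add: W_def)
    then show ?thesis using that top by (simp add: W_def K)
  qed
  obtain V where V: "openin T V" "\<one>\<^bsub>G\<^esub> \<in> V" "\<forall>g\<in>V. \<exists>h\<in>K. \<theta> g = h \<otimes>\<^bsub>G\<^esub> inv\<^bsub>G\<^esub> g \<otimes>\<^bsub>G\<^esub> h"
    using local_cartan_decomposition[OF hom cont invol N0 W W1 WK] by blast
  have conn: "connected_space T"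
  proof -
    have "connectedin (subtopology compact_open_topology (isometries AX m)) (carrier G)"
      unfolding G isometry_group_0_def by (simp add: connectedin_connected_component_of)
    then have "connectedin compact_open_topology (carrier G)" by (simp add: connectedin_subtopology)
    then show ?thesis unfolding T by (simp add: connectedin_def)
  qed
  show ?thesis
  proof (intro gelfand_pair.intro cg gelfand_pair_axioms.intro)
    show "subgroup K G" by (rule sub)
    show "normalised_haar_measure (G\<lparr>carrier := K\<rparr>) (subtopology T K) mK" by (rule mK)
    show "K_biinvariant_semigroup G T K mK \<mu>" by (rule \<mu>)
    fix \<pi> v w
    assume "irreducible_unitary_rep G T \<pi>" "v \<in> carrier_vec (rep_dim G \<pi>)" "K_fixed K \<pi> v"
      "w \<in> carrier_vec (rep_dim G \<pi>)" "K_fixed K \<pi> w" "v \<bullet>c w = 0" "w \<noteq> 0\<^sub>v (rep_dim G \<pi>)"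
    then show "v = 0\<^sub>v (rep_dim G \<pi>)"
      using V sub by (intro K_fixed_unique[OF conn hom cont surj _ _ V(1,2), of K]) (auto simp: subgroup_def)
  qed
qed

theorem theorem5p2:
  fixes AX :: "('x::topological_space, 'e::euclidean_space) chart set"
    and m :: "('x, 'e) metric_tensor"
    and p :: 'x
    and G :: "('x \<Rightarrow> 'x) monoid"
    and T :: "('x \<Rightarrow> 'x) topology"
    and AG :: "('x \<Rightarrow> 'x, 'f::euclidean_space) chart set"
    and K :: "('x \<Rightarrow> 'x) set"
    and mG mK :: "('x \<Rightarrow> 'x) measure"
    and \<mu> :: "real \<Rightarrow> ('x \<Rightarrow> 'x) measure"
    and Ghat :: "('x \<Rightarrow> 'x) rep set"
    and e :: "('x \<Rightarrow> 'x) rep \<Rightarrow> nat \<Rightarrow> complex Matrix.vec"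
  assumes "compact_irreducible_symmetric_space AX m p G T AG K"
    and "normalised_haar_measure G T mG"
    and "normalised_haar_measure (G\<lparr>carrier := K\<rparr>) (subtopology T K) mK"
    and "K_biinvariant_semigroup G T K mK \<mu>"
    and "is_unitary_dual G T Ghat"
    and "\<And>\<pi>. \<pi> \<in> spherical_part G K Ghat \<Longrightarrow> adapted_basis G K \<pi> (e \<pi>)"
  shows "(\<forall>t\<ge>0. \<forall>\<pi>\<in>spherical_part G K Ghat. \<forall>g\<in>carrier G.
           transition_operator G \<mu> t (spherical_function e \<pi>) g =
             exp (- of_real t * characteristic_exponent \<mu> e \<pi>) * spherical_function e \<pi> g) \<and>
         ((\<forall>t>0. has_continuous_density T mG (\<mu> t)) \<longrightarrow>
         (\<forall>t>0. \<forall>g\<in>carrier G. \<forall>h\<in>carrier G.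
            ((\<lambda>\<pi>. of_nat (rep_dim G \<pi>) * exp (- of_real t * cnj (characteristic_exponent \<mu> e \<pi>)) *
                   spherical_function e \<pi> (inv\<^bsub>G\<^esub> g \<otimes>\<^bsub>G\<^esub> h))
              has_sum of_real (transition_density G p mG \<mu> t (g p) (h p)))
              (spherical_part G K Ghat) \<and>
            ((\<lambda>\<pi>. \<Sum>j=1..rep_dim G \<pi>.
                   of_nat (rep_dim G \<pi>) * exp (- of_real t * characteristic_exponent \<mu> e \<pi>) *
                   cnj (matrix_coeff e \<pi> 1 j g) * matrix_coeff e \<pi> 1 j h)
              has_sum of_real (transition_density G p mG \<mu> t (g p) (h p)))
              (spherical_part G K Ghat)))"
proof -
  note X = assms(1)
  note [simp del] = One_nat_def
  have G: "G = isometry_group_0 AX m" and lie: "lie_group G T AG"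
    and act: "smooth_map (prod_topology T euclidean) (prod_atlas AG AX) euclidean AX (\<lambda>(g, x). g x)"
    and stab: "K = {g \<in> carrier G. g p = p}" and trans: "(\<lambda>g. g p) ` carrier G = UNIV"
    and sym: "riemannian_symmetric_space AX m"
    using X by (auto simp: compact_irreducible_symmetric_space_def)
  interpret gelfand_pair G T mG K mK \<mu>
    by (rule symmetric_space_gelfand_pair[OF assms(1-4)])
  note dual = assms(5) and basis = assms(6)
  let ?S = "spherical_part G K Ghat"
  have H: "Hausdorff_space (euclidean :: 'x topology)"
    using sym by (simp add: riemannian_symmetric_space_def smooth_manifold_def)
  have comp: "(g \<otimes>\<^bsub>G\<^esub> h) x = g (h x)" and one: "\<one>\<^bsub>G\<^esub> x = x" for g h x
    unfolding G by (simp_all add: isometry_group_0_def)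
  have ev: "continuous_map T euclidean (\<lambda>g. g p)"
  proof -
    have "continuous_map (prod_topology T euclidean) euclidean (\<lambda>(g, x). g x)" using act by (simp add: smooth_map_def)
    from continuous_map_compose'[OF this, of T "\<lambda>g. (g, p)"] show ?thesis
      using continuous_id' by (simp add: continuous_map_pairedI)
  qed
  show ?thesis
  proof (intro conjI allI ballI impI)
    fix t :: real and \<pi> g assume "0 \<le> t" "\<pi> \<in> ?S" "g \<in> carrier G"
    then show "transition_operator G \<mu> t (spherical_function e \<pi>) g =
        exp (- of_real t * characteristic_exponent \<mu> e \<pi>) * spherical_function e \<pi> g"
      by (intro transition_operator_spherical[OF dual basis])
  next
    fix t :: real and g h
    assume dens: "\<forall>t>0. has_continuous_density T mG (\<mu> t)" and t: "0 < t" and g: "g \<in> carrier G" and h: "h \<in> carrier G"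
    obtain f where f: "continuous_map T euclideanreal f" "\<And>x. x \<in> carrier G \<Longrightarrow> 0 \<le> f x"
        "\<mu> t = density mG (\<lambda>x. ennreal (f x))"
      using dens t topspace unfolding has_continuous_density_def by metis
    obtain f2 where f2: "continuous_map T euclideanreal f2" "\<And>x. x \<in> carrier G \<Longrightarrow> 0 \<le> f2 x"
        "\<mu> (t / 2) = density mG (\<lambda>x. ennreal (f2 x))"
      using dens t topspace unfolding has_continuous_density_def by (metis half_gt_zero)
    have t0: "t \<ge> 0" using t by simp
    let ?x = "inv\<^bsub>G\<^esub> g \<otimes>\<^bsub>G\<^esub> h"
    have x: "?x \<in> carrier G" using g h by simp
    have k: "transition_density G p mG \<mu> t (g p) (h p) = f ?x"
    proof (rule transition_density_eq[where G = G and p = p and f = f and \<mu> = \<mu> and t = t, OF compact_group_axioms comp one ev H trans stab f _ _ g h])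
      fix k x assume "k \<in> K" "x \<in> carrier G"
      then show "f (x \<otimes>\<^bsub>G\<^esub> k) = f x" "f (k \<otimes>\<^bsub>G\<^esub> x) = f x"
        using density_right_K[OF t0 f] density_left_K[OF t0 f] by auto
    qed
    have sum: "((\<lambda>\<pi>. of_nat (rep_dim G \<pi>) * fourier \<pi> (e \<pi> 1) t * coef \<pi> (e \<pi> 1) (e \<pi> 1) ?x) has_sum of_real (f ?x)) ?S"
      by (rule density_expansion[OF dual basis t f f2 x])
    \<comment> \<open>The terms of (a) are the conjugates of those of the expansion, because the
      spherical function is the conjugate coefficient; the sum is unchanged since \<open>f\<close>
      is real.\<close>
    have a: "of_nat (rep_dim G \<pi>) * exp (- of_real t * cnj (characteristic_exponent \<mu> e \<pi>)) * spherical_function e \<pi> ?x =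
        cnj (of_nat (rep_dim G \<pi>) * fourier \<pi> (e \<pi> 1) t * coef \<pi> (e \<pi> 1) (e \<pi> 1) ?x)" if "\<pi> \<in> ?S" for \<pi>
      using spherical_fourier[OF dual basis that t0] spherical_function_coef[OF dual basis that x]
      by (simp add: exp_cnj)
    have b: "(\<Sum>j=1..rep_dim G \<pi>. of_nat (rep_dim G \<pi>) * exp (- of_real t * characteristic_exponent \<mu> e \<pi>) *
          cnj (matrix_coeff e \<pi> 1 j g) * matrix_coeff e \<pi> 1 j h) =
        of_nat (rep_dim G \<pi>) * fourier \<pi> (e \<pi> 1) t * coef \<pi> (e \<pi> 1) (e \<pi> 1) ?x" if "\<pi> \<in> ?S" for \<pi>
      using sum_matrix_coeff[OF dual basis that g h] spherical_fourier[OF dual basis that t0]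
      by (simp add: mult.assoc flip: sum_distrib_left)
    show "((\<lambda>\<pi>. of_nat (rep_dim G \<pi>) * exp (- of_real t * cnj (characteristic_exponent \<mu> e \<pi>)) *
           spherical_function e \<pi> ?x) has_sum of_real (transition_density G p mG \<mu> t (g p) (h p))) ?S"
      unfolding k
    proof (rule iffD2[OF has_sum_cong[OF a]])
      have "((\<lambda>\<pi>. cnj (of_nat (rep_dim G \<pi>) * fourier \<pi> (e \<pi> 1) t * coef \<pi> (e \<pi> 1) (e \<pi> 1) ?x))
          has_sum cnj (of_real (f ?x))) ?S"
        using sum by (simp only: has_sum_cnj_iff)
      then show "((\<lambda>\<pi>. cnj (of_nat (rep_dim G \<pi>) * fourier \<pi> (e \<pi> 1) t * coef \<pi> (e \<pi> 1) (e \<pi> 1) ?x))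
          has_sum of_real (f ?x)) ?S" by (simp only: complex_cnj_complex_of_real)
    qed
    show "((\<lambda>\<pi>. \<Sum>j=1..rep_dim G \<pi>. of_nat (rep_dim G \<pi>) * exp (- of_real t * characteristic_exponent \<mu> e \<pi>) *
           cnj (matrix_coeff e \<pi> 1 j g) * matrix_coeff e \<pi> 1 j h)
        has_sum of_real (transition_density G p mG \<mu> t (g p) (h p))) ?S"
      unfolding k by (rule iffD2[OF has_sum_cong[OF b] sum])
  qed
qed

end
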